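(* Let $I\subset A$ be a proper non-zero ideal, $\Gamma=\Gamma_P(I)$, and $W_1$ a $K$-subspace with $0\subsetneq W_1\subsetneq W$. Let $\mathcal{B}_\bullet(W)_\sigma$ be the subcomplex of $\mathcal{B}_\bullet(W)$ consisting of those simplices $\{\langle L_0\rangle,\dots,\langle L_d\rangle\}$ for which there exists $g\in\Gamma\setminus\{1\}$ with $gL_i=L_i$ for all $i$ and $g|_{W_1}=\mathrm{id}_{W_1}$. Then the geometric realization $|\mathcal{B}_\bullet(W)_\sigma|$ is contractible.
   Context: Let $\mathbb{F}_q$ be a finite field, $C$ a smooth geometrically irreducible projective curve over $\mathbb{F}_q$ with function field $K$, $\infty$ a closed point, $A$ the ring of functions regular outside $\infty$, $R=\mathcal{O}_{C,\infty}$ with uniformizer $\varpi$. $W$ is a $K$-vector space of dimension $r\ge2$. An $R$-lattice is a finitely generated $R$-submodule of $W$ of rank $r$. The Bruhat–Tits building $\mathcal{B}_\bullet(W)$ has as vertices the homothety classes $\langle L\rangle=\{\varpi^nL\}$ of $R$-lattices, and a set of $d+1$ vertices is a simplex iff it has representatives with $L_0\supsetneq L_1\supsetneq\cdots\supsetneq L_d\supsetneq\varpi L_0$. $P\subset W$ is a projective $A$-submodule of rank $r$ with $KP=W$ and $\Gamma_P(I)=\ker(\mathrm{Aut}_A(P)\to\mathrm{Aut}_A(P/IP))$. *)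

theory Defs
  imports "HOL-Analysis.Analysis" "HOL-Computational_Algebra.Polynomial"
    "HOL-Library.Poly_Mapping"
begin

subsection \<open>Modules over a subring of a field\<close>

text \<open>
  The field \<open>K\<close> is a whole type; its subfields and subrings are sets. A module over a subring \<open>S\<close>
  is a subset of a type with a scalar multiplication \<open>s\<close> by \<open>K\<close>.
\<close>

definition subring_of_field :: "'k::field set \<Rightarrow> bool" where
  "subring_of_field S \<longleftrightarrow> 1 \<in> S \<and> (\<forall>x\<in>S. \<forall>y\<in>S. x - y \<in> S \<and> x * y \<in> S)"

definition subfield_of_field :: "'k::field set \<Rightarrow> bool" where
  "subfield_of_field S \<longleftrightarrow> subring_of_field S \<and> (\<forall>x\<in>S. inverse x \<in> S)"

definition submodule_over :: "('k::field \<Rightarrow> 'm::ab_group_add \<Rightarrow> 'm) \<Rightarrow> 'k set \<Rightarrow> 'm set \<Rightarrow> bool" where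
  "submodule_over s S M \<longleftrightarrow>
     0 \<in> M \<and> (\<forall>x\<in>M. \<forall>y\<in>M. x + y \<in> M) \<and> (\<forall>a\<in>S. \<forall>x\<in>M. s a x \<in> M)"

definition module_span :: "('k::field \<Rightarrow> 'm::ab_group_add \<Rightarrow> 'm) \<Rightarrow> 'k set \<Rightarrow> 'm set \<Rightarrow> 'm set" where
  "module_span s S X = submodule_over s S hull X"

definition fin_gen_over :: "('k::field \<Rightarrow> 'm::ab_group_add \<Rightarrow> 'm) \<Rightarrow> 'k set \<Rightarrow> 'm set \<Rightarrow> bool" where
  "fin_gen_over s S M \<longleftrightarrow> (\<exists>X. finite X \<and> M = module_span s S X)"

definition linear_over ::
  "'k::field set \<Rightarrow> 'm::ab_group_add set \<Rightarrow> ('k \<Rightarrow> 'm \<Rightarrow> 'm) \<Rightarrow> ('k \<Rightarrow> 'n::ab_group_add \<Rightarrow> 'n)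
    \<Rightarrow> ('m \<Rightarrow> 'n) \<Rightarrow> bool" where
  "linear_over S M s s' f \<longleftrightarrow>
     (\<forall>x\<in>M. \<forall>y\<in>M. f (x + y) = f x + f y) \<and> (\<forall>a\<in>S. \<forall>x\<in>M. f (s a x) = s' a (f x))"

definition free_module :: "'k::field set \<Rightarrow> 'j set \<Rightarrow> ('j \<Rightarrow>\<^sub>0 'k) set" where
  "free_module S J = {f. Poly_Mapping.keys f \<subseteq> J \<and> (\<forall>j. Poly_Mapping.lookup f j \<in> S)}"

text \<open>
  Projective: a direct summand of a free module. Since \<open>P\<close> is a quotient of the free module on
  its own elements, that free module is a large enough one to test.
\<close>

definition projective_over :: "('k::field \<Rightarrow> 'w::ab_group_add \<Rightarrow> 'w) \<Rightarrow> 'k set \<Rightarrow> 'w set \<Rightarrow> bool" where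
  "projective_over s S P \<longleftrightarrow>
     submodule_over s S P \<and>
     (\<exists>(\<iota> :: 'w \<Rightarrow> 'w \<Rightarrow>\<^sub>0 'k) \<rho>.
        \<iota> ` P \<subseteq> free_module S P \<and>
        linear_over S P s (\<lambda>a. Poly_Mapping.map ((*) a)) \<iota> \<and>
        \<rho> ` free_module S P \<subseteq> P \<and>
        linear_over S (free_module S P) (\<lambda>a. Poly_Mapping.map ((*) a)) s \<rho> \<and>
        (\<forall>x\<in>P. \<rho> (\<iota> x) = x))"

text \<open>
  For a torsion-free module over a subring of \<open>K\<close> sitting in a \<open>K\<close>-vector space, the rank is the
  dimension of its \<open>K\<close>-span, which is what \<open>dim\<close> computes for an arbitrary subset.
\<close>

abbreviation module_rank :: "('k::field \<Rightarrow> 'w::ab_group_add \<Rightarrow> 'w) \<Rightarrow> 'w set \<Rightarrow> nat" where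
  "module_rank s M \<equiv> vector_space.dim s M"

definition ideal_mult :: "('k::field \<Rightarrow> 'w::ab_group_add \<Rightarrow> 'w) \<Rightarrow> 'k set \<Rightarrow> 'k set \<Rightarrow> 'w set \<Rightarrow> 'w set" where
  "ideal_mult s A I P = module_span s A {s a x | a x. a \<in> I \<and> x \<in> P}"


subsection \<open>The curve\<close>

text \<open>
  A smooth geometrically irreducible projective curve \<open>C\<close> over the finite field \<open>F\<close> is given through
  its function field \<open>K\<close>: a finitely generated extension of \<open>F\<close> of transcendence degree 1 in which \<open>F\<close>
  is algebraically closed (this is geometric irreducibility, as \<open>F\<close> is perfect). The closed points of
  \<open>C\<close> correspond to the valuation rings of \<open>K\<close> over \<open>F\<close> other than \<open>K\<close>, a point being sent to its
  local ring, so a closed point is represented by its local ring.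
\<close>

definition algebraic_over :: "'k::field set \<Rightarrow> 'k \<Rightarrow> bool" where
  "algebraic_over F x \<longleftrightarrow> (\<exists>p. p \<noteq> 0 \<and> (\<forall>i. coeff p i \<in> F) \<and> poly p x = 0)"

definition field_adjoin :: "'k::field set \<Rightarrow> 'k \<Rightarrow> 'k set" where
  "field_adjoin F x = {poly p x / poly q x | p q. (\<forall>i. coeff p i \<in> F \<and> coeff q i \<in> F) \<and> poly q x \<noteq> 0}"

definition curve_function_field :: "'k::field set \<Rightarrow> bool" where
  "curve_function_field F \<longleftrightarrow>
     finite F \<and> subfield_of_field F \<and>
     (\<exists>x. \<not> algebraic_over F x \<and> fin_gen_over (*) (field_adjoin F x) (UNIV :: 'k set)) \<and>
     (\<forall>x. algebraic_over F x \<longrightarrow> x \<in> F)"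

definition closed_point :: "'k::field set \<Rightarrow> 'k set \<Rightarrow> bool" where
  "closed_point F R \<longleftrightarrow>
     subring_of_field R \<and> F \<subseteq> R \<and> R \<noteq> UNIV \<and> (\<forall>x. x \<in> R \<or> inverse x \<in> R)"

definition regular_outside :: "'k::field set \<Rightarrow> 'k set \<Rightarrow> 'k set" where
  "regular_outside F R = \<Inter>{R'. closed_point F R' \<and> R' \<noteq> R}"

definition uniformizer :: "'k::field set \<Rightarrow> 'k \<Rightarrow> bool" where
  "uniformizer R \<pi> \<longleftrightarrow> {x \<in> R. \<not> (\<exists>y\<in>R. x * y = 1)} = (*) \<pi> ` R"


subsection \<open>The Bruhat--Tits building\<close>

definition lattice_over :: "('k::field \<Rightarrow> 'w::ab_group_add \<Rightarrow> 'w) \<Rightarrow> 'k set \<Rightarrow> 'w set \<Rightarrow> bool" where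
  "lattice_over s R L \<longleftrightarrow>
     submodule_over s R L \<and> fin_gen_over s R L \<and> module_rank s L = vector_space.dim s (UNIV :: 'w set)"

definition homothety_class :: "('k::field \<Rightarrow> 'w \<Rightarrow> 'w) \<Rightarrow> 'k \<Rightarrow> 'w set \<Rightarrow> 'w set set" where
  "homothety_class s \<pi> L = range (\<lambda>n::int. s (\<pi> powi n) ` L)"

definition building :: "('k::field \<Rightarrow> 'w::ab_group_add \<Rightarrow> 'w) \<Rightarrow> 'k set \<Rightarrow> 'k \<Rightarrow> 'w set set set set" where
  "building s R \<pi> =
     {\<sigma>. \<exists>(d::nat) L. card \<sigma> = d + 1 \<and> \<sigma> = (\<lambda>i. homothety_class s \<pi> (L i)) ` {..d} \<and>
          (\<forall>i\<le>d. lattice_over s R (L i)) \<and>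
          (\<forall>i<d. L (Suc i) \<subset> L i) \<and> s \<pi> ` L 0 \<subset> L d}"


subsection \<open>Congruence subgroups and the subcomplex\<close>

definition module_Aut :: "('k::field \<Rightarrow> 'w::ab_group_add \<Rightarrow> 'w) \<Rightarrow> 'k set \<Rightarrow> 'w set \<Rightarrow> ('w \<Rightarrow> 'w) set" where
  "module_Aut s A P = {\<gamma> \<in> extensional P. bij_betw \<gamma> P P \<and> linear_over A P s s \<gamma>}"

definition congruence_subgroup ::
  "('k::field \<Rightarrow> 'w::ab_group_add \<Rightarrow> 'w) \<Rightarrow> 'k set \<Rightarrow> 'w set \<Rightarrow> 'k set \<Rightarrow> ('w \<Rightarrow> 'w) set" where
  "congruence_subgroup s A P I =
     {\<gamma> \<in> module_Aut s A P. \<forall>x\<in>P. \<gamma> x - x \<in> ideal_mult s A I P}"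

text \<open>
  An automorphism \<open>\<gamma>\<close> of \<open>P\<close> acts on \<open>W = K P\<close> through its unique \<open>K\<close>-linear extension \<open>g\<close>.
  The condition \<open>g L = L\<close> does not depend on the representative \<open>L\<close> of a vertex.
\<close>

definition fixed_subcomplex ::
  "('k::field \<Rightarrow> 'w::ab_group_add \<Rightarrow> 'w) \<Rightarrow> 'k set \<Rightarrow> 'k \<Rightarrow> 'w set \<Rightarrow> ('w \<Rightarrow> 'w) set \<Rightarrow> 'w set
    \<Rightarrow> 'w set set set set" where
  "fixed_subcomplex s R \<pi> P \<Gamma> W\<^sub>1 =
     {\<sigma> \<in> building s R \<pi>. \<exists>\<gamma>\<in>\<Gamma> - {restrict id P}. \<exists>g.
        Vector_Spaces.linear s s g \<and> (\<forall>x\<in>P. g x = \<gamma> x) \<and>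
        (\<forall>v\<in>\<sigma>. \<forall>L\<in>v. g ` L = L) \<and> (\<forall>x\<in>W\<^sub>1. g x = x)}"


subsection \<open>Geometric realization of an abstract simplicial complex\<close>

text \<open>
  Points are given by barycentric coordinates. The topology is the weak one, coherent with the
  closed simplices; on a closed simplex the product topology of \<open>'v \<Rightarrow> real\<close> is the Euclidean topology.
\<close>

definition realization_simplex :: "'v set \<Rightarrow> ('v \<Rightarrow> real) set" where
  "realization_simplex \<sigma> = {t. (\<forall>v. 0 \<le> t v) \<and> (\<forall>v. v \<notin> \<sigma> \<longrightarrow> t v = 0) \<and> sum t \<sigma> = 1}"

definition geometric_realization :: "'v set set \<Rightarrow> ('v \<Rightarrow> real) topology" where
  "geometric_realization \<Delta> = topology (\<lambda>U. U \<subseteq> (\<Union>\<sigma>\<in>\<Delta>. realization_simplex \<sigma>) \<and>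
     (\<forall>\<sigma>\<in>\<Delta>. openin (top_of_set (realization_simplex \<sigma>)) (U \<inter> realization_simplex \<sigma>)))"

lemma openin_geometric_realization:
  "openin (geometric_realization \<Delta>) U \<longleftrightarrow> U \<subseteq> (\<Union>\<sigma>\<in>\<Delta>. realization_simplex \<sigma>) \<and>
     (\<forall>\<sigma>\<in>\<Delta>. openin (top_of_set (realization_simplex \<sigma>)) (U \<inter> realization_simplex \<sigma>))"
proof -
  let ?O = "\<lambda>U. U \<subseteq> (\<Union>\<sigma>\<in>\<Delta>. realization_simplex \<sigma>) \<and>
     (\<forall>\<sigma>\<in>\<Delta>. openin (top_of_set (realization_simplex \<sigma>)) (U \<inter> realization_simplex \<sigma>))"
  have "istopology ?O"
    unfolding istopology_def
  proof (intro conjI allI impI)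
    fix S T assume S: "?O S" and T: "?O T"
    show "S \<inter> T \<subseteq> (\<Union>\<sigma>\<in>\<Delta>. realization_simplex \<sigma>)" using S by blast
    show "\<forall>\<sigma>\<in>\<Delta>. openin (top_of_set (realization_simplex \<sigma>)) (S \<inter> T \<inter> realization_simplex \<sigma>)"
    proof
      fix \<sigma> assume "\<sigma> \<in> \<Delta>"
      then have *: "openin (top_of_set (realization_simplex \<sigma>)) (S \<inter> realization_simplex \<sigma>)"
          "openin (top_of_set (realization_simplex \<sigma>)) (T \<inter> realization_simplex \<sigma>)"
        using S T by (blast, blast)
      have "S \<inter> T \<inter> realization_simplex \<sigma> = (S \<inter> realization_simplex \<sigma>) \<inter> (T \<inter> realization_simplex \<sigma>)"
        by blast
      then show "openin (top_of_set (realization_simplex \<sigma>)) (S \<inter> T \<inter> realization_simplex \<sigma>)"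
        using openin_Int[OF *] by (simp only:)
    qed
  next
    fix \<U> assume U: "\<forall>U\<in>\<U>. ?O U"
    show "\<Union>\<U> \<subseteq> (\<Union>\<sigma>\<in>\<Delta>. realization_simplex \<sigma>)" using U by blast
    show "\<forall>\<sigma>\<in>\<Delta>. openin (top_of_set (realization_simplex \<sigma>)) (\<Union>\<U> \<inter> realization_simplex \<sigma>)"
    proof
      fix \<sigma> assume "\<sigma> \<in> \<Delta>"
      then have "openin (top_of_set (realization_simplex \<sigma>))
          (\<Union>((\<lambda>U. U \<inter> realization_simplex \<sigma>) ` \<U>))"
        using U by (intro openin_Union) blast
      then show "openin (top_of_set (realization_simplex \<sigma>)) (\<Union>\<U> \<inter> realization_simplex \<sigma>)"
        by (simp only: Int_Union2)
    qed
  qed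
  then show ?thesis
    unfolding geometric_realization_def by (simp add: topology_inverse')
qed

lemma topspace_geometric_realization:
  "topspace (geometric_realization \<Delta>) = (\<Union>\<sigma>\<in>\<Delta>. realization_simplex \<sigma>)"
proof -
  have "openin (geometric_realization \<Delta>) (\<Union>\<sigma>\<in>\<Delta>. realization_simplex \<sigma>)"
    unfolding openin_geometric_realization
  proof (intro conjI ballI subset_refl)
    fix \<sigma> assume "\<sigma> \<in> \<Delta>"
    then have "(\<Union>\<sigma>\<in>\<Delta>. realization_simplex \<sigma>) \<inter> realization_simplex \<sigma> = realization_simplex \<sigma>"
      by blast
    then show "openin (top_of_set (realization_simplex \<sigma>))
        ((\<Union>\<sigma>\<in>\<Delta>. realization_simplex \<sigma>) \<inter> realization_simplex \<sigma>)"
      by simp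
  qed
  then show ?thesis
    unfolding topspace_def using openin_geometric_realization by blast
qed

end

theory Submission
  imports Defs
begin

text \<open>
  Choose a transvection \<open>g\<^sub>0 = 1 + h\<close> in \<open>\<Gamma>\<close> with \<open>h = f(\<cdot>) w\<close>, \<open>w \<in> W\<^sub>1\<close> and \<open>f\<close> vanishing on \<open>W\<^sub>1\<close>, and a
  lattice \<open>L\<^sub>0\<close> with \<open>M = h L\<^sub>0 \<subseteq> L\<^sub>0\<close>. Represent each vertex by its largest representative \<open>L \<subseteq> L\<^sub>0\<close>.
  If \<open>g\<close> stabilises \<open>L\<close> and is the identity on \<open>W\<^sub>1\<close>, it also stabilises all \<open>L + \<pi>\<^sup>n M\<close>, because \<open>M \<subseteq> W\<^sub>1\<close>;
  letting \<open>n\<close> decrease from infinity to 0 deforms the complex into the part where \<open>M \<subseteq> L\<close>. There \<open>g\<^sub>0\<close>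
  stabilises everything between \<open>M\<close> and \<open>L\<^sub>0\<close>, in particular all \<open>L + M + \<pi>\<^sup>n L\<^sub>0\<close>, and letting \<open>n\<close> decrease
  to 0 contracts that part to \<open>L\<^sub>0\<close>.

  On the algebraic side this needs that \<open>K\<close> is the union of the \<open>\<pi>\<^sup>-\<^sup>n R\<close> and the fraction field of \<open>A\<close>.
  Both follow from the algebraic dependence of any two elements of \<open>K\<close>, a counting argument over the
  finite field. Riemann--Roch is avoided: that \<open>A\<close> is not just the constants is seen from its proper
  non-zero ideal \<open>I\<close>.
\<close>

subsection \<open>Maps out of and into a geometric realization\<close>

text \<open>The steps n + 1 and n of a deformation by adding modules K n cannot be joined by
  straight lines: for lattices L \<subset> L', the sums L + K n and L' + K (n+1) may be
  incomparable. A chain survives when the larger lattices are ahead, so barycentric mass is moved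
  starting from the largest lattice, and only one lattice of a simplex is in transit at a time. The
  number of steps that move a given simplex has no common bound; infinitely many of them are
  compressed into [0,1], and the weak topology reduces continuity to single simplices. Two
  deformations are used because of the stabilisers. The element g belonging to a simplex need not
  stabilise \<open>L\<^sub>0\<close>, so it is no witness for the sums with \<pi>^n
  \<open>L\<^sub>0\<close>; but it fixes \<pi>^n M pointwise. Once M lies in all lattices, the
  single element \<open>g\<^sub>0\<close> is a witness for every simplex. Representatives inside
  \<open>L\<^sub>0\<close> give each simplex a definite order by inclusion, and adding submodules of
  \<open>L\<^sub>0\<close> never calls for rescaling.\<close>

lemma closed_realization_simplex: "closed (realization_simplex \<sigma>)"
proof -
  have c: "continuous_on UNIV (\<lambda>t::'a \<Rightarrow> real. t v)" for v
    by (rule continuous_on_product_coordinates)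
  have "realization_simplex \<sigma> = (\<Inter>v. {t. 0 \<le> t v}) \<inter> (\<Inter>v\<in>-\<sigma>. {t. t v = 0}) \<inter> {t. sum t \<sigma> = 1}"
    unfolding realization_simplex_def by auto
  moreover have "closed {t::'a \<Rightarrow> real. 0 \<le> t v}" "closed {t::'a \<Rightarrow> real. t v = 0}" for v
    by (intro closed_Collect_le closed_Collect_eq continuous_on_const c)+
  moreover have "closed {t::'a \<Rightarrow> real. sum t \<sigma> = 1}"
    by (intro closed_Collect_eq continuous_on_const continuous_on_sum c)
  ultimately show ?thesis by (auto intro!: closed_Int)
qed

lemma closedin_geometric_realization:
  assumes "closedin (geometric_realization \<Delta>) C" "\<rho> \<in> \<Delta>"
  shows "closed (C \<inter> realization_simplex \<rho>)"
proof -
  have "C \<subseteq> topspace (geometric_realization \<Delta>)"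
    and "openin (geometric_realization \<Delta>) (topspace (geometric_realization \<Delta>) - C)"
    using assms(1) by (auto simp: closedin_def)
  then have "openin (top_of_set (realization_simplex \<rho>))
      ((topspace (geometric_realization \<Delta>) - C) \<inter> realization_simplex \<rho>)"
    using assms(2) unfolding openin_geometric_realization by blast
  moreover have "(topspace (geometric_realization \<Delta>) - C) \<inter> realization_simplex \<rho>
      = realization_simplex \<rho> - (C \<inter> realization_simplex \<rho>)"
    using assms(2) unfolding topspace_geometric_realization by blast
  ultimately have "closedin (top_of_set (realization_simplex \<rho>)) (C \<inter> realization_simplex \<rho>)"
    by (simp add: closedin_def)
  then show ?thesis
    using closed_realization_simplex closedin_closed_trans by blast
qed

text \<open>Continuity in coordinates is weaker than continuity for the weak topology. It suffices
  when finitely many simplices cover the image, since the preimage of a closed set is then a finite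
  union of closed sets.\<close>

lemma continuous_map_into_realization:
  assumes f: "continuous_map X euclidean f" and "finite D" "D \<subseteq> \<Delta>"
    and im: "\<And>x. x \<in> topspace X \<Longrightarrow> f x \<in> (\<Union>\<rho>\<in>D. realization_simplex \<rho>)"
  shows "continuous_map X (geometric_realization \<Delta>) f"
  unfolding continuous_map_closedin topspace_geometric_realization
proof (intro conjI allI impI ballI Pi_I)
  show "f x \<in> (\<Union>\<rho>\<in>\<Delta>. realization_simplex \<rho>)" if "x \<in> topspace X" for x
    using im[OF that] \<open>D \<subseteq> \<Delta>\<close> by blast
next
  fix C assume C: "closedin (geometric_realization \<Delta>) C"
  have "{x \<in> topspace X. f x \<in> C} = (\<Union>\<rho>\<in>D. {x \<in> topspace X. f x \<in> C \<inter> realization_simplex \<rho>})"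
    using im by fastforce
  moreover have "closedin X {x \<in> topspace X. f x \<in> C \<inter> realization_simplex \<rho>}" if "\<rho> \<in> D" for \<rho>
    using closedin_continuous_map_preimage[OF f] closedin_geometric_realization[OF C] that \<open>D \<subseteq> \<Delta>\<close>
    by (metis closed_closedin subsetD)
  ultimately show "closedin X {x \<in> topspace X. f x \<in> C}"
    using \<open>finite D\<close> by (auto intro!: closedin_Union)
qed

lemma continuous_map_from_realization:
  assumes "\<And>\<sigma>. \<sigma> \<in> \<Delta> \<Longrightarrow> continuous_map (top_of_set (realization_simplex \<sigma>)) Y f"
  shows "continuous_map (geometric_realization \<Delta>) Y f"
  unfolding continuous_map_def topspace_geometric_realization openin_geometric_realization
proof (intro conjI allI impI ballI Pi_I)
  fix x assume "x \<in> (\<Union>\<sigma>\<in>\<Delta>. realization_simplex \<sigma>)"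
  then show "f x \<in> topspace Y"
    using continuous_map_image_subset_topspace[OF assms] by force
next
  fix U \<sigma> assume U: "openin Y U" and \<sigma>: "\<sigma> \<in> \<Delta>"
  have "{x \<in> \<Union> (realization_simplex ` \<Delta>). f x \<in> U} \<inter> realization_simplex \<sigma>
      = {x \<in> topspace (top_of_set (realization_simplex \<sigma>)). f x \<in> U}"
    using \<sigma> by auto
  then show "openin (top_of_set (realization_simplex \<sigma>))
      ({x \<in> \<Union> (realization_simplex ` \<Delta>). f x \<in> U} \<inter> realization_simplex \<sigma>)"
    using openin_continuous_map_preimage[OF assms[OF \<sigma>] U] by simp
qed auto

text \<open>Presents the weak topology as glued from closed simplices, so that the theory of
  products of quotient maps applies to homotopies.\<close>

lemma quotient_map_realization:
  "quotient_map (sum_topology (\<lambda>\<sigma>. top_of_set (realization_simplex \<sigma>)) \<Delta>)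
     (geometric_realization \<Delta>) snd"
  unfolding quotient_map_def
proof (intro conjI allI impI)
  show "snd ` topspace (sum_topology (\<lambda>\<sigma>. top_of_set (realization_simplex \<sigma>)) \<Delta>)
      = topspace (geometric_realization \<Delta>)"
    by (force simp: topspace_geometric_realization image_iff)
  fix U assume U: "U \<subseteq> topspace (geometric_realization \<Delta>)"
  have "{x. (\<sigma>, x) \<in> {x \<in> topspace (sum_topology (\<lambda>\<sigma>. top_of_set (realization_simplex \<sigma>)) \<Delta>). snd x \<in> U}}
      = U \<inter> realization_simplex \<sigma>" if "\<sigma> \<in> \<Delta>" for \<sigma>
    using that by auto
  then show "openin (sum_topology (\<lambda>\<sigma>. top_of_set (realization_simplex \<sigma>)) \<Delta>)
         {x \<in> topspace (sum_topology (\<lambda>\<sigma>. top_of_set (realization_simplex \<sigma>)) \<Delta>). snd x \<in> U} =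
        openin (geometric_realization \<Delta>) U"
    using U unfolding openin_sum_topology openin_geometric_realization topspace_geometric_realization
    by auto
qed

text \<open>A product with a coherent topology need not be coherent with the products of the pieces.
  Here it is, because the interval is locally compact Hausdorff, and the product of a quotient map
  with the identity of such a space is a quotient map.\<close>

lemma continuous_map_prod_realization:
  assumes h: "\<And>\<sigma>. \<sigma> \<in> \<Delta> \<Longrightarrow>
    continuous_map (top_of_set ({0..1::real} \<times> realization_simplex \<sigma>)) Y h"
  shows "continuous_map (prod_topology (top_of_set {0..1::real}) (geometric_realization \<Delta>)) Y h"
proof -
  let ?I = "top_of_set {0..1::real}"
  let ?S = "\<lambda>\<sigma>. top_of_set (realization_simplex \<sigma>)"
  have lc: "locally_compact_space ?I"
    by (intro compact_imp_locally_compact_space compact_space_subtopology) simp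
  have hd: "Hausdorff_space ?I"
    by (intro Hausdorff_space_subtopology) simp
  have q: "quotient_map (prod_topology ?I (sum_topology ?S \<Delta>))
      (prod_topology ?I (geometric_realization \<Delta>)) (\<lambda>(x,y). (x, snd y))"
    by (rule quotient_map_prod_right[OF lc disjI1[OF hd] quotient_map_realization])
  have "continuous_map (prod_topology ?I (sum_topology ?S \<Delta>)) Y (h \<circ> (\<lambda>(x,y). (x, snd y)))"
    unfolding continuous_map_def
  proof (intro conjI allI impI Pi_I)
    fix p assume "p \<in> topspace (prod_topology ?I (sum_topology ?S \<Delta>))"
    then obtain s \<sigma> x where p: "p = (s, \<sigma>, x)" "s \<in> {0..1}" "\<sigma> \<in> \<Delta>" "x \<in> realization_simplex \<sigma>"
      by auto
    then show "(h \<circ> (\<lambda>(x,y). (x, snd y))) p \<in> topspace Y"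
      using continuous_map_image_subset_topspace[OF h[OF p(3)]] by force
  next
    fix U assume U: "openin Y U"
    show "openin (prod_topology ?I (sum_topology ?S \<Delta>))
        {p \<in> topspace (prod_topology ?I (sum_topology ?S \<Delta>)). (h \<circ> (\<lambda>(x,y). (x, snd y))) p \<in> U}"
      (is "openin _ ?P")
      unfolding openin_prod_topology_alt
    proof (intro allI impI)
      fix s y assume "(s, y) \<in> ?P"
      then obtain \<sigma> x where y: "y = (\<sigma>, x)" "s \<in> {0..1}" "\<sigma> \<in> \<Delta>" "x \<in> realization_simplex \<sigma>" "h (s, x) \<in> U"
        by auto
      have "openin (prod_topology ?I (?S \<sigma>)) {q \<in> {0..1} \<times> realization_simplex \<sigma>. h q \<in> U}"
        using openin_continuous_map_preimage[OF h[OF y(3)] U]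
        by (simp add: subtopology_Times)
      moreover have "(s, x) \<in> {q \<in> {0..1} \<times> realization_simplex \<sigma>. h q \<in> U}"
        using y by simp
      ultimately obtain V T where VT: "openin ?I V" "openin (?S \<sigma>) T" "s \<in> V" "x \<in> T"
          "V \<times> T \<subseteq> {q \<in> {0..1} \<times> realization_simplex \<sigma>. h q \<in> U}"
        by (elim openin_prod_topology_alt[THEN iffD1, rule_format, elim_format] exE conjE)
      have "{x. (i, x) \<in> {\<sigma>} \<times> T} = (if i = \<sigma> then T else {})" for i
        by auto
      then have "openin (sum_topology ?S \<Delta>) ({\<sigma>} \<times> T)"
        using VT(2) y(3) openin_subset[OF VT(2)] by (auto simp: openin_sum_topology)
      moreover have "V \<times> ({\<sigma>} \<times> T) \<subseteq> ?P"
        using VT(5) y(3) by auto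
      ultimately show "\<exists>V T. openin ?I V \<and> openin (sum_topology ?S \<Delta>) T \<and> s \<in> V \<and> y \<in> T \<and> V \<times> T \<subseteq> ?P"
        using VT y(1) by (intro exI[of _ V] exI[of _ "{\<sigma>} \<times> T"]) auto
    qed
  qed
  then show ?thesis
    by (rule continuous_compose_quotient_map[OF q])
qed

subsection \<open>Moving mass along a sequence of vertex maps\<close>

text \<open>For a \<le> b this is the length of the part of [a,b] inside the window
  [\<tau> - n, \<tau> - n + 1]. As a difference of clamped endpoints it is visibly
  continuous.\<close>

definition interval_overlap :: "real \<Rightarrow> nat \<Rightarrow> real \<Rightarrow> real \<Rightarrow> real" where
  "interval_overlap \<tau> n a b =
     max (\<tau> - real n) (min (\<tau> - real n + 1) b) - max (\<tau> - real n) (min (\<tau> - real n + 1) a)"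

lemma interval_overlap_nonneg: "a \<le> b \<Longrightarrow> 0 \<le> interval_overlap \<tau> n a b"
  unfolding interval_overlap_def by (simp add: max_def min_def)

lemma interval_overlap_eq_0:
  "a \<le> b \<Longrightarrow> b \<le> \<tau> - real n \<or> \<tau> - real n + 1 \<le> a \<Longrightarrow> interval_overlap \<tau> n a b = 0"
  unfolding interval_overlap_def by (auto simp: max_def min_def)

lemma sum_interval_overlap:
  assumes "0 \<le> \<tau>" "0 \<le> a" "a \<le> b" "b \<le> 1" "\<tau> \<le> real m"
  shows "(\<Sum>n\<le>m. interval_overlap \<tau> n a b) = b - a"
proof -
  \<comment> \<open>The windows of index 0, ..., k are consecutive, so the sum is the overlap with
    [\<tau> - k, \<tau> + 1]; for k = m this window contains [0,1].\<close>
  have "(\<Sum>n\<le>k. interval_overlap \<tau> n a b)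
      = max (\<tau> - real k) (min (\<tau> + 1) b) - max (\<tau> - real k) (min (\<tau> + 1) a)" for k
    by (induction k) (auto simp: interval_overlap_def max_def min_def)
  from this[of m] show ?thesis
    using assms by (auto simp: max_def min_def)
qed

text \<open>The right end of the interval belonging to v; the left end is
  \<open>mass_below key x v - x v\<close>. Summing over the support of x avoids a choice of
  simplex.\<close>

definition mass_below :: "('v \<Rightarrow> 'b::order) \<Rightarrow> ('v \<Rightarrow> real) \<Rightarrow> 'v \<Rightarrow> real" where
  "mass_below key x v = (\<Sum>u | x u \<noteq> 0 \<and> key u \<le> key v. x u)"

text \<open>
  The vertices of a simplex are linearly ordered by \<open>key\<close>, so a point \<open>x\<close> of it cuts \<open>[0,1]\<close> into
  consecutive intervals of lengths \<open>x v\<close>. At time \<open>\<tau>\<close> the mass at position \<open>u\<close> of the interval of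
  \<open>v\<close> sits at \<open>\<phi> n v\<close>, where \<open>n\<close> is the integral part of \<open>\<tau> + 1 - u\<close>.
\<close>

definition mass_flow ::
  "('v \<Rightarrow> 'b::order) \<Rightarrow> (nat \<Rightarrow> 'v \<Rightarrow> 'v) \<Rightarrow> real \<Rightarrow> ('v \<Rightarrow> real) \<Rightarrow> 'v \<Rightarrow> real" where
  "mass_flow key \<phi> \<tau> x w = (\<Sum>v | x v \<noteq> 0. \<Sum>n\<le>nat \<lceil>\<tau>\<rceil>.
     of_bool (\<phi> n v = w) * interval_overlap \<tau> n (mass_below key x v - x v) (mass_below key x v))"

lemma mass_below_eq:
  assumes "finite \<sigma>" "x \<in> realization_simplex \<sigma>"
  shows "mass_below key x v = (\<Sum>u | u \<in> \<sigma> \<and> key u \<le> key v. x u)"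
  unfolding mass_below_def using assms
  by (intro sum.mono_neutral_left) (auto simp: realization_simplex_def)

lemma mass_below_bounds:
  assumes "finite \<sigma>" "x \<in> realization_simplex \<sigma>" "v \<in> \<sigma>"
  shows "0 \<le> mass_below key x v - x v" "mass_below key x v - x v \<le> mass_below key x v"
    "mass_below key x v \<le> 1"
proof -
  have nn: "0 \<le> x u" and s1: "sum x \<sigma> = 1" for u
    using assms(2) by (auto simp: realization_simplex_def)
  have e: "mass_below key x v = (\<Sum>u | u \<in> \<sigma> \<and> key u \<le> key v. x u)"
    by (rule mass_below_eq[OF assms(1,2)])
  have "x v \<le> (\<Sum>u | u \<in> \<sigma> \<and> key u \<le> key v. x u)"
    using assms nn by (intro member_le_sum) auto
  then show "0 \<le> mass_below key x v - x v" using e by simp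
  show "mass_below key x v - x v \<le> mass_below key x v" using nn[of v] by simp
  have "(\<Sum>u | u \<in> \<sigma> \<and> key u \<le> key v. x u) \<le> sum x \<sigma>"
    using assms nn by (intro sum_mono2) auto
  then show "mass_below key x v \<le> 1" using e s1 by simp
qed

lemma mass_below_strict:
  assumes "finite \<sigma>" "x \<in> realization_simplex \<sigma>" "v \<in> \<sigma>" "key u < key v"
  shows "mass_below key x u \<le> mass_below key x v - x v"
proof -
  have nn: "0 \<le> x u" for u
    using assms(2) by (auto simp: realization_simplex_def)
  have "mass_below key x v = x v + (\<Sum>u | u \<in> \<sigma> \<and> key u \<le> key v \<and> u \<noteq> v. x u)"
    unfolding mass_below_eq[OF assms(1,2)]
    using assms by (subst sum.remove[of _ v]) (auto intro!: sum.cong)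
  moreover have "(\<Sum>w | w \<in> \<sigma> \<and> key w \<le> key u. x w) \<le> (\<Sum>u | u \<in> \<sigma> \<and> key u \<le> key v \<and> u \<noteq> v. x u)"
    using assms nn by (intro sum_mono2) (auto dest: order.trans[OF _ less_imp_le])
  ultimately show ?thesis
    unfolding mass_below_eq[OF assms(1,2)] by simp
qed

text \<open>Replaces the varying support and the cutoff depending on \<tau> by fixed finite ranges:
  vertices outside the support have intervals of length 0, and windows beyond the cutoff end at or
  before 0.\<close>

lemma mass_flow_eq:
  assumes "finite \<sigma>" "x \<in> realization_simplex \<sigma>" "0 \<le> \<tau>" "\<tau> \<le> real m"
  shows "mass_flow key \<phi> \<tau> x w = (\<Sum>v\<in>\<sigma>. \<Sum>n\<le>m.
     of_bool (\<phi> n v = w) * interval_overlap \<tau> n (mass_below key x v - x v) (mass_below key x v))"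
proof -
  let ?f = "\<lambda>v n. of_bool (\<phi> n v = w) * interval_overlap \<tau> n (mass_below key x v - x v) (mass_below key x v)"
  have m: "nat \<lceil>\<tau>\<rceil> \<le> m" using assms(4) by linarith
  have in_\<sigma>: "v \<in> \<sigma>" if "x v \<noteq> 0" for v
    using assms(2) that by (auto simp: realization_simplex_def)
  have *: "(\<Sum>n\<le>nat \<lceil>\<tau>\<rceil>. ?f v n) = (\<Sum>n\<le>m. ?f v n)" if "x v \<noteq> 0" for v
  proof (rule sum.mono_neutral_left)
    show "\<forall>n\<in>{..m} - {..nat \<lceil>\<tau>\<rceil>}. ?f v n = 0"
    proof
      fix n assume "n \<in> {..m} - {..nat \<lceil>\<tau>\<rceil>}"
      then have "\<tau> - real n + 1 \<le> 0" by auto linarith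
      then have "interval_overlap \<tau> n (mass_below key x v - x v) (mass_below key x v) = 0"
        using mass_below_bounds[OF assms(1,2) in_\<sigma>[OF that], of key]
        by (intro interval_overlap_eq_0) auto
      then show "?f v n = 0" by simp
    qed
  qed (use m in auto)
  have "mass_flow key \<phi> \<tau> x w = (\<Sum>v | x v \<noteq> 0. \<Sum>n\<le>m. ?f v n)"
    unfolding mass_flow_def by (rule sum.cong[OF refl], rule *) blast
  also have "\<dots> = (\<Sum>v\<in>\<sigma>. \<Sum>n\<le>m. ?f v n)"
    using assms(1) in_\<sigma> by (intro sum.mono_neutral_left) (auto simp: interval_overlap_def)
  finally show ?thesis .
qed

text \<open>Keys live in a partial order and are comparable only within \<open>T\<close>, so a
  minimal element is taken and seen to be least.\<close>

lemma finite_chain_least: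
  fixes key :: "'v \<Rightarrow> 'b::order"
  assumes "finite T" "T \<noteq> {}" and lin: "\<And>u v. u \<in> T \<Longrightarrow> v \<in> T \<Longrightarrow> key u \<le> key v \<or> key v \<le> key u"
  obtains w where "w \<in> T" "\<And>v. v \<in> T \<Longrightarrow> key w \<le> key v"
proof -
  obtain m where m: "m \<in> key ` T" "\<forall>b\<in>key ` T. b \<le> m \<longrightarrow> m = b"
    using finite_has_minimal[of "key ` T"] assms(1,2) by auto
  then obtain w where w: "w \<in> T" "m = key w" by auto
  have "key w \<le> key v" if "v \<in> T" for v
    using lin[OF w(1) that] m(2) that w(2) by auto
  with w(1) that show thesis by blast
qed

lemma finite_chain_greatest:
  fixes key :: "'v \<Rightarrow> 'b::order"
  assumes "finite T" "T \<noteq> {}" and lin: "\<And>u v. u \<in> T \<Longrightarrow> v \<in> T \<Longrightarrow> key u \<le> key v \<or> key v \<le> key u"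
  obtains w where "w \<in> T" "\<And>v. v \<in> T \<Longrightarrow> key v \<le> key w"
proof -
  obtain m where m: "m \<in> key ` T" "\<forall>b\<in>key ` T. m \<le> b \<longrightarrow> m = b"
    using finite_has_maximal[of "key ` T"] assms(1,2) by auto
  then obtain w where w: "w \<in> T" "m = key w" by auto
  have "key v \<le> key w" if "v \<in> T" for v
    using lin[OF w(1) that] m(2) that w(2) by auto
  with w(1) that show thesis by blast
qed

text \<open>For \<tau> in [n, n+1) only the windows of index n and n + 1 overlap [0,1], and the
  position \<tau> - n separates them. Let w be the vertex whose interval contains this cut. Vertices
  above w sit at index n, those below at index n + 1, and w may be split between the two; this is
  the set that \<open>\<rho> w\<close> has to contain.\<close>

lemma mass_flow_in_simplex:
  assumes fin: "finite \<sigma>" and x: "x \<in> realization_simplex \<sigma>"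
    and lin: "\<And>u v. u \<in> \<sigma> \<Longrightarrow> v \<in> \<sigma> \<Longrightarrow> key u \<le> key v \<or> key v \<le> key u"
    and \<tau>: "0 \<le> \<tau>" "real n \<le> \<tau>" "\<tau> < real n + 1"
    and car: "\<And>w. w \<in> \<sigma> \<Longrightarrow> finite (\<rho> w) \<and>
      \<phi> n ` {v \<in> \<sigma>. key w \<le> key v} \<union> \<phi> (Suc n) ` {v \<in> \<sigma>. key v \<le> key w} \<subseteq> \<rho> w"
  shows "\<exists>w\<in>\<sigma>. mass_flow key \<phi> \<tau> x \<in> realization_simplex (\<rho> w)"
proof -
  let ?B = "mass_below key x"
  let ?o = "\<lambda>k v. interval_overlap \<tau> k (?B v - x v) (?B v)"
  have s1: "sum x \<sigma> = 1"
    using x by (auto simp: realization_simplex_def)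
  have ne: "\<sigma> \<noteq> {}" using s1 by auto
  define u where "u = \<tau> - real n"
  have u: "0 \<le> u" "u < 1" using \<tau> by (auto simp: u_def)
  obtain t where t: "t \<in> \<sigma>" "\<And>v. v \<in> \<sigma> \<Longrightarrow> key v \<le> key t"
    using finite_chain_greatest[of \<sigma> key, OF fin ne lin] by blast
  then have "{u. u \<in> \<sigma> \<and> key u \<le> key t} = \<sigma>" by auto
  then have "?B t = 1"
    unfolding mass_below_eq[OF fin x] using s1 by simp
  \<comment> \<open>The vertices whose intervals extend beyond the cut u; the least of them is the
    one being cut. There is one because the topmost interval ends at 1.\<close>
  define T where "T = {v \<in> \<sigma>. u < ?B v}"
  have "t \<in> T" using t \<open>?B t = 1\<close> u by (auto simp: T_def)
  then have "finite T" "T \<noteq> {}" using fin by (auto simp: T_def)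
  moreover have "key u \<le> key v \<or> key v \<le> key u" if "u \<in> T" "v \<in> T" for u v
    using lin that by (auto simp: T_def)
  ultimately obtain w where w: "w \<in> T" "\<And>v. v \<in> T \<Longrightarrow> key w \<le> key v"
    using finite_chain_least[of T key] by blast
  have w\<sigma>: "w \<in> \<sigma>" "u < ?B w" using w by (auto simp: T_def)
  have key: "\<phi> k v \<in> \<rho> w" if v: "v \<in> \<sigma>" and o: "?o k v \<noteq> 0" for k v
  proof -
    have b: "?B v - x v \<le> ?B v" "0 \<le> ?B v - x v" "?B v \<le> 1" using mass_below_bounds[OF fin x v, of key] by auto
    have *: "\<tau> - real k < ?B v" "?B v - x v < \<tau> - real k + 1"
      using o interval_overlap_eq_0[OF b(1)] by (meson not_less)+
    then have "real n < real k + 1" "real k < real n + 2" using b \<tau> by auto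
    then consider "k = n" | "k = Suc n" by linarith
    then show ?thesis
    proof cases
      case 1
      then have "v \<in> T" using * v by (auto simp: T_def u_def)
      then show ?thesis using w(2) car[OF w\<sigma>(1)] v 1 by auto
    next
      case 2
      then have "?B v - x v < u" using * by (auto simp: u_def)
      then have "\<not> key w < key v"
        using mass_below_strict[OF fin x v, of key w] w\<sigma>(2) by auto
      then have "key v \<le> key w" using lin[OF v w\<sigma>(1)] by (auto simp: order.order_iff_strict)
      then show ?thesis using car[OF w\<sigma>(1)] v 2 by auto
    qed
  qed
  define m where "m = Suc n"
  have m: "\<tau> \<le> real m" using \<tau> by (simp add: m_def)
  have eq: "mass_flow key \<phi> \<tau> x y = (\<Sum>v\<in>\<sigma>. \<Sum>k\<le>m. of_bool (\<phi> k v = y) * ?o k v)" for y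
    by (rule mass_flow_eq[OF fin x \<tau>(1) m])
  have o0: "0 \<le> ?o k v" if "v \<in> \<sigma>" for k v
    using mass_below_bounds[OF fin x that, of key] by (intro interval_overlap_nonneg)
  have "mass_flow key \<phi> \<tau> x \<in> realization_simplex (\<rho> w)"
    unfolding realization_simplex_def mem_Collect_eq
  proof (intro conjI allI impI)
    show "0 \<le> mass_flow key \<phi> \<tau> x y" for y
      unfolding eq by (intro sum_nonneg mult_nonneg_nonneg o0) auto
    show "mass_flow key \<phi> \<tau> x y = 0" if "y \<notin> \<rho> w" for y
      unfolding eq using key that by (intro sum.neutral ballI) auto
    have "sum (mass_flow key \<phi> \<tau> x) (\<rho> w) = (\<Sum>v\<in>\<sigma>. \<Sum>k\<le>m. (\<Sum>y\<in>\<rho> w. of_bool (\<phi> k v = y) * ?o k v))"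
      unfolding eq by (subst sum.swap) (intro sum.cong refl sum.swap)
    also have "\<dots> = (\<Sum>v\<in>\<sigma>. \<Sum>k\<le>m. ?o k v)"
    proof (intro sum.cong refl)
      fix v k assume v: "v \<in> \<sigma>"
      have "(\<Sum>y\<in>\<rho> w. of_bool (\<phi> k v = y) * ?o k v) = (\<Sum>y\<in>\<rho> w. if \<phi> k v = y then ?o k v else 0)"
        by (intro sum.cong) auto
      also have "\<dots> = ?o k v"
        using car[OF w\<sigma>(1)] key[OF v, of k] by (subst sum.delta') auto
      finally show "(\<Sum>y\<in>\<rho> w. of_bool (\<phi> k v = y) * ?o k v) = ?o k v" .
    qed
    also have "\<dots> = (\<Sum>v\<in>\<sigma>. x v)"
    proof (intro sum.cong refl)
      fix v assume "v \<in> \<sigma>"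
      from sum_interval_overlap[OF \<tau>(1) mass_below_bounds[OF fin x this, of key] m]
      show "(\<Sum>k\<le>m. ?o k v) = x v" by simp
    qed
    finally show "sum (mass_flow key \<phi> \<tau> x) (\<rho> w) = 1" using s1 by simp
  qed
  then show ?thesis using w\<sigma>(1) by blast
qed

text \<open>Once \<tau> \<ge> N, a window of index below N begins at 1 or later, so all mass sits at
  indices where \<phi> is already the identity on \<sigma>.\<close>

lemma mass_flow_large_time:
  assumes fin: "finite \<sigma>" and x: "x \<in> realization_simplex \<sigma>"
    and st: "\<And>n v. n \<ge> N \<Longrightarrow> v \<in> \<sigma> \<Longrightarrow> \<phi> n v = v" and \<tau>: "real N \<le> \<tau>"
  shows "mass_flow key \<phi> \<tau> x = x"
proof
  fix w
  let ?B = "mass_below key x"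
  let ?o = "\<lambda>k v. interval_overlap \<tau> k (?B v - x v) (?B v)"
  define m where "m = nat \<lceil>\<tau>\<rceil>"
  have m: "\<tau> \<le> real m" unfolding m_def by linarith
  have \<tau>0: "0 \<le> \<tau>" using \<tau> by linarith
  have "mass_flow key \<phi> \<tau> x w = (\<Sum>v\<in>\<sigma>. \<Sum>k\<le>m. of_bool (\<phi> k v = w) * ?o k v)"
    by (rule mass_flow_eq[OF fin x \<tau>0 m])
  also have "\<dots> = (\<Sum>v\<in>\<sigma>. of_bool (v = w) * (\<Sum>k\<le>m. ?o k v))"
    unfolding sum_distrib_left
  proof (intro sum.cong refl)
    fix v k assume v: "v \<in> \<sigma>"
    show "of_bool (\<phi> k v = w) * ?o k v = of_bool (v = w) * ?o k v"
    proof (cases "N \<le> k")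
      case False
      then have "1 \<le> \<tau> - real k" using \<tau> by linarith
      then have "?o k v = 0" using mass_below_bounds[OF fin x v, of key]
        by (intro interval_overlap_eq_0) auto
      then show ?thesis by simp
    qed (use st v in auto)
  qed
  also have "\<dots> = (\<Sum>v\<in>\<sigma>. if v = w then x v else 0)"
  proof (intro sum.cong refl)
    fix v assume "v \<in> \<sigma>"
    from sum_interval_overlap[OF \<tau>0 mass_below_bounds[OF fin x this, of key] m]
    show "of_bool (v = w) * (\<Sum>k\<le>m. ?o k v) = (if v = w then x v else 0)" by simp
  qed
  also have "\<dots> = x w"
    using fin x by (subst sum.delta) (auto simp: realization_simplex_def)
  finally show "mass_flow key \<phi> \<tau> x w = x w" .
qed

text \<open>At time 0 the window of index 0 is [0,1] itself, so the flow ends in the simplicial map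
  given by \<open>\<phi> 0\<close>.\<close>

lemma mass_flow_0:
  assumes "finite \<sigma>" "x \<in> realization_simplex \<sigma>"
  shows "mass_flow key \<phi> 0 x w = (\<Sum>v\<in>\<sigma>. of_bool (\<phi> 0 v = w) * x v)"
proof -
  have "interval_overlap 0 0 (mass_below key x v - x v) (mass_below key x v) = x v" if "v \<in> \<sigma>" for v
    using mass_below_bounds[OF assms that, of key] by (auto simp: interval_overlap_def)
  then show ?thesis
    by (subst mass_flow_eq[OF assms, of 0 0]) (auto intro!: sum.cong simp del: sum_of_bool_mult_eq)
qed

lemma mass_flow_0_in_simplex:
  assumes fin: "finite \<sigma>" "finite \<rho>" and x: "x \<in> realization_simplex \<sigma>" and \<rho>: "\<phi> 0 ` \<sigma> \<subseteq> \<rho>"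
  shows "mass_flow key \<phi> 0 x \<in> realization_simplex \<rho>"
  unfolding realization_simplex_def mem_Collect_eq mass_flow_0[OF fin(1) x]
proof (intro conjI allI impI)
  have nn: "0 \<le> x u" and s1: "sum x \<sigma> = 1" for u
    using x by (auto simp: realization_simplex_def)
  show "0 \<le> (\<Sum>v\<in>\<sigma>. of_bool (\<phi> 0 v = w) * x v)" for w
    by (intro sum_nonneg mult_nonneg_nonneg nn) auto
  show "(\<Sum>v\<in>\<sigma>. of_bool (\<phi> 0 v = w) * x v) = 0" if "w \<notin> \<rho>" for w
    using that \<rho> by (intro sum.neutral) auto
  have "(\<Sum>w\<in>\<rho>. \<Sum>v\<in>\<sigma>. of_bool (\<phi> 0 v = w) * x v) = (\<Sum>v\<in>\<sigma>. \<Sum>w\<in>\<rho>. if \<phi> 0 v = w then x v else 0)"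
    by (subst sum.swap) (intro sum.cong refl, simp)
  also have "\<dots> = sum x \<sigma>"
    using fin(2) \<rho> by (intro sum.cong refl, subst sum.delta') auto
  finally show "(\<Sum>w\<in>\<rho>. \<Sum>v\<in>\<sigma>. of_bool (\<phi> 0 v = w) * x v) = 1" using s1 by simp
qed

text \<open>With bounded time and a single simplex, \<open>mass_flow_eq\<close> gives one finite sum
  of clamps valid on all of S, whereas the range of the defining sum moves with the point.\<close>

lemma continuous_on_mass_flow:
  assumes fin: "finite \<sigma>" and f: "continuous_on S f" and g: "continuous_on S g"
    and fS: "\<And>p. p \<in> S \<Longrightarrow> 0 \<le> f p \<and> f p \<le> real m"
    and gS: "\<And>p. p \<in> S \<Longrightarrow> g p \<in> realization_simplex \<sigma>"
  shows "continuous_on S (\<lambda>p. mass_flow key \<phi> (f p) (g p))"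
proof (rule continuous_on_coordinatewise_then_product)
  fix w
  let ?B = "\<lambda>p v. (\<Sum>u | u \<in> \<sigma> \<and> key u \<le> key v. g p u)"
  have gc: "continuous_on S (\<lambda>p. g p v)" for v
    using g by (rule continuous_on_product_then_coordinatewise)
  have "continuous_on S (\<lambda>p. \<Sum>v\<in>\<sigma>. \<Sum>n\<le>m.
      of_bool (\<phi> n v = w) * interval_overlap (f p) n (?B p v - g p v) (?B p v))"
    unfolding interval_overlap_def by (intro continuous_intros gc f)
  then show "continuous_on S (\<lambda>p. mass_flow key \<phi> (f p) (g p) w)"
  proof (rule continuous_on_eq)
    fix p assume p: "p \<in> S"
    show "(\<Sum>v\<in>\<sigma>. \<Sum>n\<le>m. of_bool (\<phi> n v = w) * interval_overlap (f p) n (?B p v - g p v) (?B p v))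
        = mass_flow key \<phi> (f p) (g p) w"
      using fS[OF p] by (simp only: mass_flow_eq[OF fin gS[OF p], of "f p" m] mass_below_eq[OF fin gS[OF p]])
  qed
qed

text \<open>Time \<tau> = 1/s - 1 runs from infinity at s = 0 down to 0 at s = 1. On each simplex
  the flow is the identity for all small s, so setting it to the identity at s = 0 is continuous
  there, even if no single bound on s serves all simplices.\<close>

lemma homotopic_mass_flow:
  fixes \<Delta> :: "'v set set" and key :: "'v \<Rightarrow> 'b::order" and \<phi> :: "nat \<Rightarrow> 'v \<Rightarrow> 'v"
  assumes fin: "\<And>\<sigma>. \<sigma> \<in> \<Delta> \<Longrightarrow> finite \<sigma>"
    and lin: "\<And>\<sigma> u v. \<sigma> \<in> \<Delta> \<Longrightarrow> u \<in> \<sigma> \<Longrightarrow> v \<in> \<sigma> \<Longrightarrow> key u \<le> key v \<or> key v \<le> key u"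
    and stable: "\<And>\<sigma> v. \<sigma> \<in> \<Delta> \<Longrightarrow> v \<in> \<sigma> \<Longrightarrow> \<exists>N. \<forall>n\<ge>N. \<phi> n v = v"
    and carrier: "\<And>\<sigma> w n. \<sigma> \<in> \<Delta> \<Longrightarrow> w \<in> \<sigma> \<Longrightarrow>
      \<exists>\<rho>\<in>\<Delta>. \<phi> n ` {v \<in> \<sigma>. key w \<le> key v} \<union> \<phi> (Suc n) ` {v \<in> \<sigma>. key v \<le> key w} \<subseteq> \<rho>"
  shows "homotopic_with (\<lambda>_. True) (geometric_realization \<Delta>) (geometric_realization \<Delta>)
     id (mass_flow key \<phi> 0)"
proof -
  let ?X = "geometric_realization \<Delta>"
  define h where "h = (\<lambda>(s::real, x). if s = 0 then x else mass_flow key \<phi> (1 / s - 1) x)"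
  have "continuous_map (top_of_set ({0..1} \<times> realization_simplex \<sigma>)) ?X h" if \<sigma>: "\<sigma> \<in> \<Delta>" for \<sigma>
  proof -
    have f\<sigma>: "finite \<sigma>" by (rule fin[OF \<sigma>])
    from stable[OF \<sigma>] obtain N' where N': "\<forall>v\<in>\<sigma>. \<forall>n\<ge>N' v. \<phi> n v = v" by metis
    define N where "N = Max (insert 0 (N' ` \<sigma>))"
    have N: "\<phi> n v = v" if "N \<le> n" "v \<in> \<sigma>" for n v
    proof -
      have "N' v \<le> N" using f\<sigma> that(2) by (auto simp: N_def)
      then show ?thesis using N' that by auto
    qed
    \<comment> \<open>Time truncated at N. For s \<le> 1/(N+1) the flow on \<sigma> is already the
      identity, so the truncation changes nothing and removes the pole at 0.\<close>
    define T where "T = (\<lambda>s::real. 1 / max s (1 / (real N + 1)) - 1)"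
    have pos: "0 < max s (1 / (real N + 1))" for s :: real
      by (rule less_le_trans[OF _ max.cobounded2]) simp
    have T: "0 \<le> T s \<and> T s \<le> real N" if "s \<in> {0..1}" for s
    proof -
      have "max s (1 / (real N + 1)) \<le> 1" using that by simp
      then have "1 \<le> 1 / max s (1 / (real N + 1))"
        using pos by (simp add: le_divide_eq)
      moreover have "1 / max s (1 / (real N + 1)) \<le> 1 / (1 / (real N + 1))"
        by (intro divide_left_mono max.cobounded2 mult_pos_pos pos) auto
      ultimately show ?thesis by (simp add: T_def)
    qed
    have hT: "h (s, x) = mass_flow key \<phi> (T s) x" if s: "s \<in> {0..1}" and x: "x \<in> realization_simplex \<sigma>" for s x
    proof (cases "s \<le> 1 / (real N + 1)")
      case True
      then have "T s = real N" by (simp add: T_def max_absorb2)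
      then have *: "mass_flow key \<phi> (T s) x = x"
        using mass_flow_large_time[where \<phi> = \<phi> and N = N, OF f\<sigma> x N, of "T s" key] by simp
      show ?thesis
      proof (cases "s = 0")
        case False
        then have "real N + 1 \<le> 1 / s"
          using True s by (simp add: field_simps)
        then have "mass_flow key \<phi> (1 / s - 1) x = x"
          using mass_flow_large_time[where \<phi> = \<phi> and N = N, OF f\<sigma> x N, of "1 / s - 1" key] by simp
        then show ?thesis using False * by (simp add: h_def)
      next
        case s0: True
        show ?thesis unfolding * by (simp add: h_def s0)
      qed
    next
      case False
      then have "T s = 1 / s - 1" by (simp add: T_def max_absorb1)
      moreover have "s \<noteq> 0" using False by auto
      ultimately show ?thesis by (simp add: h_def)
    qed
    \<comment> \<open>Chosen carriers. Only times up to N occur on \<sigma>, so finitely many of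
      them contain the whole image, as \<open>continuous_map_into_realization\<close> asks.\<close>
    define \<rho> where "\<rho> n w = (SOME \<rho>. \<rho> \<in> \<Delta> \<and>
        \<phi> n ` {v \<in> \<sigma>. key w \<le> key v} \<union> \<phi> (Suc n) ` {v \<in> \<sigma>. key v \<le> key w} \<subseteq> \<rho>)" for n w
    have \<rho>: "\<rho> n w \<in> \<Delta> \<and>
        \<phi> n ` {v \<in> \<sigma>. key w \<le> key v} \<union> \<phi> (Suc n) ` {v \<in> \<sigma>. key v \<le> key w} \<subseteq> \<rho> n w"
      if "w \<in> \<sigma>" for n w
      unfolding \<rho>_def by (rule someI_ex) (use carrier[OF \<sigma> that, of n] in blast)
    show ?thesis
    proof (rule continuous_map_into_realization[where D = "(\<lambda>(n, w). \<rho> n w) ` ({..N} \<times> \<sigma>)"])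
      let ?S = "{0..1::real} \<times> realization_simplex \<sigma>"
      have "continuous_on ?S (\<lambda>p. T (fst p))"
        unfolding T_def by (intro continuous_intros ballI less_imp_neq[OF pos, symmetric])
      moreover have "continuous_on ?S (snd :: real \<times> ('v \<Rightarrow> real) \<Rightarrow> _)"
        by (intro continuous_intros)
      moreover have "0 \<le> T (fst p) \<and> T (fst p) \<le> real N" "snd p \<in> realization_simplex \<sigma>" if "p \<in> ?S" for p
        using that by (auto intro!: T)
      ultimately have "continuous_on ?S (\<lambda>p. mass_flow key \<phi> (T (fst p)) (snd p))"
        by (rule continuous_on_mass_flow[OF f\<sigma>])
      then have "continuous_on ?S h"
        by (rule continuous_on_eq) (auto simp: hT)
      then show "continuous_map (top_of_set ?S) euclidean h"
        by simp
      show "finite ((\<lambda>(n, w). \<rho> n w) ` ({..N} \<times> \<sigma>))" using f\<sigma> by simp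
      show "(\<lambda>(n, w). \<rho> n w) ` ({..N} \<times> \<sigma>) \<subseteq> \<Delta>" using \<rho> by auto
      fix p assume "p \<in> topspace (top_of_set ?S)"
      then obtain s x where p: "p = (s, x)" "s \<in> {0..1}" "x \<in> realization_simplex \<sigma>" by auto
      define n where "n = nat \<lfloor>T s\<rfloor>"
      have n: "real n \<le> T s" "T s < real n + 1" "n \<le> N"
        using T[OF p(2)] unfolding n_def by linarith+
      have "\<exists>w\<in>\<sigma>. mass_flow key \<phi> (T s) x \<in> realization_simplex (\<rho> n w)"
      proof (rule mass_flow_in_simplex[OF f\<sigma> p(3) lin[OF \<sigma>] _ n(1,2)])
        show "0 \<le> T s" using T[OF p(2)] by blast
        show "finite (\<rho> n w) \<and> \<phi> n ` {v \<in> \<sigma>. key w \<le> key v} \<union> \<phi> (Suc n) ` {v \<in> \<sigma>. key v \<le> key w} \<subseteq> \<rho> n w"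
          if "w \<in> \<sigma>" for w
          using \<rho>[OF that] fin by blast
      qed
      then show "h p \<in> (\<Union>\<rho>\<in>(\<lambda>(n, w). \<rho> n w) ` ({..N} \<times> \<sigma>). realization_simplex \<rho>)"
        using n(3) p hT by auto
    qed
  qed
  then have "continuous_map (prod_topology (top_of_set {0..1}) ?X) ?X h"
    by (rule continuous_map_prod_realization)
  then show ?thesis
    unfolding homotopic_with_def by (intro exI[of _ h]) (auto simp: h_def)
qed

lemma continuous_map_mass_flow_0:
  assumes fin: "\<And>\<sigma>. \<sigma> \<in> \<Delta> \<Longrightarrow> finite \<sigma>" "\<And>\<rho>. \<rho> \<in> \<Delta>' \<Longrightarrow> finite \<rho>"
    and carrier: "\<And>\<sigma>. \<sigma> \<in> \<Delta> \<Longrightarrow> \<exists>\<rho>\<in>\<Delta>'. \<phi> 0 ` \<sigma> \<subseteq> \<rho>"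
  shows "continuous_map (geometric_realization \<Delta>) (geometric_realization \<Delta>') (mass_flow key \<phi> 0)"
proof (rule continuous_map_from_realization)
  fix \<sigma> assume \<sigma>: "\<sigma> \<in> \<Delta>"
  obtain \<rho> where \<rho>: "\<rho> \<in> \<Delta>'" "\<phi> 0 ` \<sigma> \<subseteq> \<rho>" using carrier[OF \<sigma>] by blast
  show "continuous_map (top_of_set (realization_simplex \<sigma>)) (geometric_realization \<Delta>') (mass_flow key \<phi> 0)"
  proof (rule continuous_map_into_realization[where D = "{\<rho>}"])
    have "continuous_on (realization_simplex \<sigma>) (mass_flow key \<phi> 0)"
      using continuous_on_mass_flow[OF fin(1)[OF \<sigma>] continuous_on_const[of _ 0] continuous_on_id, where m = 0]
      by simp
    then show "continuous_map (top_of_set (realization_simplex \<sigma>)) euclidean (mass_flow key \<phi> 0)"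
      by simp
    fix x assume "x \<in> topspace (top_of_set (realization_simplex \<sigma>))"
    then show "mass_flow key \<phi> 0 x \<in> (\<Union>\<rho>\<in>{\<rho>}. realization_simplex \<rho>)"
      using mass_flow_0_in_simplex[where \<phi> = \<phi>, OF fin(1)[OF \<sigma>] fin(2)[OF \<rho>(1)] _ \<rho>(2)] by simp
  qed (use \<rho> in auto)
qed

lemma continuous_map_subcomplex:
  assumes "\<Delta>' \<subseteq> \<Delta>"
  shows "continuous_map (geometric_realization \<Delta>') (geometric_realization \<Delta>) id"
proof (rule continuous_map_from_realization)
  fix \<sigma> assume "\<sigma> \<in> \<Delta>'"
  then show "continuous_map (top_of_set (realization_simplex \<sigma>)) (geometric_realization \<Delta>) id"
    using assms by (intro continuous_map_into_realization[where D = "{\<sigma>}"]) auto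
qed

text \<open>The flow joins the identity of \<Delta> to a map that factors through \<Delta>', and a
  null-homotopy of \<Delta>' then makes that map homotopic to a constant.\<close>

lemma contractible_realization_mass_flow:
  fixes \<Delta> \<Delta>' :: "'v set set" and key :: "'v \<Rightarrow> 'b::order" and \<phi> :: "nat \<Rightarrow> 'v \<Rightarrow> 'v"
  assumes fin: "\<And>\<sigma>. \<sigma> \<in> \<Delta> \<Longrightarrow> finite \<sigma>"
    and lin: "\<And>\<sigma> u v. \<sigma> \<in> \<Delta> \<Longrightarrow> u \<in> \<sigma> \<Longrightarrow> v \<in> \<sigma> \<Longrightarrow> key u \<le> key v \<or> key v \<le> key u"
    and stable: "\<And>\<sigma> v. \<sigma> \<in> \<Delta> \<Longrightarrow> v \<in> \<sigma> \<Longrightarrow> \<exists>N. \<forall>n\<ge>N. \<phi> n v = v"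
    and carrier: "\<And>\<sigma> w n. \<sigma> \<in> \<Delta> \<Longrightarrow> w \<in> \<sigma> \<Longrightarrow>
      \<exists>\<rho>\<in>\<Delta>. \<phi> n ` {v \<in> \<sigma>. key w \<le> key v} \<union> \<phi> (Suc n) ` {v \<in> \<sigma>. key v \<le> key w} \<subseteq> \<rho>"
    and sub: "\<Delta>' \<subseteq> \<Delta>" and target: "\<And>\<sigma>. \<sigma> \<in> \<Delta> \<Longrightarrow> \<exists>\<rho>\<in>\<Delta>'. \<phi> 0 ` \<sigma> \<subseteq> \<rho>"
    and contr: "contractible_space (geometric_realization \<Delta>')"
  shows "contractible_space (geometric_realization \<Delta>)"
proof -
  let ?X = "geometric_realization \<Delta>" and ?Y = "geometric_realization \<Delta>'"
  have f: "continuous_map ?X ?Y (mass_flow key \<phi> 0)"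
    using fin sub target by (intro continuous_map_mass_flow_0) auto
  obtain a where "homotopic_with (\<lambda>_. True) ?Y ?Y id (\<lambda>_. a)"
    using contr unfolding contractible_space_def by blast
  then have "homotopic_with (\<lambda>_. True) ?X ?Y (id \<circ> mass_flow key \<phi> 0) ((\<lambda>_. a) \<circ> mass_flow key \<phi> 0)"
    by (rule homotopic_with_compose_continuous_map_right[OF _ f]) simp
  then have "homotopic_with (\<lambda>_. True) ?X ?X (id \<circ> (id \<circ> mass_flow key \<phi> 0)) (id \<circ> ((\<lambda>_. a) \<circ> mass_flow key \<phi> 0))"
    by (rule homotopic_with_compose_continuous_map_left[OF _ continuous_map_subcomplex[OF sub]]) simp
  then have "homotopic_with (\<lambda>_. True) ?X ?X (mass_flow key \<phi> 0) (\<lambda>_. a)"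
    by (simp add: o_def)
  moreover have "homotopic_with (\<lambda>_. True) ?X ?X id (mass_flow key \<phi> 0)"
    by (rule homotopic_mass_flow[OF fin lin stable carrier])
  ultimately show ?thesis
    unfolding contractible_space_def using homotopic_with_trans by blast
qed

lemma contractible_realization_singleton: "contractible_space (geometric_realization {{v}})"
proof -
  have "realization_simplex {v} = {\<lambda>u. if u = v then 1 else 0}"
    by (auto simp: realization_simplex_def fun_eq_iff)
  then have "topspace (geometric_realization {{v}}) = {\<lambda>u. if u = v then 1 else 0}"
    by (simp add: topspace_geometric_realization)
  then show ?thesis
    by (simp add: contractible_space_subset_singleton)
qed

subsection \<open>Spans over subrings\<close>

lemma subring_of_fieldD:
  assumes "subring_of_field S"
  shows "0 \<in> S" "1 \<in> S" "x \<in> S \<Longrightarrow> y \<in> S \<Longrightarrow> x + y \<in> S" "x \<in> S \<Longrightarrow> - x \<in> S"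
    "x \<in> S \<Longrightarrow> y \<in> S \<Longrightarrow> x - y \<in> S" "x \<in> S \<Longrightarrow> y \<in> S \<Longrightarrow> x * y \<in> S" "x \<in> S \<Longrightarrow> x ^ n \<in> S"
proof -
  have d: "x - y \<in> S" if "x \<in> S" "y \<in> S" for x y
    using assms that unfolding subring_of_field_def by blast
  show 1: "1 \<in> S" using assms unfolding subring_of_field_def by blast
  show 0: "0 \<in> S" using d[OF 1 1] by simp
  show n: "- x \<in> S" if "x \<in> S" for x using d[OF 0 that] by simp
  show "x + y \<in> S" if "x \<in> S" "y \<in> S" using d[OF that(1) n[OF that(2)]] by simp
  show "x - y \<in> S" if "x \<in> S" "y \<in> S" using d that .
  show m: "x * y \<in> S" if "x \<in> S" "y \<in> S" for x y
    using assms that unfolding subring_of_field_def by blast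
  show "x ^ n \<in> S" if "x \<in> S" using that by (induction n) (auto intro: 1 m)
qed

lemma sum_mem_subring: "subring_of_field S \<Longrightarrow> (\<And>i. i \<in> J \<Longrightarrow> f i \<in> S) \<Longrightarrow> sum f J \<in> S"
  by (induction J rule: infinite_finite_induct) (auto intro: subring_of_fieldD)

lemma submodule_overD:
  assumes "submodule_over s S M"
  shows "0 \<in> M" "x \<in> M \<Longrightarrow> y \<in> M \<Longrightarrow> x + y \<in> M" "a \<in> S \<Longrightarrow> x \<in> M \<Longrightarrow> s a x \<in> M"
  using assms unfolding submodule_over_def by auto

lemma sum_mem_submodule: "submodule_over s S M \<Longrightarrow> (\<And>i. i \<in> J \<Longrightarrow> f i \<in> M) \<Longrightarrow> sum f J \<in> M"
  by (induction J rule: infinite_finite_induct) (auto intro: submodule_overD)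

lemma submodule_module_span: "submodule_over s S (module_span s S X)"
  unfolding module_span_def by (rule hull_in) (auto simp: submodule_over_def)

lemma module_span_superset: "X \<subseteq> module_span s S X"
  unfolding module_span_def by (rule hull_subset)

lemma module_span_minimal: "X \<subseteq> M \<Longrightarrow> submodule_over s S M \<Longrightarrow> module_span s S X \<subseteq> M"
  unfolding module_span_def by (rule hull_minimal)

lemma module_span_mono: "X \<subseteq> Y \<Longrightarrow> module_span s S X \<subseteq> module_span s S Y"
  by (meson module_span_minimal module_span_superset order_trans submodule_module_span)

lemma module_span_finite:
  assumes s: "vector_space s" and S: "subring_of_field S" and X: "finite X"
  shows "module_span s S X = (\<lambda>a. \<Sum>x\<in>X. s (a x) x) ` (X \<rightarrow>\<^sub>E S)"
proof
  interpret vector_space s by (rule s)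
  let ?M = "(\<lambda>a. \<Sum>x\<in>X. s (a x) x) ` (X \<rightarrow>\<^sub>E S)"
  have I: "(\<Sum>x\<in>X. s (a x) x) \<in> ?M" if "\<And>x. x \<in> X \<Longrightarrow> a x \<in> S" for a
    using that by (intro image_eqI[of _ _ "restrict a X"]) (auto intro!: sum.cong)
  have "submodule_over s S ?M"
    unfolding submodule_over_def
  proof (intro conjI ballI)
    show "0 \<in> ?M" using I[of "\<lambda>_. 0"] subring_of_fieldD(1)[OF S] by simp
    fix u assume "u \<in> ?M"
    then obtain a where a: "\<And>x. x \<in> X \<Longrightarrow> a x \<in> S" "u = (\<Sum>x\<in>X. s (a x) x)" by auto
    show "u + v \<in> ?M" if "v \<in> ?M" for v
    proof -
      obtain b where b: "\<And>x. x \<in> X \<Longrightarrow> b x \<in> S" "v = (\<Sum>x\<in>X. s (b x) x)" using \<open>v \<in> ?M\<close> by auto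
      have "u + v = (\<Sum>x\<in>X. s (a x + b x) x)"
        by (simp add: a(2) b(2) scale_left_distrib sum.distrib)
      then show ?thesis using I[of "\<lambda>x. a x + b x"] a b subring_of_fieldD(3)[OF S] by auto
    qed
    show "s c u \<in> ?M" if "c \<in> S" for c
    proof -
      have "s c u = (\<Sum>x\<in>X. s (c * a x) x)" by (simp add: a(2) scale_sum_right)
      then show ?thesis using I[of "\<lambda>x. c * a x"] a that subring_of_fieldD(6)[OF S] by auto
    qed
  qed
  moreover have "X \<subseteq> ?M"
  proof
    fix y assume y: "y \<in> X"
    have "(\<Sum>x\<in>X. s (if x = y then 1 else 0) x) = (\<Sum>x\<in>X. if x = y then x else 0)"
      by (intro sum.cong) auto
    also have "\<dots> = y" using X y by simp
    finally have "y = (\<Sum>x\<in>X. s (if x = y then 1 else 0) x)" by simp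
    moreover have "(\<Sum>x\<in>X. s (if x = y then 1 else 0) x) \<in> ?M"
      by (rule I) (auto intro: subring_of_fieldD[OF S])
    ultimately show "y \<in> ?M" by metis
  qed
  ultimately show "module_span s S X \<subseteq> ?M" by (intro module_span_minimal)
  show "?M \<subseteq> module_span s S X"
  proof (intro image_subsetI)
    fix a assume a: "a \<in> X \<rightarrow>\<^sub>E S"
    show "(\<Sum>x\<in>X. s (a x) x) \<in> module_span s S X"
      using a module_span_superset[of X s S]
      by (intro sum_mem_submodule[OF submodule_module_span] submodule_overD(3)[OF submodule_module_span]) auto
  qed
qed

lemma card_module_span_le:
  assumes "vector_space s" "subring_of_field S" "finite X" "finite S"
  shows "finite (module_span s S X)" "card (module_span s S X) \<le> card S ^ card X"
proof -
  have f: "finite (X \<rightarrow>\<^sub>E S)" using assms by (intro finite_PiE) auto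
  show "finite (module_span s S X)" unfolding module_span_finite[OF assms(1-3)] using f by simp
  have "card (module_span s S X) \<le> card (X \<rightarrow>\<^sub>E S)"
    unfolding module_span_finite[OF assms(1-3)] by (rule card_image_le[OF f])
  also have "\<dots> = card S ^ card X" using assms(3) by (simp add: card_PiE)
  finally show "card (module_span s S X) \<le> card S ^ card X" .
qed

subsection \<open>Algebraic dependence over a finite constant field\<close>

lemma submodule_mult_preimage:
  fixes S :: "'k::field set"
  shows "submodule_over (*) S M \<Longrightarrow> submodule_over (*) S {v. c * v \<in> M}"
  unfolding submodule_over_def by (auto simp: distrib_left mult.left_commute)

text \<open>
  Multiplication by \<open>y\<close> and \<open>z\<close> raises the degree in \<open>x\<close> by a bounded amount, up to denominators. So the
  monomials \<open>y\<^sup>i z\<^sup>j\<close> with \<open>i, j \<le> n\<close>, of which there are quadratically many in \<open>n\<close>, have their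
  \<open>F\<close>-combinations in a space whose dimension grows linearly, and two of these must coincide.
\<close>

lemma algebraically_dependent:
  fixes F :: "'k::field set"
  assumes "curve_function_field F"
  obtains n c where "\<And>i j. c i j \<in> F" "\<exists>i\<le>n. \<exists>j\<le>n. c i j \<noteq> 0"
    "(\<Sum>i\<le>n. \<Sum>j\<le>n. c i j * y ^ i * z ^ j) = 0"
proof -
  have finF: "finite F" and F: "subring_of_field F"
    using assms by (auto simp: curve_function_field_def subfield_of_field_def)
  note Fs = subring_of_fieldD[OF F]
  obtain x X where X: "finite X" "(UNIV :: 'k set) = module_span (*) (field_adjoin F x) X"
    using assms unfolding curve_function_field_def fin_gen_over_def by blast
  have vs: "vector_space ((*) :: 'k \<Rightarrow> _)" by (rule vector_space_over_itself.vector_space_axioms)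
  \<comment> \<open>\<open>V D\<close> plays the part of the elements of degree at most D in x over
    the generators X; it is spanned over F by at most (D+1) card X vectors.\<close>
  define G where "G D = (\<lambda>(k, e). x ^ k * e) ` ({..D} \<times> X)" for D :: nat
  define V where "V D = module_span (*) F (G D)" for D
  have Vsub: "submodule_over (*) F (V D)" for D
    unfolding V_def by (rule submodule_module_span)
  have Vmono: "V D \<subseteq> V D'" if "D \<le> D'" for D D'
    unfolding V_def G_def using that by (intro module_span_mono image_mono) auto
  have GV: "x ^ k * e \<in> V D" if "k \<le> D" "e \<in> X" for k e D
    unfolding V_def using that by (intro subsetD[OF module_span_superset]) (auto simp: G_def)
  have Vind: "c * v \<in> V D'" if "\<And>k e. k \<le> D \<Longrightarrow> e \<in> X \<Longrightarrow> c * (x ^ k * e) \<in> V D'" "v \<in> V D" for c v D D'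
  proof -
    have "V D \<subseteq> {v. c * v \<in> V D'}"
      unfolding V_def[of D] using that(1)
      by (intro module_span_minimal submodule_mult_preimage Vsub) (auto simp: G_def)
    then show ?thesis using that(2) by auto
  qed
  have xV: "x ^ k * v \<in> V (k + D)" if "v \<in> V D" for k v D
    using that by (rule Vind[rotated])
      (auto simp: mult.assoc[symmetric] power_add[symmetric] intro!: GV)
  define T where "T = {poly p x | p. \<forall>i. coeff p i \<in> F}"
  have TV: "\<exists>D. \<forall>D'. \<forall>v\<in>V D'. t * v \<in> V (D + D')" if "t \<in> T" for t
  proof -
    obtain p where p: "t = poly p x" "\<forall>i. coeff p i \<in> F" using \<open>t \<in> T\<close> by (auto simp: T_def)
    have "t * v \<in> V (degree p + D')" if v: "v \<in> V D'" for v D'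
    proof -
      have "t * v = (\<Sum>i\<le>degree p. coeff p i * (x ^ i * v))"
        by (simp add: p(1) poly_altdef sum_distrib_right mult.assoc)
      also have "\<dots> \<in> V (degree p + D')"
      proof (intro sum_mem_submodule[OF Vsub])
        fix i assume "i \<in> {..degree p}"
        then have "x ^ i * v \<in> V (degree p + D')"
          using xV[OF v, of i] Vmono[of "i + D'" "degree p + D'"] by auto
        then show "coeff p i * (x ^ i * v) \<in> V (degree p + D')"
          using p(2) submodule_overD(3)[OF Vsub] by blast
      qed
      finally show ?thesis .
    qed
    then show ?thesis by blast
  qed
  have Tm: "a * b \<in> T" if "a \<in> T" "b \<in> T" for a b
  proof -
    obtain p q where p: "a = poly p x" "\<forall>i. coeff p i \<in> F" and q: "b = poly q x" "\<forall>i. coeff q i \<in> F"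
      using \<open>a \<in> T\<close> \<open>b \<in> T\<close> by (auto simp: T_def)
    have "coeff (p * q) i \<in> F" for i
      unfolding coeff_mult using p q by (intro sum_mem_subring[OF F] Fs) auto
    then show ?thesis unfolding T_def using p q by (auto intro!: exI[of _ "p * q"])
  qed
  have T1: "1 \<in> T"
    unfolding T_def using Fs by (auto intro!: exI[of _ 1] simp: coeff_eq_0 one_pCons coeff_pCons split: nat.split)
  \<comment> \<open>The elements that a non-zero polynomial in x carries into some
    \<open>V D\<close>. They form a vector space over the rational functions in x and contain X,
    hence are everything.\<close>
  define Z where "Z = {w. \<exists>t\<in>T. t \<noteq> 0 \<and> (\<exists>D. t * w \<in> V D)}"
  have ZI: "w \<in> Z" if "t \<in> T" "t \<noteq> 0" "t * w \<in> V D" for w t D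
    using that unfolding Z_def by blast
  have "submodule_over (*) (field_adjoin F x) Z"
    unfolding submodule_over_def
  proof (intro conjI ballI)
    show "0 \<in> Z" using ZI[OF T1, of 0] submodule_overD(1)[OF Vsub] by simp
    fix u assume "u \<in> Z"
    then obtain t D where t: "t \<in> T" "t \<noteq> 0" "t * u \<in> V D" by (auto simp: Z_def)
    show "u + v \<in> Z" if "v \<in> Z" for v
    proof -
      obtain t' D' where t': "t' \<in> T" "t' \<noteq> 0" "t' * v \<in> V D'" using \<open>v \<in> Z\<close> by (auto simp: Z_def)
      obtain E where E: "\<And>D' v. v \<in> V D' \<Longrightarrow> t * v \<in> V (E + D')" using TV[OF t(1)] by blast
      obtain E' where E': "\<And>D' v. v \<in> V D' \<Longrightarrow> t' * v \<in> V (E' + D')" using TV[OF t'(1)] by blast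
      define C where "C = E + D' + E' + D"
      have "t' * (t * u) \<in> V C" "t * (t' * v) \<in> V C"
        using E'[OF t(3)] E[OF t'(3)] Vmono[of "E' + D" C] Vmono[of "E + D'" C] by (auto simp: C_def)
      then have "t' * (t * u) + t * (t' * v) \<in> V C" by (rule submodule_overD(2)[OF Vsub])
      then have "(t * t') * (u + v) \<in> V C" by (simp add: algebra_simps)
      with ZI[OF Tm[OF t(1) t'(1)]] t(2) t'(2) show ?thesis by simp
    qed
    show "f * u \<in> Z" if f: "f \<in> field_adjoin F x" for f
    proof -
      obtain p q where pq: "f = poly p x / poly q x" "\<forall>i. coeff p i \<in> F" "\<forall>i. coeff q i \<in> F" "poly q x \<noteq> 0"
        using f by (auto simp: field_adjoin_def)
      then have "poly p x \<in> T" "poly q x \<in> T" by (auto simp: T_def)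
      then obtain E where "poly p x * (t * u) \<in> V (E + D)" using TV t(3) by blast
      moreover have "poly p x * (t * u) = (t * poly q x) * (f * u)"
        using pq(4) by (simp add: pq(1))
      ultimately show ?thesis
        using ZI[OF Tm[OF t(1) \<open>poly q x \<in> T\<close>]] t(2) pq(4) by simp
    qed
  qed
  moreover have "X \<subseteq> Z"
    using ZI[OF T1, of _ 0] GV[of 0 0] by auto
  ultimately have ZU: "w \<in> Z" for w
    using X(2) module_span_minimal[of X Z "(*)" "field_adjoin F x"] by auto
  have common: "\<exists>t\<in>T. t \<noteq> 0 \<and> (\<exists>D. \<forall>w\<in>Q. t * w \<in> V D)" if "finite Q" for Q
    using that
  proof induction
    case empty
    then show ?case using T1 by (auto intro!: bexI[of _ 1])
  next
    case (insert w Q)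
    then obtain t D where t: "t \<in> T" "t \<noteq> 0" "\<And>w. w \<in> Q \<Longrightarrow> t * w \<in> V D" by auto
    obtain t' D' where t': "t' \<in> T" "t' \<noteq> 0" "t' * w \<in> V D'" using ZU[of w] by (auto simp: Z_def)
    obtain E where E: "\<And>D' v. v \<in> V D' \<Longrightarrow> t * v \<in> V (E + D')" using TV[OF t(1)] by blast
    obtain E' where E': "\<And>D' v. v \<in> V D' \<Longrightarrow> t' * v \<in> V (E' + D')" using TV[OF t'(1)] by blast
    define C where "C = E + D' + E' + D"
    have "(t * t') * u \<in> V C" if "u \<in> insert w Q" for u
    proof (cases "u = w")
      case True
      then show ?thesis using E[OF t'(3)] Vmono[of "E + D'" C] by (auto simp: C_def mult.assoc)
    next
      case False
      then show ?thesis using that E'[OF t(3)] Vmono[of "E' + D" C]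
        by (auto simp: C_def mult.assoc mult.left_commute)
    qed
    then show ?case using Tm[OF t(1) t'(1)] t(2) t'(2) by (intro bexI[of _ "t * t'"]) auto
  qed
  \<comment> \<open>One denominator t for 1 and for all products of y and z with the generators.
    Multiplication by t, t y or t z then raises the degree by at most the d defined below.\<close>
  obtain t D1 where t: "t \<in> T" "t \<noteq> 0"
      "\<And>w. w \<in> insert 1 ((*) y ` X \<union> (*) z ` X) \<Longrightarrow> t * w \<in> V D1"
    using common[of "insert 1 ((*) y ` X \<union> (*) z ` X)"] X(1) by (elim meta_impE bexE conjE exE) blast+
  obtain E where E: "\<And>D' v. v \<in> V D' \<Longrightarrow> t * v \<in> V (E + D')" using TV[OF t(1)] by blast
  define d where "d = E + D1"
  have mt: "t * v \<in> V (d + D)" if "v \<in> V D" for v D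
    using E[OF that] Vmono[of "E + D" "d + D"] by (auto simp: d_def)
  have my: "(t * u) * v \<in> V (d + D)" if u: "u = y \<or> u = z" and "v \<in> V D" for u v D
  proof (rule Vind[OF _ \<open>v \<in> V D\<close>])
    fix k e assume k: "k \<le> D" "e \<in> X"
    then have "t * (u * e) \<in> V D1" using t(3) u by auto
    then have "x ^ k * (t * (u * e)) \<in> V (k + D1)" by (rule xV)
    then show "(t * u) * (x ^ k * e) \<in> V (d + D)"
      using Vmono[of "k + D1" "d + D"] k by (auto simp: d_def algebra_simps)
  qed
  have t1: "t \<in> V d" using t(3)[of 1] Vmono[of D1 d] by (auto simp: d_def)
  \<comment> \<open>The factors \<open>t ^ k\<close> are padding: with k = 2n - i - j all monomials
    get the same power of t. The last factor t starts the induction in \<open>V d\<close>.\<close>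
  have mon: "t ^ (i + j + k) * (t * (y ^ i * z ^ j)) \<in> V (d * (i + j + k + 1))" for i j k
  proof -
    have 1: "(t * z) ^ j * t \<in> V (d * (j + 1))" for j
    proof (induction j)
      case (Suc j)
      from my[OF disjI2[OF refl] this] show ?case by (simp add: algebra_simps)
    qed (simp add: t1)
    have 2: "(t * y) ^ i * ((t * z) ^ j * t) \<in> V (d * (i + j + 1))" for i
    proof (induction i)
      case (Suc i)
      from my[OF disjI1[OF refl] this] show ?case by (simp add: algebra_simps)
    qed (use 1[of j] in simp)
    have "t ^ k * ((t * y) ^ i * ((t * z) ^ j * t)) \<in> V (d * (i + j + k + 1))" for k
    proof (induction k)
      case (Suc k)
      from mt[OF this] show ?case by (simp add: algebra_simps)
    qed (use 2[of i] in simp)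
    moreover have "t ^ k * ((t * y) ^ i * ((t * z) ^ j * t)) = t ^ (i + j + k) * (t * (y ^ i * z ^ j))"
      by (simp add: power_add power_mult_distrib ac_simps)
    ultimately show ?thesis by metis
  qed
  \<comment> \<open>Chosen so that (C+1) card X, which equals 2 d n card X + (d+1) card X, stays
    below (n+1)^2, the number of monomials.\<close>
  define n where "n = 2 * d * card X + card X"
  define C where "C = d * (2 * n + 1)"
  have mon': "t ^ (2 * n) * (t * (y ^ i * z ^ j)) \<in> V C" if "i \<le> n" "j \<le> n" for i j
    using mon[of i j "2 * n - i - j"] that by (simp add: C_def)
  define f where "f c = (\<Sum>(i, j)\<in>{..n} \<times> {..n}. c (i, j) * (t ^ (2 * n) * (t * (y ^ i * z ^ j))))" for c :: "nat \<times> nat \<Rightarrow> 'k"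
  let ?S = "({..n} \<times> {..n}) \<rightarrow>\<^sub>E F"
  have fV: "f ` ?S \<subseteq> V C"
  proof (intro image_subsetI)
    fix c assume c: "c \<in> ?S"
    show "f c \<in> V C"
      unfolding f_def
    proof (intro sum_mem_submodule[OF Vsub])
      fix p assume "p \<in> {..n} \<times> {..n}"
      then obtain i j where p: "p = (i, j)" "i \<le> n" "j \<le> n" by auto
      have "c (i, j) * (t ^ (2 * n) * (t * (y ^ i * z ^ j))) \<in> V C"
        by (rule submodule_overD(3)[OF Vsub _ mon'[OF p(2,3)]]) (use c p in auto)
      then show "(case p of (i, j) \<Rightarrow> c (i, j) * (t ^ (2 * n) * (t * (y ^ i * z ^ j)))) \<in> V C"
        using p(1) by simp
    qed
  qed
  have cardG: "card (G C) \<le> (C + 1) * card X" and finG: "finite (G C)"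
    using card_image_le[of "{..C} \<times> X" "\<lambda>(k, e). x ^ k * e"] X(1)
    by (auto simp: G_def card_cartesian_product)
  have F2: "card {0, 1 :: 'k} \<le> card F" by (rule card_mono[OF finF]) (use Fs in auto)
  have finV: "finite (V C)" and "card (V C) \<le> card F ^ card (G C)"
    unfolding V_def using card_module_span_le[OF vs F finG finF] by auto
  note this(2)
  also have "card F ^ card (G C) \<le> card F ^ ((C + 1) * card X)"
    using cardG F2 by (intro power_increasing) auto
  also have "\<dots> < card F ^ ((n + 1) * (n + 1))"
  proof (rule power_strict_increasing)
    have "(C + 1) * card X = n * (2 * d * card X) + d * card X + card X"
      by (simp add: C_def algebra_simps)
    also have "\<dots> \<le> n * n + n + n"
      by (intro add_mono mult_le_mono) (auto simp: n_def)
    also have "\<dots> < (n + 1) * (n + 1)" by simp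
    finally show "(C + 1) * card X < (n + 1) * (n + 1)" .
  qed (use F2 in auto)
  also have "\<dots> = card ?S" by (simp add: card_PiE card_cartesian_product)
  finally have "card (f ` ?S) < card ?S"
    using card_mono[OF finV fV] by simp
  then have "\<not> inj_on f ?S" using card_image[of f ?S] by auto
  then obtain a b where ab: "a \<in> ?S" "b \<in> ?S" "f a = f b" "a \<noteq> b" by (auto simp: inj_on_def)
  define c where "c i j = (if i \<le> n \<and> j \<le> n then a (i, j) - b (i, j) else 0)" for i j
  show thesis
  proof (rule that[of c n])
    show "c i j \<in> F" for i j using ab(1,2) Fs by (auto simp: c_def PiE_iff)
    show "\<exists>i\<le>n. \<exists>j\<le>n. c i j \<noteq> 0"
    proof (rule ccontr)
      assume *: "\<not> ?thesis"
      have "a p = b p" for p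
      proof (cases "p \<in> {..n} \<times> {..n}")
        case True
        then have "c (fst p) (snd p) = 0" using * by auto
        then show ?thesis using True by (auto simp: c_def)
      next
        case False
        then show ?thesis using PiE_arb[OF ab(1)] PiE_arb[OF ab(2)] by metis
      qed
      then show False using ab(4) by auto
    qed
    have "0 = f a - f b" using ab(3) by simp
    also have "\<dots> = (\<Sum>p\<in>{..n} \<times> {..n}. (t ^ (2 * n) * t) * (c (fst p) (snd p) * y ^ fst p * z ^ snd p))"
      unfolding f_def split_beta sum_subtractf[symmetric]
      by (intro sum.cong) (auto simp: c_def algebra_simps)
    also have "\<dots> = (t ^ (2 * n) * t) * (\<Sum>i\<le>n. \<Sum>j\<le>n. c i j * y ^ i * z ^ j)"
      by (simp add: sum_distrib_left sum.cartesian_product split_beta)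
    finally show "(\<Sum>i\<le>n. \<Sum>j\<le>n. c i j * y ^ i * z ^ j) = 0" using t(2) by auto
  qed
qed

subsection \<open>The valuation ring at infinity and the ring of functions regular elsewhere\<close>

lemma closed_pointD:
  assumes "closed_point F R"
  shows "subring_of_field R" "F \<subseteq> R" "x \<in> R \<or> inverse x \<in> R" "R \<noteq> UNIV"
  using assms by (auto simp: closed_point_def)

text \<open>If \<pi> were 0, every non-zero element of R would be a unit; but for x outside R, the
  element \<open>inverse x\<close> lies in R and its inverse does not. As \<pi> itself is a
  non-unit, \<open>inverse \<pi>\<close> is outside R.\<close>

lemma uniformizerD:
  assumes R: "closed_point F R" and \<pi>: "uniformizer R \<pi>"
  shows "\<pi> \<in> R" "\<pi> \<noteq> 0" "inverse \<pi> \<notin> R"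
proof -
  note Rs = subring_of_fieldD[OF closed_pointD(1)[OF R]]
  have eq: "{x \<in> R. \<not> (\<exists>y\<in>R. x * y = 1)} = (*) \<pi> ` R" using \<pi> by (simp add: uniformizer_def)
  have "\<pi> * 1 \<in> (*) \<pi> ` R" using Rs(2) by blast
  then have m: "\<pi> \<in> R" "\<not> (\<exists>y\<in>R. \<pi> * y = 1)" using eq by auto
  then show "\<pi> \<in> R" by simp
  show "\<pi> \<noteq> 0"
  proof
    assume 0: "\<pi> = 0"
    obtain x where x: "x \<notin> R" using closed_pointD(4)[OF R] by auto
    then have ix: "inverse x \<in> R" using closed_pointD(3)[OF R] by blast
    have "x \<noteq> 0" using x Rs(1) by auto
    have "inverse x \<notin> (*) \<pi> ` R" using 0 \<open>x \<noteq> 0\<close> by auto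
    then obtain y where y: "y \<in> R" "inverse x * y = 1" using eq ix by blast
    then have "y = x" using \<open>x \<noteq> 0\<close> by (simp add: field_simps)
    then show False using x y by simp
  qed
  then show "inverse \<pi> \<notin> R" using m(2) by force
qed

lemma submodule_principal:
  assumes R: "subring_of_field R"
  shows "submodule_over (*) R ((*) c ` R)"
  unfolding submodule_over_def
proof (intro conjI ballI)
  note Rs = subring_of_fieldD[OF R]
  show "0 \<in> (*) c ` R" using Rs(1) by (intro image_eqI[of _ _ 0]) auto
  fix x assume "x \<in> (*) c ` R"
  then obtain u where u: "u \<in> R" "x = c * u" by blast
  show "x + y \<in> (*) c ` R" if "y \<in> (*) c ` R" for y
  proof -
    obtain v where v: "v \<in> R" "y = c * v" using \<open>y \<in> (*) c ` R\<close> by blast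
    show ?thesis using Rs(3)[OF u(1) v(1)] by (intro image_eqI[of _ _ "u + v"]) (auto simp: u v distrib_left)
  qed
  show "a * x \<in> (*) c ` R" if "a \<in> R" for a
    using Rs(6)[OF that u(1)] by (intro image_eqI[of _ _ "a * u"]) (auto simp: u ac_simps)
qed

text \<open>
  If \<open>w \<noteq> 0\<close> were divisible by all powers of \<open>\<pi>\<close>, then the lexicographically least monomial \<open>w\<^sup>i \<pi>\<^sup>j\<close>
  of an algebraic relation between \<open>w\<close> and \<open>\<pi>\<close> would have smaller valuation than the others.
\<close>

lemma uniformizer_archimedean:
  assumes F: "curve_function_field F" and R: "closed_point F R" and \<pi>: "uniformizer R \<pi>"
  shows "\<exists>n. \<pi> ^ n * x \<in> R"
proof (rule ccontr)
  assume neg: "\<not> (\<exists>n. \<pi> ^ n * x \<in> R)"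
  note Rr = closed_pointD(1)[OF R]
  note Rs = subring_of_fieldD[OF Rr]
  note p = uniformizerD[OF R \<pi>]
  define w where "w = inverse x"
  have x0: "x \<noteq> 0" using neg Rs(1) by auto
  \<comment> \<open>Since \<pi>^n x is never in R, its inverse always is, and that inverse is w /
    \<pi>^n.\<close>
  have wd: "\<exists>r\<in>R. w = \<pi> ^ n * r" for n
  proof -
    have "inverse (\<pi> ^ n * x) \<in> R" using neg closed_pointD(3)[OF R] by blast
    moreover have "w = \<pi> ^ n * inverse (\<pi> ^ n * x)" using p(2) x0 by (simp add: w_def field_simps)
    ultimately show ?thesis by blast
  qed
  have w0: "w \<noteq> 0" using x0 by (simp add: w_def)
  have wR: "w \<in> R" using wd[of 0] by auto
  obtain c n where c: "\<And>i j. c i j \<in> F" "\<exists>i\<le>n. \<exists>j\<le>n. c i j \<noteq> 0"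
      "(\<Sum>i\<le>n. \<Sum>j\<le>n. c i j * w ^ i * \<pi> ^ j) = 0"
    by (rule algebraically_dependent[OF F, of w \<pi>]) (rule that)
  obtain i0 where i0: "i0 \<le> n \<and> (\<exists>j\<le>n. c i0 j \<noteq> 0)"
      "\<And>i. i < i0 \<Longrightarrow> \<not> (i \<le> n \<and> (\<exists>j\<le>n. c i j \<noteq> 0))"
    using c(2) exists_least_iff[of "\<lambda>i. i \<le> n \<and> (\<exists>j\<le>n. c i j \<noteq> 0)"] by blast
  then have i0l: "c i j = 0" if "i < i0" "j \<le> n" for i j
    using that by (meson le_trans less_imp_le)
  obtain j0 where j0: "j0 \<le> n \<and> c i0 j0 \<noteq> 0" "\<And>j. j < j0 \<Longrightarrow> \<not> (j \<le> n \<and> c i0 j \<noteq> 0)"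
    using i0(1) exists_least_iff[of "\<lambda>j. j \<le> n \<and> c i0 j \<noteq> 0"] by blast
  then have j0l: "c i0 j = 0" if "j < j0" for j
    using that by (meson le_trans less_imp_le)
  \<comment> \<open>The R-multiples of \<pi> times the least monomial. A term with i = i0 and j > j0
    has an extra \<pi>; one with i > i0 has an extra w, which is divisible by \<pi>^(j0+1).\<close>
  define J where "J = (*) (w ^ i0 * \<pi> ^ Suc j0) ` R"
  have Jsub: "submodule_over (*) R J"
    unfolding J_def by (rule submodule_principal[OF Rr])
  have cR: "c i j \<in> R" for i j using c(1) closed_pointD(2)[OF R] by auto
  have other: "c i j * w ^ i * \<pi> ^ j \<in> J" if "i \<le> n" "j \<le> n" "(i, j) \<noteq> (i0, j0)" for i j
  proof -
    have in_J: "c i j * w ^ i * \<pi> ^ j \<in> J" if "c i j * w ^ i * \<pi> ^ j = (w ^ i0 * \<pi> ^ Suc j0) * r" "r \<in> R" for r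
      using that unfolding J_def by blast
    have "i < i0 \<or> i = i0 \<and> j < j0 \<or> i = i0 \<and> j0 < j \<or> i0 < i"
      using that(3) by auto
    then consider "i < i0" | "i = i0" "j < j0" | "i = i0" "j0 < j" | "i0 < i"
      by blast
    then show ?thesis
    proof cases
      case 3
      then have "\<pi> ^ j = \<pi> ^ Suc j0 * \<pi> ^ (j - Suc j0)" by (metis Suc_leI le_add_diff_inverse power_add)
      then show ?thesis using 3 p(1)
        by (intro in_J[of "c i j * \<pi> ^ (j - Suc j0)"] Rs cR) (auto simp: ac_simps)
    next
      case 4
      obtain r where r: "r \<in> R" "w = \<pi> ^ Suc j0 * r" using wd by blast
      have "w ^ i = w ^ i0 * (w * w ^ (i - Suc i0))"
        using 4 by (simp add: power_add[symmetric] power_Suc[symmetric] del: power_Suc)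
      also have "\<dots> = w ^ i0 * ((\<pi> ^ Suc j0 * r) * w ^ (i - Suc i0))" using r(2) by metis
      finally show ?thesis using p(1) r(1) wR
        by (intro in_J[of "c i j * r * w ^ (i - Suc i0) * \<pi> ^ j"] Rs cR) (auto simp: ac_simps)
    qed (use i0l j0l that submodule_overD(1)[OF Jsub] in auto)
  qed
  let ?S = "{..n} \<times> {..n}"
  have "(\<Sum>p\<in>?S. c (fst p) (snd p) * w ^ fst p * \<pi> ^ snd p) = 0"
    using c(3) by (simp add: sum.cartesian_product split_beta)
  then have "c i0 j0 * w ^ i0 * \<pi> ^ j0 = - (\<Sum>p\<in>?S - {(i0, j0)}. c (fst p) (snd p) * w ^ fst p * \<pi> ^ snd p)"
    using i0 j0 by (subst (asm) sum.remove[of _ "(i0, j0)"]) (auto simp: add_eq_0_iff)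
  also have "\<dots> = (- 1) * (\<Sum>p\<in>?S - {(i0, j0)}. c (fst p) (snd p) * w ^ fst p * \<pi> ^ snd p)" by simp
  also have "\<dots> \<in> J"
    by (intro submodule_overD(3)[OF Jsub] sum_mem_submodule[OF Jsub] other Rs) auto
  finally obtain r where r: "r \<in> R" "c i0 j0 * w ^ i0 * \<pi> ^ j0 = (w ^ i0 * \<pi> ^ Suc j0) * r"
    unfolding J_def by blast
  then have "(w ^ i0 * \<pi> ^ j0) * c i0 j0 = (w ^ i0 * \<pi> ^ j0) * (\<pi> * r)" by (simp add: ac_simps)
  \<comment> \<open>A non-zero constant is a unit of R, so this makes \<pi> a unit.\<close>
  then have "c i0 j0 = \<pi> * r" using w0 p(2) by simp
  then have "inverse \<pi> = r * inverse (c i0 j0)" using j0 p(2) by (simp add: field_simps)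
  moreover have "inverse (c i0 j0) \<in> R"
    using F c(1) closed_pointD(2)[OF R] by (auto simp: curve_function_field_def subfield_of_field_def)
  ultimately show False using p(3) r(1) Rs(6) by simp
qed

lemma subring_regular_outside: "subring_of_field (regular_outside F R)"
  unfolding regular_outside_def subring_of_field_def closed_point_def by blast

lemma constants_regular_outside: "F \<subseteq> regular_outside F R"
  unfolding regular_outside_def closed_point_def by blast

text \<open>A relation between a and y makes y a root of a polynomial over F[a], and y times its
  leading coefficient is integral over A. As an intersection of valuation rings, A is integrally
  closed. That a is a non-unit of A ensures that the polynomial in y is not zero.\<close>

lemma fraction_field_regular_outside:
  assumes F: "curve_function_field F" and A: "A = regular_outside F R"
    and a: "a \<in> A" "a \<noteq> 0" "inverse a \<notin> A"
  shows "\<exists>b\<in>A. b \<noteq> 0 \<and> b * y \<in> A"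
proof -
  note As = subring_of_fieldD[OF subring_regular_outside[of F R], folded A]
  have FA: "F \<subseteq> A" using constants_regular_outside A by blast
  obtain c n where c: "\<And>i j. c i j \<in> F" "\<exists>i\<le>n. \<exists>j\<le>n. c i j \<noteq> 0"
      "(\<Sum>i\<le>n. \<Sum>j\<le>n. c i j * a ^ i * y ^ j) = 0"
    by (rule algebraically_dependent[OF F, of a y]) (rule that)
  define f where "f j = (\<Sum>i\<le>n. c i j * a ^ i)" for j
  have fA: "f j \<in> A" for j
    unfolding f_def A using c(1) FA a(1)
    by (intro sum_mem_subring[OF subring_regular_outside]) (auto simp: A[symmetric] intro!: As)
  have rel: "(\<Sum>j\<le>n. f j * y ^ j) = 0"
    using c(3) unfolding f_def by (subst (asm) sum.swap) (simp add: sum_distrib_right)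
  \<comment> \<open>Otherwise a is algebraic over F: dividing a relation by its lowest power of a
    shows that a divides a non-zero constant in A, so a would be a unit.\<close>
  have "\<exists>j\<le>n. f j \<noteq> 0"
  proof (rule ccontr)
    assume *: "\<not> ?thesis"
    obtain j where j: "j \<le> n" "\<exists>i\<le>n. c i j \<noteq> 0" using c(2) by blast
    obtain i0 where i0: "i0 \<le> n \<and> c i0 j \<noteq> 0" "\<And>i. i < i0 \<Longrightarrow> \<not> (i \<le> n \<and> c i j \<noteq> 0)"
      using j(2) exists_least_iff[of "\<lambda>i. i \<le> n \<and> c i j \<noteq> 0"] by blast
    then have i0l: "c i j = 0" if "i < i0" for i
      using that by (meson le_trans less_imp_le)
    have "f j = c i0 j * a ^ i0 + (\<Sum>i\<in>{..n} - {i0}. c i j * a ^ i)"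
      unfolding f_def using i0 by (subst sum.remove[of _ i0]) auto
    also have "(\<Sum>i\<in>{..n} - {i0}. c i j * a ^ i) = (\<Sum>i\<in>{..n} - {i0}. a ^ i0 * (a * (if i0 < i then c i j * a ^ (i - Suc i0) else 0)))"
    proof (intro sum.cong refl)
      fix i assume i: "i \<in> {..n} - {i0}"
      show "c i j * a ^ i = a ^ i0 * (a * (if i0 < i then c i j * a ^ (i - Suc i0) else 0))"
      proof (cases "i0 < i")
        case True
        then have "a ^ i = a ^ i0 * (a * a ^ (i - Suc i0))"
          by (simp add: power_add[symmetric] power_Suc[symmetric] del: power_Suc)
        then show ?thesis using True by (simp add: ac_simps)
      qed (use i i0l in auto)
    qed
    also have "\<dots> = a ^ i0 * (a * (\<Sum>i\<in>{..n} - {i0}. (if i0 < i then c i j * a ^ (i - Suc i0) else 0)))"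
      (is "_ = a ^ i0 * (a * ?r)")
      by (simp add: sum_distrib_left)
    finally have "a ^ i0 * (c i0 j + a * ?r) = 0" using * j(1) by (simp add: algebra_simps)
    then have "c i0 j + a * ?r = 0" using a(2) by simp
    then have "inverse a = - ?r * inverse (c i0 j)" using i0 a(2) by (simp add: field_simps eq_neg_iff_add_eq_0 add.commute)
    moreover have "?r \<in> A"
      unfolding A using c(1) FA a(1)
      by (intro sum_mem_subring[OF subring_regular_outside]) (auto simp: A[symmetric] intro!: As)
    moreover have "inverse (c i0 j) \<in> A"
      using F c(1) FA by (auto simp: curve_function_field_def subfield_of_field_def)
    ultimately have "inverse a \<in> A" using As(6)[OF As(4)] by simp
    then show False using a(3) by simp
  qed
  then have ne: "{j. j \<le> n \<and> f j \<noteq> 0} \<noteq> {}" by auto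
  define m where "m = Max {j. j \<le> n \<and> f j \<noteq> 0}"
  have m: "m \<le> n" "f m \<noteq> 0" using Max_in[OF _ ne] by (auto simp: m_def)
  have ml: "f j = 0" if "m < j" "j \<le> n" for j
  proof (rule ccontr)
    assume "f j \<noteq> 0"
    then have "j \<le> m" unfolding m_def using that(2) by (intro Max_ge) auto
    then show False using that(1) by simp
  qed
  have rel': "(\<Sum>j\<le>m. f j * y ^ j) = 0"
    unfolding rel[symmetric] using m(1) ml by (intro sum.mono_neutral_left) auto
  show ?thesis
  proof (cases m)
    case 0
    then show ?thesis using rel' m(2) by simp
  next
    case (Suc k)
    define t where "t = f m * y"
    \<comment> \<open>The relation multiplied by \<open>f m ^ k\<close> is monic in t.\<close>
    have rel2: "t ^ Suc k = - (\<Sum>j\<le>k. f j * f m ^ (k - j) * t ^ j)"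
    proof -
      have "f m ^ k * (\<Sum>j\<le>Suc k. f j * y ^ j) = (\<Sum>j\<le>k. f j * f m ^ (k - j) * t ^ j) + t ^ Suc k"
      proof -
        have "f m ^ k * (f j * y ^ j) = f j * f m ^ (k - j) * t ^ j" if "j \<le> k" for j
        proof -
          have "f m ^ k = f m ^ (k - j) * f m ^ j" using that by (simp add: power_add[symmetric])
          then show ?thesis by (simp add: t_def power_mult_distrib ac_simps)
        qed
        then have "(\<Sum>j\<le>k. f m ^ k * (f j * y ^ j)) = (\<Sum>j\<le>k. f j * f m ^ (k - j) * t ^ j)"
          by (intro sum.cong refl) auto
        moreover have "f m ^ k * (f (Suc k) * y ^ Suc k) = t ^ Suc k"
          using Suc by (simp add: t_def power_mult_distrib ac_simps)
        ultimately show ?thesis by (simp only: sum.atMost_Suc distrib_left sum_distrib_left)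
      qed
      then show ?thesis using rel' Suc by (simp add: eq_neg_iff_add_eq_0 add.commute del: power_Suc)
    qed
    \<comment> \<open>Integral closedness of a valuation ring: if t is outside,
      \<open>inverse t\<close> is inside, and the monic equation divided by t^k writes t as a
      polynomial in \<open>inverse t\<close>.\<close>
    have "t \<in> R'" if R': "closed_point F R'" "R' \<noteq> R" for R'
    proof (rule ccontr)
      assume t: "t \<notin> R'"
      note R's = subring_of_fieldD[OF closed_pointD(1)[OF R'(1)]]
      have iR: "inverse t \<in> R'" using t closed_pointD(3)[OF R'(1)] by blast
      have AR: "A \<subseteq> R'" using R' A by (auto simp: regular_outside_def)
      have t0: "t \<noteq> 0" using t R's(1) by auto
      have "t = inverse t ^ k * t ^ Suc k"
        using t0 by (simp add: power_inverse field_simps)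
      also have "\<dots> = - (\<Sum>j\<le>k. inverse t ^ k * (f j * f m ^ (k - j) * t ^ j))"
        unfolding rel2 by (simp add: sum_distrib_left)
      also have "(\<Sum>j\<le>k. inverse t ^ k * (f j * f m ^ (k - j) * t ^ j)) = (\<Sum>j\<le>k. f j * f m ^ (k - j) * inverse t ^ (k - j))"
      proof (intro sum.cong refl)
        fix j assume "j \<in> {..k}"
        then have "inverse t ^ k * t ^ j = inverse t ^ (k - j)"
          using t0 by (simp add: power_diff power_inverse field_simps)
        then show "inverse t ^ k * (f j * f m ^ (k - j) * t ^ j) = f j * f m ^ (k - j) * inverse t ^ (k - j)"
          by (simp add: ac_simps)
      qed
      finally have "t = - (\<Sum>j\<le>k. f j * f m ^ (k - j) * inverse t ^ (k - j))" .
      also have "\<dots> \<in> R'"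
        using fA AR iR by (intro R's(4) sum_mem_subring[OF closed_pointD(1)[OF R'(1)]] R's(6,7)) auto
      finally show False using t by simp
    qed
    then have "f m * y \<in> A" by (auto simp: A regular_outside_def t_def)
    then show ?thesis using fA m(2) by blast
  qed
qed

subsection \<open>A transvection in the congruence subgroup\<close>

text \<open>The vectors with a non-zero A-multiple in P form a K-subspace; closure under scalars is
  where \<open>frac\<close> enters.\<close>

lemma clear_denominators:
  assumes vs: "vector_space s" and A: "subring_of_field A"
    and frac: "\<And>y. \<exists>b\<in>A. b \<noteq> 0 \<and> b * y \<in> A"
    and P: "submodule_over s A P" and x: "x \<in> module.span s P"
  shows "\<exists>c\<in>A. c \<noteq> 0 \<and> s c x \<in> P"
proof -
  interpret vector_space s by (rule vs)
  note As = subring_of_fieldD[OF A] and Ps = submodule_overD[OF P]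
  define Q where "Q = {x. \<exists>c\<in>A. c \<noteq> 0 \<and> s c x \<in> P}"
  have QI: "x \<in> Q" if "c \<in> A" "c \<noteq> 0" "s c x \<in> P" for c x
    using that unfolding Q_def by blast
  have "subspace Q"
    unfolding subspace_def
  proof (intro conjI ballI allI)
    show "0 \<in> Q" using QI[OF As(2), of 0] Ps(1) by simp
    fix u assume "u \<in> Q"
    then obtain c where c: "c \<in> A" "c \<noteq> 0" "s c u \<in> P" unfolding Q_def by blast
    show "u + v \<in> Q" if "v \<in> Q" for v
    proof -
      obtain d where d: "d \<in> A" "d \<noteq> 0" "s d v \<in> P" using \<open>v \<in> Q\<close> unfolding Q_def by blast
      have "s d (s c u) + s c (s d v) \<in> P" by (intro Ps(2,3) c d)
      then have "s (c * d) (u + v) \<in> P" by (simp add: scale_right_distrib mult.commute)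
      then show ?thesis using QI[OF As(6)[OF c(1) d(1)]] c(2) d(2) by simp
    qed
    show "s k u \<in> Q" for k
    proof -
      obtain b where b: "b \<in> A" "b \<noteq> 0" "b * k \<in> A" using frac by blast
      have "s (b * k) (s c u) \<in> P" by (intro Ps(3) c b)
      then have "s (b * c) (s k u) \<in> P" by (simp add: ac_simps)
      then show ?thesis using QI[OF As(6)[OF b(1) c(1)]] b(2) c(2) by simp
    qed
  qed
  moreover have "P \<subseteq> Q" using QI[OF As(2)] by auto
  ultimately have "span P \<subseteq> Q" by (intro span_minimal)
  then show ?thesis using x by (auto simp: Q_def)
qed

lemma vanishing_functional:
  assumes vs: "vector_space s" and W: "module.subspace s W\<^sub>1" "W\<^sub>1 \<noteq> UNIV"
  obtains f where "Vector_Spaces.linear s (*) f" "\<And>x. x \<in> W\<^sub>1 \<Longrightarrow> f x = 0" "\<exists>z. f z \<noteq> 0"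
proof -
  interpret vector_space s by (rule vs)
  interpret p: vector_space_pair s "(*)"
    by (simp add: vector_space_pair_def vs vector_space_over_itself.vector_space_axioms)
  obtain B where B: "B \<subseteq> W\<^sub>1" "independent B" "W\<^sub>1 \<subseteq> span B"
    using maximal_independent_subset[of W\<^sub>1] by blast
  obtain z where z: "z \<notin> W\<^sub>1" using W(2) by blast
  have sB: "span B = W\<^sub>1" using B W(1) by (meson span_minimal subset_antisym)
  then have "independent (insert z B)" using B(2) z by (intro independent_insertI) auto
  then obtain g where g: "Vector_Spaces.linear s (*) g" "\<forall>x\<in>insert z B. g x = of_bool (x = z)"
    using p.linear_independent_extend[of "insert z B" "\<lambda>x. of_bool (x = z)"] by blast
  show thesis
  proof (rule that[OF g(1)])
    have "z \<notin> B" using z B(1) by auto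
    then have "g x = 0" if "x \<in> B" for x using g(2) that by auto
    then show "g x = 0" if "x \<in> W\<^sub>1" for x
      using p.linear_eq_0_on_span[OF g(1)] that sB by blast
    show "\<exists>z. g z \<noteq> 0" using g(2) by (intro exI[of _ z]) simp
  qed
qed

lemma lookup_map_mult: "Poly_Mapping.lookup (Poly_Mapping.map ((*) (a :: 'k::field)) f) j = a * Poly_Mapping.lookup f j"
  by (simp add: Poly_Mapping.map.rep_eq when_def)

text \<open>On vectors supported in J, f after \<rho> is determined by its values at the finitely
  many basis vectors of J, and one c clears the denominators of those values. The induction splits
  off one coordinate.\<close>

lemma bounded_functional_on_free_module:
  fixes A :: "'k::field set"
  assumes A: "subring_of_field A"
    and frac: "\<And>y. \<exists>b\<in>A. b \<noteq> 0 \<and> b * y \<in> A"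
    and \<rho>: "linear_over A (free_module A P) (\<lambda>a. Poly_Mapping.map ((*) a)) s \<rho>"
    and f: "Vector_Spaces.linear s (*) f"
    and J: "finite J" "J \<subseteq> P"
  shows "\<exists>c\<in>A. c \<noteq> 0 \<and> (\<forall>v\<in>free_module A P. Poly_Mapping.keys v \<subseteq> J \<longrightarrow> c * f (\<rho> v) \<in> A)"
  using J
proof induction
  note As = subring_of_fieldD[OF A]
  interpret f: Vector_Spaces.linear s "(*)" f by (rule f)
  have \<rho>a: "\<rho> (u + v) = \<rho> u + \<rho> v" if "u \<in> free_module A P" "v \<in> free_module A P" for u v
    using \<rho> that unfolding linear_over_def by blast
  case empty
  have "0 \<in> free_module A P" using As(1) by (simp add: free_module_def)
  from \<rho>a[OF this this] have "\<rho> 0 = 0" by simp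
  then show ?case using As(1,2) by (intro bexI[of _ 1]) (auto simp: f.zero)
next
  note As = subring_of_fieldD[OF A]
  interpret f: Vector_Spaces.linear s "(*)" f by (rule f)
  have \<rho>a: "\<rho> (u + v) = \<rho> u + \<rho> v" if "u \<in> free_module A P" "v \<in> free_module A P" for u v
    using \<rho> that unfolding linear_over_def by blast
  have \<rho>s: "\<rho> (Poly_Mapping.map ((*) a) v) = s a (\<rho> v)" if "a \<in> A" "v \<in> free_module A P" for a v
    using \<rho> that unfolding linear_over_def by blast
  case (insert j J)
  then obtain c where c: "c \<in> A" "c \<noteq> 0"
      "\<And>v. v \<in> free_module A P \<Longrightarrow> Poly_Mapping.keys v \<subseteq> J \<Longrightarrow> c * f (\<rho> v) \<in> A" by auto
  obtain b where b: "b \<in> A" "b \<noteq> 0" "b * f (\<rho> (Poly_Mapping.single j 1)) \<in> A" using frac by blast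
  have e: "Poly_Mapping.single j 1 \<in> free_module A P"
    using insert.prems As(1,2) by (auto simp: free_module_def lookup_single when_def)
  have "(c * b) * f (\<rho> v) \<in> A" if v: "v \<in> free_module A P" "Poly_Mapping.keys v \<subseteq> insert j J" for v
  proof -
    define a where "a = Poly_Mapping.lookup v j"
    have a: "a \<in> A" using v(1) by (simp add: a_def free_module_def)
    define u where "u = Poly_Mapping.update j 0 v"
    have u: "Poly_Mapping.keys u = Poly_Mapping.keys v - {j}"
      by (auto simp: u_def keys_update)
    have "Poly_Mapping.lookup u k \<in> A" for k
      using v(1) As(1) by (auto simp: u_def lookup_update free_module_def)
    then have uF: "u \<in> free_module A P" using v(1) u by (auto simp: free_module_def)
    have aF: "Poly_Mapping.map ((*) a) (Poly_Mapping.single j 1) \<in> free_module A P"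
      using e a As by (auto simp: free_module_def lookup_map_mult in_keys_iff lookup_single when_def)
    have "v = u + Poly_Mapping.map ((*) a) (Poly_Mapping.single j 1)"
      by (rule poly_mapping_eqI)
         (auto simp: lookup_add lookup_map_mult u_def lookup_update a_def lookup_single when_def)
    then have "\<rho> v = \<rho> u + s a (\<rho> (Poly_Mapping.single j 1))"
      using \<rho>a[OF uF aF] \<rho>s[OF a e] by simp
    then have "(c * b) * f (\<rho> v) = b * (c * f (\<rho> u)) + (c * a) * (b * f (\<rho> (Poly_Mapping.single j 1)))"
      by (simp add: f.add f.scale algebra_simps)
    also have "\<dots> \<in> A"
      using u v(2) by (intro As(3) As(6)[OF b(1)] As(6)[OF As(6)[OF c(1) a] b(3)] c(3)[OF uF]) auto
    finally show ?thesis .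
  qed
  then show ?case using As(6)[OF c(1) b(1)] c(2) b(2) by (intro bexI[of _ "c * b"]) auto
qed

text \<open>Stands in for finite generation of P. Some non-zero multiple of each x in P has its
  coordinates supported where those of a finite K-basis are, and a non-zero scalar does not change
  the support.\<close>

lemma keys_bounded_on_projective:
  fixes A :: "'k::field set"
  assumes vs: "vector_space s" and A: "subring_of_field A"
    and frac: "\<And>y. \<exists>b\<in>A. b \<noteq> 0 \<and> b * y \<in> A"
    and P: "submodule_over s A P" and span: "module.span s P = UNIV"
    and dim: "vector_space.dim s P > 0"
    and \<iota>: "linear_over A P s (\<lambda>a. Poly_Mapping.map ((*) a)) \<iota>" "\<iota> ` P \<subseteq> free_module A P"
  shows "\<exists>J. finite J \<and> J \<subseteq> P \<and> (\<forall>x\<in>P. Poly_Mapping.keys (\<iota> x) \<subseteq> J)"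
proof -
  interpret vector_space s by (rule vs)
  note As = subring_of_fieldD[OF A] and Ps = submodule_overD[OF P]
  have \<iota>a: "\<iota> (u + v) = \<iota> u + \<iota> v" if "u \<in> P" "v \<in> P" for u v
    using \<iota>(1) that unfolding linear_over_def by blast
  have \<iota>s: "\<iota> (s a v) = Poly_Mapping.map ((*) a) (\<iota> v)" if "a \<in> A" "v \<in> P" for a v
    using \<iota>(1) that unfolding linear_over_def by blast
  obtain B where B: "B \<subseteq> P" "independent B" "P \<subseteq> span B" "card B = dim P"
    using basis_exists[of P] by blast
  have finB: "finite B" using B(4) dim by (intro card_ge_0_finite) simp
  have sB: "span B = UNIV" using B(3) span by (metis span_mono span_span top.extremum_uniqueI)
  define J where "J = (\<Union>b\<in>B. Poly_Mapping.keys (\<iota> b))"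
  define Q where "Q = {x \<in> P. Poly_Mapping.keys (\<iota> x) \<subseteq> J}"
  have "submodule_over s A Q"
    unfolding submodule_over_def
  proof (intro conjI ballI)
    from \<iota>a[OF Ps(1) Ps(1)] have "\<iota> 0 = 0" by simp
    then show "0 \<in> Q" using Ps(1) by (simp add: Q_def)
    fix u assume u: "u \<in> Q"
    show "u + v \<in> Q" if "v \<in> Q" for v
      using u that Ps(2)[of u v] keys_add[of "\<iota> u" "\<iota> v"] \<iota>a[of u v] by (auto simp: Q_def)
    show "s a u \<in> Q" if "a \<in> A" for a
      using u that Ps(3)[of a u] \<iota>s[of a u] by (auto simp: Q_def in_keys_iff lookup_map_mult)
  qed
  moreover have "B \<subseteq> Q" using B(1) by (auto simp: Q_def J_def)
  then have "x \<in> span Q" for x using sB span_mono[of B Q] by auto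
  ultimately have cQ: "\<exists>c\<in>A. c \<noteq> 0 \<and> s c x \<in> Q" for x
    by (rule clear_denominators[OF vs A frac])
  have "Poly_Mapping.keys (\<iota> x) \<subseteq> J" if x: "x \<in> P" for x
  proof -
    obtain c where c: "c \<in> A" "c \<noteq> 0" "s c x \<in> Q" using cQ by blast
    have "Poly_Mapping.keys (\<iota> x) = Poly_Mapping.keys (\<iota> (s c x))"
      using c(2) by (auto simp: \<iota>s[OF c(1) x] in_keys_iff lookup_map_mult)
    then show ?thesis using c(3) by (simp add: Q_def)
  qed
  moreover have "finite J" using finB by (simp add: J_def)
  moreover have "J \<subseteq> P" using B(1) \<iota>(2) by (fastforce simp: J_def free_module_def)
  ultimately show ?thesis by blast
qed

text \<open>Projectivity serves to make f integral on P: \<iota> writes elements of P in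
  coordinates, finitely many of which occur, so a multiple of any functional on W takes values in A
  on P.\<close>

lemma transvection_exists:
  fixes A :: "'k::field set" and s :: "'k \<Rightarrow> 'w::ab_group_add \<Rightarrow> 'w"
  assumes vs: "vector_space s" and A: "subring_of_field A"
    and frac: "\<And>y. \<exists>b\<in>A. b \<noteq> 0 \<and> b * y \<in> A"
    and P: "projective_over s A P" and span: "module.span s P = UNIV"
    and dim: "vector_space.dim s P > 0"
    and I: "submodule_over (*) A I" "i \<in> I" "i \<noteq> 0"
    and W: "module.subspace s W\<^sub>1" "W\<^sub>1 \<noteq> UNIV" "W\<^sub>1 \<noteq> {0}"
  obtains f w where "Vector_Spaces.linear s (*) f" "\<And>x. x \<in> W\<^sub>1 \<Longrightarrow> f x = 0" "\<exists>x\<in>P. f x \<noteq> 0"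
    "w \<in> W\<^sub>1" "w \<noteq> 0" "\<And>x. x \<in> P \<Longrightarrow> s (f x) w \<in> ideal_mult s A I P"
proof -
  interpret vector_space s by (rule vs)
  interpret p: vector_space_pair s "(*)"
    by (simp add: vector_space_pair_def vs vector_space_over_itself.vector_space_axioms)
  obtain \<iota> :: "'w \<Rightarrow> 'w \<Rightarrow>\<^sub>0 'k" and \<rho> where Psub: "submodule_over s A P"
    and \<iota>: "linear_over A P s (\<lambda>a. Poly_Mapping.map ((*) a)) \<iota>" "\<iota> ` P \<subseteq> free_module A P"
    and \<rho>: "linear_over A (free_module A P) (\<lambda>a. Poly_Mapping.map ((*) a)) s \<rho>"
    and \<rho>\<iota>: "\<And>x. x \<in> P \<Longrightarrow> \<rho> (\<iota> x) = x"
    using P unfolding projective_over_def by auto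
  obtain J where J: "finite J" "J \<subseteq> P" "\<And>x. x \<in> P \<Longrightarrow> Poly_Mapping.keys (\<iota> x) \<subseteq> J"
    using keys_bounded_on_projective[OF vs A frac Psub span dim \<iota>] by blast
  obtain g where g: "Vector_Spaces.linear s (*) g" "\<And>x. x \<in> W\<^sub>1 \<Longrightarrow> g x = 0" "\<exists>z. g z \<noteq> 0"
    using vanishing_functional[OF vs W(1,2)] by blast
  interpret g: Vector_Spaces.linear s "(*)" g by (rule g(1))
  obtain c where c: "c \<in> A" "c \<noteq> 0" "\<And>v. v \<in> free_module A P \<Longrightarrow> Poly_Mapping.keys v \<subseteq> J \<Longrightarrow> c * g (\<rho> v) \<in> A"
    using bounded_functional_on_free_module[OF A frac \<rho> g(1) J(1,2)] by blast
  have cg: "c * g x \<in> A" if "x \<in> P" for x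
    using c(3)[of "\<iota> x"] J(3)[OF that] \<iota>(2) \<rho>\<iota>[OF that] that by auto
  obtain v where v: "v \<in> W\<^sub>1" "v \<noteq> 0" using W(1,3) subspace_0 by blast
  obtain d where d: "d \<in> A" "d \<noteq> 0" "s d v \<in> P"
    using clear_denominators[OF vs A frac Psub, of v] span by auto
  show thesis
  \<comment> \<open>The factor c makes the functional integral on P, d moves v into P, and i puts
    the image into I P.\<close>
  proof (rule that[of "\<lambda>x. c * g x" "s i (s d v)"])
    show "Vector_Spaces.linear s (*) (\<lambda>x. c * g x)"
      using p.linear_compose_scale_right[OF g(1)] by simp
    show "c * g x = 0" if "x \<in> W\<^sub>1" for x using g(2)[OF that] by simp
    show "\<exists>x\<in>P. c * g x \<noteq> 0"
    proof (rule ccontr)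
      assume "\<not> ?thesis"
      then have "g x = 0" if "x \<in> P" for x using that c(2) by auto
      then have "g x = 0" if "x \<in> span P" for x
        using p.linear_eq_0_on_span[OF g(1)] that by blast
      then show False using g(3) span by auto
    qed
    show "s i (s d v) \<in> W\<^sub>1" using W(1) v(1) by (intro subspace_scale)
    show "s i (s d v) \<noteq> 0" using I(3) d(2) v(2) by simp
    show "s (c * g x) (s i (s d v)) \<in> ideal_mult s A I P" if "x \<in> P" for x
    proof -
      have "(c * g x) * i \<in> I" by (rule submodule_overD(3)[OF I(1) cg[OF that] I(2)])
      then have "s ((c * g x) * i) (s d v) \<in> {s a x | a x. a \<in> I \<and> x \<in> P}" using d(3) by blast
      then have "s ((c * g x) * i) (s d v) \<in> ideal_mult s A I P"
        unfolding ideal_mult_def by (rule subsetD[OF module_span_superset])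
      then show ?thesis by (simp add: mult.assoc)
    qed
  qed
qed

subsection \<open>Lattices and the building\<close>

definition sumset :: "'w::ab_group_add set \<Rightarrow> 'w set \<Rightarrow> 'w set" where
  "sumset L N = {x + y | x y. x \<in> L \<and> y \<in> N}"

lemma sumset_mono: "L \<subseteq> L' \<Longrightarrow> N \<subseteq> N' \<Longrightarrow> sumset L N \<subseteq> sumset L' N'"
  unfolding sumset_def by blast

lemma submodule_sumset:
  assumes "module s" "submodule_over s R L" "submodule_over s R N"
  shows "submodule_over s R (sumset L N)" "L \<subseteq> sumset L N" "N \<subseteq> sumset L N"
    "submodule_over s R M \<Longrightarrow> L \<subseteq> M \<Longrightarrow> N \<subseteq> M \<Longrightarrow> sumset L N \<subseteq> M"
proof -
  interpret module s by (rule assms(1))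
  note L = submodule_overD[OF assms(2)] and N = submodule_overD[OF assms(3)]
  show "L \<subseteq> sumset L N" "N \<subseteq> sumset L N"
    unfolding sumset_def using L(1) N(1) by force+
  show "sumset L N \<subseteq> M" if "submodule_over s R M" "L \<subseteq> M" "N \<subseteq> M"
    unfolding sumset_def using submodule_overD(2)[OF that(1)] that by blast
  have I: "x + y \<in> sumset L N" if "x \<in> L" "y \<in> N" for x y using that unfolding sumset_def by blast
  show "submodule_over s R (sumset L N)"
    unfolding submodule_over_def
  proof (intro conjI ballI)
    show "0 \<in> sumset L N" using I[OF L(1) N(1)] by simp
    fix u assume "u \<in> sumset L N"
    then obtain x y where u: "u = x + y" "x \<in> L" "y \<in> N" unfolding sumset_def by blast
    show "u + v \<in> sumset L N" if "v \<in> sumset L N" for v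
    proof -
      obtain x' y' where v: "v = x' + y'" "x' \<in> L" "y' \<in> N" using \<open>v \<in> sumset L N\<close> unfolding sumset_def by blast
      have "u + v = (x + x') + (y + y')" by (simp add: u v)
      then show ?thesis using I L(2) N(2) u v by metis
    qed
    show "s a u \<in> sumset L N" if "a \<in> R" for a
      using I[OF L(3)[OF that u(2)] N(3)[OF that u(3)]] by (simp add: u(1) scale_right_distrib)
  qed
qed

lemma sumset_module_span:
  assumes "module s"
  shows "sumset (module_span s R X) (module_span s R Y) = module_span s R (X \<union> Y)"
proof
  note sm = submodule_module_span[of s R]
  note ss = submodule_sumset[OF assms sm sm]
  show "sumset (module_span s R X) (module_span s R Y) \<subseteq> module_span s R (X \<union> Y)"
    by (intro ss(4)[OF sm] module_span_mono) auto
  show "module_span s R (X \<union> Y) \<subseteq> sumset (module_span s R X) (module_span s R Y)"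
    by (intro module_span_minimal[OF _ ss(1)] Un_least order_trans[OF module_span_superset ss(2)]
        order_trans[OF module_span_superset ss(3)])
qed

text \<open>What the lattices draw from the curve: \<open>archimedean\<close> lets any finitely
  generated module be scaled into a lattice, and \<open>\<pi>inv\<close> keeps such modules from
  containing a line. \<open>nontrivial\<close> provides non-zero vectors in lattices.\<close>

locale lattice_setting = finite_dimensional_vector_space s Basis
  for s :: "'k::field \<Rightarrow> 'w::ab_group_add \<Rightarrow> 'w" and Basis :: "'w set" +
  fixes R :: "'k set" and \<pi> :: 'k
  assumes R: "subring_of_field R" and \<pi>R: "\<pi> \<in> R" and \<pi>0: "\<pi> \<noteq> 0" and \<pi>inv: "inverse \<pi> \<notin> R"
    and archimedean: "\<And>x. \<exists>n. \<pi> ^ n * x \<in> R" and nontrivial: "Basis \<noteq> {}"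
begin

lemmas R_closed = subring_of_fieldD[OF R]

abbreviation "rmod \<equiv> submodule_over s R"
abbreviation "fingen \<equiv> fin_gen_over s R"
abbreviation "lattice \<equiv> lattice_over s R"
abbreviation "cls \<equiv> homothety_class s \<pi>"

lemma fingen_rmod: "fingen N \<Longrightarrow> rmod N"
  unfolding fin_gen_over_def using submodule_module_span by auto

lemma lattice_iff: "lattice L \<longleftrightarrow> fingen L \<and> span L = UNIV"
proof -
  have "dim L = dim UNIV \<longleftrightarrow> span L = UNIV" by (metis dim_span dim_eq_full dim_UNIV dimension_def)
  then show ?thesis unfolding lattice_over_def using fingen_rmod by auto
qed

lemma linear_image_rmod:
  assumes "Vector_Spaces.linear s s g" "rmod N" shows "rmod (g ` N)"
proof -
  interpret g: Vector_Spaces.linear s s g by (rule assms(1))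
  show ?thesis using assms(2) unfolding submodule_over_def
    by (auto simp: image_iff g.add[symmetric] g.scale[symmetric] intro: bexI[of _ 0] simp: g.zero)
qed

lemma linear_image_sumset:
  assumes "Vector_Spaces.linear s s g" shows "g ` sumset L N = sumset (g ` L) (g ` N)"
proof -
  interpret g: Vector_Spaces.linear s s g by (rule assms(1))
  show ?thesis unfolding sumset_def by (force simp: g.add)
qed

lemma linear_scale_map: "Vector_Spaces.linear s s (s c)"
  by unfold_locales (auto simp: scale_right_distrib ac_simps)

lemma linear_vimage_rmod:
  assumes "Vector_Spaces.linear s s g" "rmod N" shows "rmod {v. g v \<in> N}"
proof -
  interpret g: Vector_Spaces.linear s s g by (rule assms(1))
  show ?thesis using assms(2) unfolding submodule_over_def by (auto simp: g.add g.scale g.zero)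
qed

lemma linear_image_module_span:
  assumes "Vector_Spaces.linear s s g"
  shows "g ` module_span s R X = module_span s R (g ` X)"
proof
  show "module_span s R (g ` X) \<subseteq> g ` module_span s R X"
    using linear_image_rmod[OF assms submodule_module_span]
    by (intro module_span_minimal) (auto intro: imageI subsetD[OF module_span_superset])
  have "module_span s R X \<subseteq> {v. g v \<in> module_span s R (g ` X)}"
    using linear_vimage_rmod[OF assms submodule_module_span]
    by (intro module_span_minimal) (auto intro: subsetD[OF module_span_superset])
  then show "g ` module_span s R X \<subseteq> module_span s R (g ` X)" by auto
qed

lemma linear_image_fingen: "Vector_Spaces.linear s s g \<Longrightarrow> fingen N \<Longrightarrow> fingen (g ` N)"
  unfolding fin_gen_over_def using linear_image_module_span by (metis finite_imageI)

lemma fingen_sumset: "fingen L \<Longrightarrow> fingen N \<Longrightarrow> fingen (sumset L N)"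
  unfolding fin_gen_over_def using sumset_module_span[OF module_axioms] by (metis finite_UnI)

lemma lattice_sumset:
  assumes "lattice L" "fingen N" shows "lattice (sumset L N)"
proof -
  have "L \<subseteq> sumset L N"
    using assms by (intro submodule_sumset(2)[OF module_axioms, of R] fingen_rmod) (auto simp: lattice_iff)
  then have "span (sumset L N) = UNIV" using assms(1) span_mono[of L "sumset L N"] by (auto simp: lattice_iff)
  then show ?thesis using assms fingen_sumset by (auto simp: lattice_iff)
qed

lemma scale_powi_image: "s a ` (s b ` L) = s (a * b) ` L"
  by (auto simp: image_iff)

lemma scale_powi_mono:
  assumes N: "rmod N" and le: "m \<le> n" shows "s (\<pi> powi n) ` N \<subseteq> s (\<pi> powi m) ` N"
proof (intro image_subsetI)
  fix x assume x: "x \<in> N"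
  have "\<pi> powi n = \<pi> powi m * \<pi> ^ nat (n - m)"
    using \<pi>0 le power_int_add[of \<pi> m "n - m"] by (simp add: power_int_def)
  then have "s (\<pi> powi n) x = s (\<pi> powi m) (s (\<pi> ^ nat (n - m)) x)" by simp
  moreover have "s (\<pi> ^ nat (n - m)) x \<in> N" using submodule_overD(3)[OF N R_closed(7)[OF \<pi>R] x] .
  ultimately show "s (\<pi> powi n) x \<in> s (\<pi> powi m) ` N" by blast
qed

lemma scale_\<pi>_subset: "rmod N \<Longrightarrow> s \<pi> ` N \<subseteq> N"
  using submodule_overD(3)[OF _ \<pi>R] by blast

lemma scale_power_mono: "rmod N \<Longrightarrow> m \<le> n \<Longrightarrow> s (\<pi> ^ n) ` N \<subseteq> s (\<pi> ^ m) ` N"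
  using scale_powi_mono[of N "int m" "int n"] by simp

lemma scale_image_subset_iff: "c \<noteq> 0 \<Longrightarrow> s c ` L \<subseteq> s c ` N \<longleftrightarrow> L \<subseteq> N"
  by (rule inj_image_subset_iff) (simp add: inj_def)

text \<open>The vectors that some power of \<pi> carries into L form a K-subspace by
  \<open>archimedean\<close>; it contains L, so it is everything. The exponents for the finitely
  many generators of N have a common bound.\<close>

lemma absorb:
  assumes L: "lattice L" and N: "fingen N"
  shows "\<exists>n0. \<forall>n\<ge>n0. s (\<pi> ^ n) ` N \<subseteq> L"
proof -
  have Lr: "rmod L" and sL: "span L = UNIV" using L fingen_rmod by (auto simp: lattice_iff)
  note Ls = submodule_overD[OF Lr]
  have up: "s (\<pi> ^ n) x \<in> L" if "s (\<pi> ^ m) x \<in> L" "m \<le> n" for m n x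
  proof -
    have "\<pi> ^ n = \<pi> ^ (n - m) * \<pi> ^ m" using that(2) by (simp add: power_add[symmetric])
    then have "s (\<pi> ^ n) x = s (\<pi> ^ (n - m)) (s (\<pi> ^ m) x)" by simp
    then show ?thesis using Ls(3)[OF R_closed(7)[OF \<pi>R] that(1)] by (simp del: scale_scale)
  qed
  define Q where "Q = {x. \<exists>n. s (\<pi> ^ n) x \<in> L}"
  have "subspace Q"
    unfolding subspace_def
  proof (intro conjI ballI allI)
    show "0 \<in> Q" using Ls(1) by (simp add: Q_def)
    fix u assume "u \<in> Q"
    then obtain n where n: "s (\<pi> ^ n) u \<in> L" by (auto simp: Q_def)
    show "u + v \<in> Q" if "v \<in> Q" for v
    proof -
      obtain m where m: "s (\<pi> ^ m) v \<in> L" using \<open>v \<in> Q\<close> by (auto simp: Q_def)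
      have "s (\<pi> ^ (n + m)) u + s (\<pi> ^ (n + m)) v \<in> L"
        by (intro Ls(2) up[OF n] up[OF m]) auto
      then show ?thesis unfolding Q_def by (auto simp: scale_right_distrib[symmetric])
    qed
    show "s k u \<in> Q" for k
    proof -
      obtain m where m: "\<pi> ^ m * k \<in> R" using archimedean by blast
      have "s (\<pi> ^ m * k) (s (\<pi> ^ n) u) \<in> L" by (rule Ls(3)[OF m n])
      moreover have "s (\<pi> ^ m * k) (s (\<pi> ^ n) u) = s (\<pi> ^ (m + n)) (s k u)"
        by (simp add: power_add ac_simps)
      ultimately have "s (\<pi> ^ (m + n)) (s k u) \<in> L" by (simp only:)
      then show ?thesis unfolding Q_def by blast
    qed
  qed
  moreover have "L \<subseteq> Q" unfolding Q_def by (auto intro: exI[of _ 0])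
  ultimately have Q: "x \<in> Q" for x using span_minimal[of L Q] sL by auto
  obtain X where X: "finite X" "N = module_span s R X" using N by (auto simp: fin_gen_over_def)
  have "\<exists>n0. \<forall>x\<in>X. s (\<pi> ^ n0) x \<in> L"
    using X(1)
  proof induction
    case (insert x X)
    then obtain n0 where n0: "\<forall>x\<in>X. s (\<pi> ^ n0) x \<in> L" by blast
    obtain m where "s (\<pi> ^ m) x \<in> L" using Q[of x] by (auto simp: Q_def)
    then show ?case using n0 up by (intro exI[of _ "n0 + m"]) auto
  qed auto
  then obtain n0 where n0: "\<And>x. x \<in> X \<Longrightarrow> s (\<pi> ^ n0) x \<in> L" by blast
  have "s (\<pi> ^ n) ` N \<subseteq> L" if "n \<ge> n0" for n
  proof -
    have "N \<subseteq> {v. s (\<pi> ^ n) v \<in> L}"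
      unfolding X(2) using n0 up[OF _ that]
      by (intro module_span_minimal linear_vimage_rmod[OF linear_scale_map Lr]) auto
    then show ?thesis by auto
  qed
  then show ?thesis by blast
qed

text \<open>A functional with value 1 at x takes values in \<pi>^(-m) R on N for some m, but its
  value at \<pi>^(-m-1) x is outside that module.\<close>

lemma no_line:
  assumes N: "fingen N" and x: "x \<noteq> 0"
  shows "\<exists>n. s (inverse \<pi> ^ n) x \<notin> N"
proof (rule ccontr)
  assume *: "\<not> ?thesis"
  interpret p: vector_space_pair s "(*)"
    by (simp add: vector_space_pair_def vector_space_axioms vector_space_over_itself.vector_space_axioms)
  have "independent {x}" using x by (simp add: dependent_single)
  then obtain f where f: "Vector_Spaces.linear s (*) f" "\<forall>y\<in>{x}. f y = 1"
    using p.linear_independent_extend[of "{x}" "\<lambda>_. 1"] by blast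
  interpret f: Vector_Spaces.linear s "(*)" f by (rule f(1))
  obtain X where X: "finite X" "N = module_span s R X" using N by (auto simp: fin_gen_over_def)
  have "\<exists>m. \<forall>y\<in>X. \<pi> ^ m * f y \<in> R"
    using X(1)
  proof induction
    case (insert y X)
    then obtain m where m: "\<And>y. y \<in> X \<Longrightarrow> \<pi> ^ m * f y \<in> R" by blast
    obtain k where k: "\<pi> ^ k * f y \<in> R" using archimedean by blast
    have "\<pi> ^ (m + k) * f z \<in> R" if "z \<in> insert y X" for z
    proof (cases "z = y")
      case True
      then show ?thesis using R_closed(6)[OF R_closed(7)[OF \<pi>R] k, of m] by (simp add: power_add ac_simps)
    next
      case False
      then have "\<pi> ^ m * f z \<in> R" using that m by auto
      then show ?thesis using R_closed(6)[OF R_closed(7)[OF \<pi>R], of "\<pi> ^ m * f z" k] by (simp add: power_add ac_simps)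
    qed
    then show ?case by blast
  qed auto
  then obtain m where m: "\<And>y. y \<in> X \<Longrightarrow> \<pi> ^ m * f y \<in> R" by blast
  have "submodule_over s R {v. \<pi> ^ m * f v \<in> R}"
    unfolding submodule_over_def
    by (auto simp: f.zero f.add f.scale distrib_left mult.left_commute intro: R_closed)
  then have "N \<subseteq> {v. \<pi> ^ m * f v \<in> R}" unfolding X(2) using m by (intro module_span_minimal) auto
  then have "\<pi> ^ m * f (s (inverse \<pi> ^ Suc m) x) \<in> R" using * by blast
  moreover have "\<pi> ^ m * f (s (inverse \<pi> ^ Suc m) x) = inverse \<pi>"
    using \<pi>0 f(2) by (simp add: f.scale power_inverse field_simps)
  ultimately show False using \<pi>inv by simp
qed

end

section \<open>Normalised representatives of the vertices\<close>

locale lattice_base = lattice_setting s Basis R \<pi>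
  for s :: "'k::field \<Rightarrow> 'w::ab_group_add \<Rightarrow> 'w" and Basis R \<pi> +
  fixes L\<^sub>0 :: "'w set"
  assumes L\<^sub>0: "lattice L\<^sub>0"
begin

text \<open>For an R-module N this says that N lies in \<open>L\<^sub>0\<close> and N / \<pi> does
  not, so N is the largest member of its homothety class inside \<open>L\<^sub>0\<close>.\<close>

definition normalised :: "'w set \<Rightarrow> bool" where
  "normalised N \<longleftrightarrow> N \<subseteq> L\<^sub>0 \<and> \<not> N \<subseteq> s \<pi> ` L\<^sub>0"

definition nrm :: "'w set set \<Rightarrow> 'w set" where
  "nrm c = (THE N. N \<in> c \<and> normalised N)"

definition is_vertex :: "'w set set \<Rightarrow> bool" where
  "is_vertex c \<longleftrightarrow> (\<exists>L. lattice L \<and> c = cls L)"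

lemma lattice_rmod: "lattice L \<Longrightarrow> rmod L"
  using lattice_iff fingen_rmod by blast

lemma mem_cls_iff: "N \<in> cls L \<longleftrightarrow> (\<exists>k. N = s (\<pi> powi k) ` L)"
  unfolding homothety_class_def by auto

lemma scale_powi_add: "s (\<pi> powi m) ` (s (\<pi> powi n) ` L) = s (\<pi> powi (m + n)) ` L"
  by (simp add: scale_powi_image power_int_add \<pi>0)

lemma scale_\<pi>_powi: "s \<pi> ` (s (\<pi> powi n) ` L) = s (\<pi> powi (n + 1)) ` L"
  using scale_powi_add[of 1 n L] by (simp add: add.commute)

lemma mem_cls_self: "L \<in> cls L"
  unfolding mem_cls_iff by (intro exI[of _ 0]) simp

lemma cls_eq: assumes "N \<in> cls L" shows "cls N = cls L"
proof -
  obtain k where k: "N = s (\<pi> powi k) ` L" using assms mem_cls_iff by auto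
  have "X \<in> cls N \<longleftrightarrow> X \<in> cls L" for X
  proof
    show "X \<in> cls L" if "X \<in> cls N"
      using that unfolding mem_cls_iff k scale_powi_add by blast
    assume "X \<in> cls L"
    then obtain n where "X = s (\<pi> powi n) ` L" using mem_cls_iff by auto
    then have "X = s (\<pi> powi (n - k)) ` N" unfolding k scale_powi_add by simp
    then show "X \<in> cls N" using mem_cls_iff by blast
  qed
  then show ?thesis by blast
qed

lemma lattice_scale: assumes "lattice L" "c \<noteq> 0" shows "lattice (s c ` L)"
proof -
  have "x \<in> span (s c ` L)" if "x \<in> L" for x
  proof -
    have "s (inverse c) (s c x) \<in> span (s c ` L)" using that by (intro span_scale span_base) blast
    then show ?thesis using assms(2) by simp
  qed
  then have "span L \<subseteq> span (s c ` L)" by (intro span_minimal subspace_span) auto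
  then show ?thesis
    using assms(1) linear_image_fingen[OF linear_scale_map] by (auto simp: lattice_iff)
qed

lemma lattice_mem_cls: "lattice L \<Longrightarrow> N \<in> cls L \<Longrightarrow> lattice N"
  unfolding mem_cls_iff using lattice_scale \<pi>0 by auto

lemma normalised_exists:
  assumes L: "lattice L" shows "\<exists>N\<in>cls L. normalised N"
proof -
  let ?S = "\<lambda>n. s (\<pi> powi n) ` L \<subseteq> L\<^sub>0"
  have Lf: "fingen L" "span L = UNIV" using L by (auto simp: lattice_iff)
  obtain n0 :: nat where "\<forall>n\<ge>n0. s (\<pi> ^ n) ` L \<subseteq> L\<^sub>0" using absorb[OF L\<^sub>0 Lf(1)] by blast
  then have n0: "?S (int n0)" by simp
  have "\<exists>x\<in>L. x \<noteq> 0"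
  proof (rule ccontr)
    assume "\<not> ?thesis"
    then have "span L \<subseteq> {0}" by (intro span_minimal) (auto simp: subspace_0 subspace_def)
    then have "Basis \<subseteq> {0}" using Lf(2) by auto
    then have "Basis = {0}" using nontrivial by auto
    then show False using independent_Basis dependent_zero[of Basis] by auto
  qed
  then obtain x where x: "x \<in> L" "x \<noteq> 0" by blast
  obtain k where k: "s (inverse \<pi> ^ k) x \<notin> L\<^sub>0" using no_line[OF _ x(2), of L\<^sub>0] L\<^sub>0 by (auto simp: lattice_iff)
  have "\<not> ?S (- int k)"
    using k x(1) by (auto simp: power_int_minus power_inverse)
  \<comment> \<open>Some scale fits by \<open>absorb\<close> and some does not by
    \<open>no_line\<close>. Walking down from the fitting exponent \<open>n0\<close>, the first
    failure j is positive, so j - 1 is a success.\<close>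
  then have "\<exists>j::nat. \<not> ?S (int n0 - int j)"
    by (intro exI[of _ "n0 + k"]) simp
  then obtain j :: nat where j: "\<not> ?S (int n0 - int j)" "\<forall>i<j. ?S (int n0 - int i)"
    using exists_least_iff[of "\<lambda>j. \<not> ?S (int n0 - int j)"] by blast
  have j0: "j \<noteq> 0" using j(1) n0 by (intro notI) simp
  define n where "n = int n0 - int (j - 1)"
  have "n - 1 = int n0 - int j" using j0 by (simp add: n_def of_nat_diff)
  then have n: "?S n" "\<not> ?S (n - 1)"
    using j(1) j(2)[rule_format, of "j - 1"] j0 unfolding n_def by (simp_all only:) simp
  have "\<not> s (\<pi> powi n) ` L \<subseteq> s \<pi> ` L\<^sub>0"
  proof
    assume "s (\<pi> powi n) ` L \<subseteq> s \<pi> ` L\<^sub>0"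
    then have "s \<pi> ` (s (\<pi> powi (n - 1)) ` L) \<subseteq> s \<pi> ` L\<^sub>0" by (simp only: scale_\<pi>_powi) simp
    then show False using n(2) scale_image_subset_iff[OF \<pi>0] by blast
  qed
  then show ?thesis using n(1) mem_cls_iff unfolding normalised_def by blast
qed

text \<open>The modules \<pi>^k L decrease with k, so exponents beyond a already land in \<pi>
  \<open>L\<^sub>0\<close>. This gives uniqueness of the normalised member and bounds the difference
  of exponents of adjacent lattices.\<close>

lemma normalised_exponent_le:
  assumes L: "rmod L" and a: "s (\<pi> powi a) ` L \<subseteq> L\<^sub>0" and b: "\<not> s (\<pi> powi b) ` L \<subseteq> s \<pi> ` L\<^sub>0"
  shows "b \<le> a"
proof (rule ccontr)
  assume "\<not> ?thesis"
  then have "s (\<pi> powi b) ` L \<subseteq> s (\<pi> powi (a + 1)) ` L" by (intro scale_powi_mono L) simp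
  also have "\<dots> = s \<pi> ` (s (\<pi> powi a) ` L)" by (simp only: scale_\<pi>_powi)
  also have "\<dots> \<subseteq> s \<pi> ` L\<^sub>0" by (intro image_mono a)
  finally show False using b by blast
qed

lemma normalised_unique:
  assumes L: "lattice L" and N: "N \<in> cls L" "normalised N" and N': "N' \<in> cls L" "normalised N'"
  shows "N = N'"
proof -
  obtain a b where ab: "N = s (\<pi> powi a) ` L" "N' = s (\<pi> powi b) ` L" using N N' mem_cls_iff by auto
  have "a = b"
    using normalised_exponent_le[OF lattice_rmod[OF L], of a b] normalised_exponent_le[OF lattice_rmod[OF L], of b a]
      N(2) N'(2) unfolding normalised_def ab by auto
  then show ?thesis using ab by simp
qed

lemma nrm_props:
  assumes "is_vertex c"
  shows "nrm c \<in> c" "normalised (nrm c)" "lattice (nrm c)" "cls (nrm c) = c"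
proof -
  obtain L where L: "lattice L" "c = cls L" using assms by (auto simp: is_vertex_def)
  obtain N where N: "N \<in> c" "normalised N" using normalised_exists[OF L(1)] L(2) by blast
  have "nrm c = N"
    unfolding nrm_def
  proof (rule the_equality)
    show "N' = N" if "N' \<in> c \<and> normalised N'" for N'
      using normalised_unique[OF L(1), of N' N] that N L(2) by blast
  qed (use N in blast)
  then show "nrm c \<in> c" "normalised (nrm c)" "lattice (nrm c)" "cls (nrm c) = c"
    using N L lattice_mem_cls cls_eq by auto
qed

lemma nrm_cls:
  assumes "lattice N" "normalised N" shows "nrm (cls N) = N" "is_vertex (cls N)"
proof -
  show v: "is_vertex (cls N)" using assms by (auto simp: is_vertex_def)
  show "nrm (cls N) = N"
    by (rule normalised_unique[OF assms(1) nrm_props(1,2)[OF v] mem_cls_self assms(2)])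
qed

text \<open>Turns the chain condition in \<open>building\<close> into a symmetric pairwise one: by
  \<open>building_subset\<close> and \<open>building_supset\<close>, simplices are the finite
  non-empty sets of vertices with pairwise adjacent normalised members.\<close>

definition adjacent :: "'w set \<Rightarrow> 'w set \<Rightarrow> bool" where
  "adjacent N N' \<longleftrightarrow> (N \<subseteq> N' \<or> N' \<subseteq> N) \<and> s \<pi> ` N \<subseteq> N' \<and> s \<pi> ` N' \<subseteq> N"

lemma adjacent_sym: "adjacent N N' \<Longrightarrow> adjacent N' N"
  unfolding adjacent_def by auto

text \<open>The exponents satisfy b \<le> a \<le> b + 1. If they agree, the inclusion L' \<subseteq>
  L is kept; if a = b + 1, it is \<pi> L \<subseteq> L' that becomes the inclusion of the normalised
  members.\<close>

lemma adjacent_nrm: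
  assumes L: "lattice L" and L': "lattice L'" and sub: "L' \<subseteq> L" "s \<pi> ` L \<subseteq> L'"
  shows "adjacent (nrm (cls L)) (nrm (cls L'))"
proof -
  have v: "is_vertex (cls L)" "is_vertex (cls L')" using L L' by (auto simp: is_vertex_def)
  obtain a b where ab: "nrm (cls L) = s (\<pi> powi a) ` L" "nrm (cls L') = s (\<pi> powi b) ` L'"
    using nrm_props(1)[OF v(1)] nrm_props(1)[OF v(2)] mem_cls_iff by metis
  note na = nrm_props(2)[OF v(1), unfolded normalised_def ab] and nb = nrm_props(2)[OF v(2), unfolded normalised_def ab]
  note Lr = lattice_rmod[OF L] and L'r = lattice_rmod[OF L']
  have 1: "s (\<pi> powi n) ` L' \<subseteq> s (\<pi> powi n) ` L" for n by (intro image_mono sub)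
  have 2: "s (\<pi> powi (n + 1)) ` L \<subseteq> s (\<pi> powi n) ` L'" for n
  proof -
    have "s (\<pi> powi n) ` (s (\<pi> powi 1) ` L) \<subseteq> s (\<pi> powi n) ` L'" using sub(2) by (intro image_mono) simp
    then show ?thesis by (simp only: scale_powi_add)
  qed
  have "b \<le> a"
    by (rule normalised_exponent_le[OF L'r order_trans[OF 1]]) (use na nb in blast)+
  moreover have "a \<le> b + 1"
    by (rule normalised_exponent_le[OF Lr order_trans[OF 2]]) (use na nb in blast)+
  ultimately consider "a = b" | "a = b + 1" by linarith
  then show ?thesis
  proof cases
    case a: 1
    show ?thesis unfolding adjacent_def ab scale_\<pi>_powi a
      by (intro conjI disjI2 1 2 order_trans[OF scale_powi_mono[OF L'r] 1]) simp
  next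
    case a: 2
    show ?thesis unfolding adjacent_def ab scale_\<pi>_powi a
      by (intro conjI disjI1 1 2 order_trans[OF scale_powi_mono[OF Lr] 2]) simp
  qed
qed

lemma building_subset:
  assumes "\<sigma> \<in> building s R \<pi>"
  shows "finite \<sigma> \<and> \<sigma> \<noteq> {} \<and> (\<forall>c\<in>\<sigma>. is_vertex c) \<and> (\<forall>c\<in>\<sigma>. \<forall>c'\<in>\<sigma>. adjacent (nrm c) (nrm c'))"
proof -
  obtain d :: nat and L where \<sigma>: "\<sigma> = (\<lambda>i. cls (L i)) ` {..d}"
    and lat: "\<And>i. i \<le> d \<Longrightarrow> lattice (L i)" and dec: "\<And>i. i < d \<Longrightarrow> L (Suc i) \<subset> L i"
    and top: "s \<pi> ` L 0 \<subset> L d"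
    using assms unfolding building_def by blast
  have mono: "L j \<subseteq> L i" if "i \<le> j" "j \<le> d" for i j
    using that
  proof (induction j rule: dec_induct)
    case (step n)
    then show ?case using dec[of n] by auto
  qed auto
  have adj: "adjacent (nrm (cls (L i))) (nrm (cls (L j)))" if "i \<le> j" "j \<le> d" for i j
  proof (rule adjacent_nrm[OF lat lat mono[OF that]])
    have "s \<pi> ` L i \<subseteq> s \<pi> ` L 0" using that by (intro image_mono mono) auto
    also have "\<dots> \<subseteq> L j" using top mono[OF that(2) le_refl] by auto
    finally show "s \<pi> ` L i \<subseteq> L j" .
  qed (use that in auto)
  have "adjacent (nrm (cls (L i))) (nrm (cls (L j)))" if "i \<le> d" "j \<le> d" for i j
    using adj[of i j] adj[of j i] that adjacent_sym by (cases "i \<le> j") auto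
  then show ?thesis using \<sigma> lat by (auto simp: is_vertex_def)
qed

lemma building_supset:
  assumes fin: "finite \<sigma>" and ne: "\<sigma> \<noteq> {}" and v: "\<And>c. c \<in> \<sigma> \<Longrightarrow> is_vertex c"
    and adj: "\<And>c c'. c \<in> \<sigma> \<Longrightarrow> c' \<in> \<sigma> \<Longrightarrow> adjacent (nrm c) (nrm c')"
  shows "\<sigma> \<in> building s R \<pi>"
proof -
  define \<N> where "\<N> = nrm ` \<sigma>"
  have inj: "inj_on nrm \<sigma>" by (rule inj_on_inverseI[of _ cls]) (use nrm_props(4) v in auto)
  have fN: "finite \<N>" and cN: "card \<N> = card \<sigma>" using fin card_image[OF inj] by (auto simp: \<N>_def)
  have comp: "X \<subset> Y \<or> Y \<subset> X" if "X \<in> \<N>" "Y \<in> \<N>" "X \<noteq> Y" for X Y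
    using adj that unfolding \<N>_def adjacent_def by blast
  \<comment> \<open>Counting the strictly larger members numbers the chain from its largest lattice,
    at 0, to its smallest.\<close>
  define k where "k X = card {Y \<in> \<N>. X \<subset> Y}" for X
  have k_less: "k Y < k X" if "X \<subset> Y" "X \<in> \<N>" "Y \<in> \<N>" for X Y
    unfolding k_def by (rule psubset_card_mono) (use that fN in auto)
  have k_inj: "inj_on k \<N>"
    using comp k_less by (intro inj_onI) (metis less_irrefl)
  have k_lt: "k ` \<N> \<subseteq> {..<card \<N>}"
  proof (intro image_subsetI)
    fix X assume "X \<in> \<N>"
    then have "k X < card \<N>" unfolding k_def by (intro psubset_card_mono fN) auto
    then show "k X \<in> {..<card \<N>}" by simp
  qed
  have k_im: "k ` \<N> = {..<card \<N>}"
    by (rule card_subset_eq[OF _ k_lt]) (simp_all add: card_image[OF k_inj])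
  obtain d where d: "card \<sigma> = Suc d" using fin ne by (metis card_0_eq not0_implies_Suc)
  have rng: "{..<card \<N>} = {..d}" using d cN by auto
  define L where "L = inv_into \<N> k"
  have L\<N>: "L ` {..d} = \<N>"
    unfolding L_def rng[symmetric] k_im[symmetric] by (rule inv_into_image_cancel[OF k_inj subset_refl])
  have LN: "L i \<in> \<N>" if "i \<le> d" for i using L\<N> that by blast
  have kL: "k (L i) = i" if "i \<le> d" for i
    unfolding L_def using that k_im rng by (intro f_inv_into_f) auto
  have dec: "L j \<subset> L i" if "i < j" "j \<le> d" for i j
  proof -
    have "L i \<noteq> L j" using kL[of i] kL[of j] that by auto
    moreover have "\<not> L i \<subset> L j" using k_less[of "L i" "L j"] kL[of i] kL[of j] LN that by auto
    ultimately show ?thesis using comp[OF LN LN, of i j] that by auto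
  qed
  have im: "\<exists>c\<in>\<sigma>. L i = nrm c" if "i \<le> d" for i using LN[OF that] by (auto simp: \<N>_def)
  have "\<sigma> = cls ` \<N>" unfolding \<N>_def image_image using nrm_props(4) v by auto
  then have "\<sigma> = (\<lambda>i. cls (L i)) ` {..d}" unfolding L\<N>[symmetric] by (simp add: image_image)
  moreover have "\<forall>i\<le>d. lattice (L i)" using im nrm_props(3) v by metis
  moreover have "\<forall>i<d. L (Suc i) \<subset> L i" using dec by auto
  \<comment> \<open>Strict because the left side lies in \<pi> \<open>L\<^sub>0\<close>, and a
    normalised lattice does not.\<close>
  moreover have "s \<pi> ` L 0 \<subset> L d"
  proof -
    obtain c c' where c: "c \<in> \<sigma>" "L 0 = nrm c" "c' \<in> \<sigma>" "L d = nrm c'" using im[of 0] im[of d] by auto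
    have "s \<pi> ` L 0 \<subseteq> L d" using adj[OF c(1,3)] c by (simp add: adjacent_def)
    moreover have "s \<pi> ` L 0 \<subseteq> s \<pi> ` L\<^sub>0" "\<not> L d \<subseteq> s \<pi> ` L\<^sub>0"
      using nrm_props(2)[OF v[OF c(1)]] nrm_props(2)[OF v[OF c(3)]] c by (auto simp: normalised_def)
    ultimately show ?thesis by auto
  qed
  moreover have "card \<sigma> = d + 1" using d by simp
  ultimately show ?thesis unfolding building_def by blast
qed

section \<open>Deformations that enlarge the lattices\<close>

definition stabilised_complex :: "('w \<Rightarrow> 'w) set \<Rightarrow> 'w set \<Rightarrow> 'w set set set set" where
  "stabilised_complex G M = {\<sigma> \<in> building s R \<pi>.
     (\<exists>g\<in>G. \<forall>c\<in>\<sigma>. g ` nrm c = nrm c) \<and> (\<forall>c\<in>\<sigma>. M \<subseteq> nrm c)}"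

definition enlarge :: "'w set \<Rightarrow> 'w set set \<Rightarrow> 'w set set" where
  "enlarge K c = cls (sumset (nrm c) K)"

text \<open>The sum stays inside \<open>L\<^sub>0\<close>, and since it contains
  \<open>nrm c\<close> it is not inside \<pi> \<open>L\<^sub>0\<close>; so it is normalised as it
  stands.\<close>

lemma nrm_enlarge:
  assumes c: "is_vertex c" and K: "fingen K" "K \<subseteq> L\<^sub>0"
  shows "is_vertex (enlarge K c)" "nrm (enlarge K c) = sumset (nrm c) K"
proof -
  have l: "lattice (sumset (nrm c) K)" by (rule lattice_sumset[OF nrm_props(3)[OF c] K(1)])
  note ss = submodule_sumset[OF module_axioms lattice_rmod[OF nrm_props(3)[OF c]] fingen_rmod[OF K(1)]]
  have "sumset (nrm c) K \<subseteq> L\<^sub>0"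
    using nrm_props(2)[OF c] K(2) by (intro ss(4) lattice_rmod[OF L\<^sub>0]) (auto simp: normalised_def)
  moreover have "\<not> sumset (nrm c) K \<subseteq> s \<pi> ` L\<^sub>0"
    using nrm_props(2)[OF c] ss(2) unfolding normalised_def by blast
  ultimately have n: "normalised (sumset (nrm c) K)" by (simp add: normalised_def)
  show "is_vertex (enlarge K c)" "nrm (enlarge K c) = sumset (nrm c) K"
    unfolding enlarge_def using nrm_cls[OF l n] by auto
qed

lemma enlarge_eq:
  assumes c: "is_vertex c" and K: "rmod K" "K \<subseteq> nrm c"
  shows "enlarge K c = c"
proof -
  note r = lattice_rmod[OF nrm_props(3)[OF c]]
  note ss = submodule_sumset[OF module_axioms r K(1)]
  have "sumset (nrm c) K = nrm c" using ss(2) ss(4)[OF r subset_refl K(2)] by blast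
  then show ?thesis unfolding enlarge_def using nrm_props(4)[OF c] by simp
qed

text \<open>\<open>Q\<close> lists vertices with indices. By \<open>comp\<close>, larger lattices
  come with smaller indices and hence larger \<open>K n\<close>, so the sums form a chain; as
  indices differ by at most 1, \<pi> K n \<subseteq> K (n+1) gives the remaining inclusions. It
  serves the intermediate stages and, with constant index 0, the end of a deformation.\<close>

lemma enlarge_simplex:
  assumes \<sigma>: "\<sigma> \<in> building s R \<pi>"
    and g: "g \<in> G" "Vector_Spaces.linear s s g" "\<And>c. c \<in> \<sigma> \<Longrightarrow> g ` nrm c = nrm c" "\<And>n. g ` K n = K n"
    and K: "\<And>n. fingen (K n)" "\<And>n. K n \<subseteq> L\<^sub>0" "\<And>n. K (Suc n) \<subseteq> K n" "\<And>n. s \<pi> ` K n \<subseteq> K (Suc n)"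
    and Q: "Q \<subseteq> \<sigma> \<times> UNIV" "finite Q" "Q \<noteq> {}"
    and comp: "\<And>v n v' n'. (v, n) \<in> Q \<Longrightarrow> (v', n') \<in> Q \<Longrightarrow>
      (nrm v \<subseteq> nrm v' \<and> n' \<le> n \<or> nrm v' \<subseteq> nrm v \<and> n \<le> n') \<and> n' \<le> Suc n"
    and M: "\<And>v n. (v, n) \<in> Q \<Longrightarrow> M \<subseteq> sumset (nrm v) (K n)"
  shows "(\<lambda>(v, n). enlarge (K n) v) ` Q \<in> stabilised_complex G M"
proof -
  note b = building_subset[OF \<sigma>]
  have v: "is_vertex c" if "(c, n) \<in> Q" for c n using b Q(1) that by auto
  note e = nrm_enlarge[OF v K(1,2)]
  have Kmono: "K n \<subseteq> K m" if "m \<le> n" for m n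
    using that by (rule lift_Suc_antimono_le[where f = K, OF K(3)])
  have sub: "s \<pi> ` sumset (nrm c) (K n) \<subseteq> sumset (nrm c') (K n')" if "(c, n) \<in> Q" "(c', n') \<in> Q" for c n c' n'
  proof -
    have "c \<in> \<sigma>" "c' \<in> \<sigma>" using that Q(1) by auto
    then have "s \<pi> ` nrm c \<subseteq> nrm c'" using b unfolding adjacent_def by blast
    moreover have "s \<pi> ` K n \<subseteq> K n'" using K(4)[of n] Kmono[of n' "Suc n"] comp[OF that] by blast
    ultimately show ?thesis unfolding linear_image_sumset[OF linear_scale_map] by (rule sumset_mono)
  qed
  have adj: "adjacent (sumset (nrm c) (K n)) (sumset (nrm c') (K n'))" if q: "(c, n) \<in> Q" "(c', n') \<in> Q" for c n c' n'
  proof -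
    have "sumset (nrm c) (K n) \<subseteq> sumset (nrm c') (K n') \<or> sumset (nrm c') (K n') \<subseteq> sumset (nrm c) (K n)"
      using comp[OF q] Kmono sumset_mono by meson
    then show ?thesis unfolding adjacent_def using sub[OF q] sub[OF q(2,1)] by blast
  qed
  have "(\<lambda>(v, n). enlarge (K n) v) ` Q \<in> building s R \<pi>"
  proof (rule building_supset)
    show "finite ((\<lambda>(v, n). enlarge (K n) v) ` Q)" "(\<lambda>(v, n). enlarge (K n) v) ` Q \<noteq> {}"
      using Q by auto
    fix c assume "c \<in> (\<lambda>(v, n). enlarge (K n) v) ` Q"
    then obtain u n where u: "(u, n) \<in> Q" "c = enlarge (K n) u" by auto
    show "is_vertex c" using e(1)[OF u(1)] u(2) by simp
    fix c' assume "c' \<in> (\<lambda>(v, n). enlarge (K n) v) ` Q"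
    then obtain u' n' where u': "(u', n') \<in> Q" "c' = enlarge (K n') u'" by auto
    show "adjacent (nrm c) (nrm c')"
      unfolding u(2) u'(2) e(2)[OF u(1)] e(2)[OF u'(1)] by (rule adj[OF u(1) u'(1)])
  qed
  moreover have "g ` nrm (enlarge (K n) u) = nrm (enlarge (K n) u)" if "(u, n) \<in> Q" for u n
  proof -
    have "u \<in> \<sigma>" using Q(1) that by auto
    then show ?thesis by (simp add: e(2)[OF that] linear_image_sumset[OF g(2)] g(3,4))
  qed
  then have "\<forall>c\<in>(\<lambda>(v, n). enlarge (K n) v) ` Q. g ` nrm c = nrm c" by auto
  moreover have "M \<subseteq> nrm (enlarge (K n) u)" if "(u, n) \<in> Q" for u n
    unfolding e(2)[OF that] by (rule M[OF that])
  then have "\<forall>c\<in>(\<lambda>(v, n). enlarge (K n) v) ` Q. M \<subseteq> nrm c" by auto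
  ultimately show ?thesis
    unfolding stabilised_complex_def using g(1) by blast
qed

text \<open>The common form of both deformations, with keys ordered by inclusion. In
  \<open>stab\<close> the element g may vary with the simplex but stabilises all \<open>K n\<close>
  at once, so that it remains a witness for every enlarged simplex.\<close>

lemma contractible_enlarge:
  fixes K :: "nat \<Rightarrow> 'w set" and G M
  defines "\<Delta> \<equiv> stabilised_complex G M"
  assumes lin: "\<And>g. g \<in> G \<Longrightarrow> Vector_Spaces.linear s s g"
    and stab: "\<And>\<sigma>. \<sigma> \<in> \<Delta> \<Longrightarrow> \<exists>g\<in>G. (\<forall>c\<in>\<sigma>. g ` nrm c = nrm c) \<and> (\<forall>n. g ` K n = K n)"
    and K: "\<And>n. fingen (K n)" "\<And>n. K n \<subseteq> L\<^sub>0" "\<And>n. K (Suc n) \<subseteq> K n" "\<And>n. s \<pi> ` K n \<subseteq> K (Suc n)"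
    and abs: "\<And>\<sigma> c. \<sigma> \<in> \<Delta> \<Longrightarrow> c \<in> \<sigma> \<Longrightarrow> \<exists>N. K N \<subseteq> nrm c"
    and sub: "\<Delta>' \<subseteq> \<Delta>" and target: "\<And>\<sigma>. \<sigma> \<in> \<Delta> \<Longrightarrow> \<exists>\<rho>\<in>\<Delta>'. enlarge (K 0) ` \<sigma> \<subseteq> \<rho>"
    and contr: "contractible_space (geometric_realization \<Delta>')"
  shows "contractible_space (geometric_realization \<Delta>)"
proof (rule contractible_realization_mass_flow[where key = nrm and \<phi> = "\<lambda>n. enlarge (K n)", OF _ _ _ _ sub target contr])
  have \<Delta>: "\<sigma> \<in> building s R \<pi>" "\<And>c. c \<in> \<sigma> \<Longrightarrow> M \<subseteq> nrm c" if "\<sigma> \<in> \<Delta>" for \<sigma>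
    using that by (auto simp: \<Delta>_def stabilised_complex_def)
  note b = building_subset[OF \<Delta>(1)]
  show "finite \<sigma>" if "\<sigma> \<in> \<Delta>" for \<sigma> using b[OF that] by blast
  show "nrm u \<subseteq> nrm v \<or> nrm v \<subseteq> nrm u" if "\<sigma> \<in> \<Delta>" "u \<in> \<sigma>" "v \<in> \<sigma>" for \<sigma> u v
    using b[OF that(1)] that(2,3) unfolding adjacent_def by blast
  show "\<exists>N. \<forall>n\<ge>N. enlarge (K n) v = v" if \<sigma>: "\<sigma> \<in> \<Delta>" "v \<in> \<sigma>" for \<sigma> v
  proof -
    obtain N where N: "K N \<subseteq> nrm v" using abs[OF \<sigma>] by blast
    have "enlarge (K n) v = v" if "N \<le> n" for n
    proof (rule enlarge_eq[OF _ fingen_rmod[OF K(1)]])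
      show "is_vertex v" using b[OF \<sigma>(1)] \<sigma>(2) by blast
      show "K n \<subseteq> nrm v" using lift_Suc_antimono_le[where f = K, OF K(3) that] N by blast
    qed
    then show ?thesis by blast
  qed
  fix \<sigma> w n assume \<sigma>: "\<sigma> \<in> \<Delta>" and w: "w \<in> \<sigma>"
  obtain g where g: "g \<in> G" "\<And>c. c \<in> \<sigma> \<Longrightarrow> g ` nrm c = nrm c" "\<And>n. g ` K n = K n"
    using stab[OF \<sigma>] by blast
  define U where "U = {v \<in> \<sigma>. nrm w \<subseteq> nrm v}"
  define D where "D = {v \<in> \<sigma>. nrm v \<subseteq> nrm w}"
  \<comment> \<open>The split vertex w occurs with both indices, the lattices above it with n and
    those below it with n + 1.\<close>
  define Q where "Q = U \<times> {n} \<union> D \<times> {Suc n}"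
  have tot: "nrm u \<subseteq> nrm v \<or> nrm v \<subseteq> nrm u" if "u \<in> \<sigma>" "v \<in> \<sigma>" for u v
    using b[OF \<sigma>] that unfolding adjacent_def by blast
  have "(\<lambda>(v, n). enlarge (K n) v) ` Q \<in> stabilised_complex G M"
  proof (rule enlarge_simplex[where K = K and g = g, OF \<Delta>(1)[OF \<sigma>] g(1) lin[OF g(1)] g(2,3) K])
    show "Q \<subseteq> \<sigma> \<times> UNIV" by (auto simp: Q_def U_def D_def)
    show "finite Q" using b[OF \<sigma>] by (auto simp: Q_def U_def D_def)
    show "Q \<noteq> {}" using w by (auto simp: Q_def U_def)
    show "M \<subseteq> sumset (nrm v) (K m)" if "(v, m) \<in> Q" for v m
    proof -
      have v: "v \<in> \<sigma>" using that by (auto simp: Q_def U_def D_def)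
      then have "is_vertex v" using b[OF \<sigma>] by blast
      then have "nrm v \<subseteq> sumset (nrm v) (K m)"
        by (intro submodule_sumset(2)[OF module_axioms, of R] lattice_rmod nrm_props fingen_rmod K)
      then show ?thesis using \<Delta>(2)[OF \<sigma> v] by blast
    qed
    show "(nrm v \<subseteq> nrm v' \<and> n' \<le> m \<or> nrm v' \<subseteq> nrm v \<and> m \<le> n') \<and> n' \<le> Suc m"
      if "(v, m) \<in> Q" "(v', n') \<in> Q" for v m v' n'
      using that tot[of v v'] unfolding Q_def U_def D_def by auto
  qed
  moreover have "enlarge (K n) ` U \<union> enlarge (K (Suc n)) ` D \<subseteq> (\<lambda>(v, n). enlarge (K n) v) ` Q"
    unfolding Q_def by force
  ultimately show "\<exists>\<rho>\<in>\<Delta>. enlarge (K n) ` {v \<in> \<sigma>. nrm w \<subseteq> nrm v} \<union> enlarge (K (Suc n)) ` {v \<in> \<sigma>. nrm v \<subseteq> nrm w} \<subseteq> \<rho>"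
    unfolding \<Delta>_def U_def D_def by blast
qed

lemma base_vertex: "normalised L\<^sub>0" "nrm (cls L\<^sub>0) = L\<^sub>0" "is_vertex (cls L\<^sub>0)"
proof -
  show n: "normalised L\<^sub>0"
    unfolding normalised_def
  proof (intro conjI subset_refl notI)
    assume sub: "L\<^sub>0 \<subseteq> s \<pi> ` L\<^sub>0"
    obtain c where "is_vertex c" using L\<^sub>0 is_vertex_def by blast
    from nrm_props(2)[OF this] obtain x where x: "x \<in> L\<^sub>0" "x \<notin> s \<pi> ` L\<^sub>0"
      unfolding normalised_def by blast
    then show False using sub by blast
  qed
  show "nrm (cls L\<^sub>0) = L\<^sub>0" "is_vertex (cls L\<^sub>0)" using nrm_cls[OF L\<^sub>0 n] by auto
qed

text \<open>With \<open>{}\<close> in place of M the containment condition is void. The part with M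
  in all lattices is contracted first, being the target of the other deformation. The second
  conclusion excludes the empty complex, which \<open>contractible_space\<close> admits.\<close>

theorem contractible_stabilised_complex:
  assumes lin: "\<And>g. g \<in> G \<Longrightarrow> Vector_Spaces.linear s s g"
    and M: "fingen M" "M \<subseteq> L\<^sub>0" "\<And>g x. g \<in> G \<Longrightarrow> x \<in> M \<Longrightarrow> g x = x"
    and g\<^sub>0: "g\<^sub>0 \<in> G" "\<And>L. rmod L \<Longrightarrow> M \<subseteq> L \<Longrightarrow> L \<subseteq> L\<^sub>0 \<Longrightarrow> g\<^sub>0 ` L = L"
  shows "contractible_space (geometric_realization (stabilised_complex G {}))"
    and "{cls L\<^sub>0} \<in> stabilised_complex G {}"
proof -
  note Mr = fingen_rmod[OF M(1)] and L\<^sub>0r = lattice_rmod[OF L\<^sub>0]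
  have L\<^sub>0f: "fingen L\<^sub>0" using L\<^sub>0 lattice_iff by blast
  note Ls = submodule_overD[OF L\<^sub>0r]
  have "{cls L\<^sub>0} \<in> building s R \<pi>"
    using scale_\<pi>_subset[OF L\<^sub>0r] by (intro building_supset) (auto simp: base_vertex adjacent_def)
  then have base: "{cls L\<^sub>0} \<in> stabilised_complex G M'" if "M' \<subseteq> L\<^sub>0" for M'
    using g\<^sub>0(1) g\<^sub>0(2)[OF L\<^sub>0r M(2) subset_refl] that unfolding stabilised_complex_def by (auto simp: base_vertex)
  then show "{cls L\<^sub>0} \<in> stabilised_complex G {}" by simp
  have pow_sub: "s (\<pi> ^ n) ` N \<subseteq> N" if "rmod N" for n N
    using submodule_overD(3)[OF that R_closed(7)[OF \<pi>R]] by blast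
  have pow_fg: "fingen (s (\<pi> ^ n) ` N)" if "fingen N" for n N
    by (rule linear_image_fingen[OF linear_scale_map that])
  have pow_Suc: "s \<pi> ` (s (\<pi> ^ n) ` N) = s (\<pi> ^ Suc n) ` N" for n N
    by (simp add: scale_powi_image)
  have vert: "is_vertex c" "nrm c \<subseteq> L\<^sub>0" if "\<sigma> \<in> stabilised_complex G M'" "c \<in> \<sigma>" for \<sigma> c M'
  proof -
    show "is_vertex c" using that building_subset unfolding stabilised_complex_def by blast
    then show "nrm c \<subseteq> L\<^sub>0" using nrm_props(2) by (simp add: normalised_def)
  qed
  have sumM: "M \<subseteq> sumset M (s (\<pi> ^ n) ` L\<^sub>0)" "s (\<pi> ^ n) ` L\<^sub>0 \<subseteq> sumset M (s (\<pi> ^ n) ` L\<^sub>0)"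
    "rmod (sumset M (s (\<pi> ^ n) ` L\<^sub>0))" "sumset M (s (\<pi> ^ n) ` L\<^sub>0) \<subseteq> L\<^sub>0" for n
  proof -
    note ss = submodule_sumset[OF module_axioms Mr fingen_rmod[OF pow_fg[OF L\<^sub>0f]]]
    show "M \<subseteq> sumset M (s (\<pi> ^ n) ` L\<^sub>0)" by (rule ss(2))
    show "s (\<pi> ^ n) ` L\<^sub>0 \<subseteq> sumset M (s (\<pi> ^ n) ` L\<^sub>0)" by (rule ss(3))
    show "rmod (sumset M (s (\<pi> ^ n) ` L\<^sub>0))" by (rule ss(1))
    show "sumset M (s (\<pi> ^ n) ` L\<^sub>0) \<subseteq> L\<^sub>0" by (rule ss(4)[OF L\<^sub>0r M(2) pow_sub[OF L\<^sub>0r]])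
  qed
  have "contractible_space (geometric_realization (stabilised_complex G M))"
  \<comment> \<open>The summand M keeps each \<open>K n\<close> between M and
    \<open>L\<^sub>0\<close>, where \<open>g\<^sub>0\<close> stabilises everything. At n = 0 all
    lattices become \<open>L\<^sub>0\<close>.\<close>
  proof (rule contractible_enlarge[where K = "\<lambda>n. sumset M (s (\<pi> ^ n) ` L\<^sub>0)" and \<Delta>' = "{{cls L\<^sub>0}}"])
    fix \<sigma> assume \<sigma>: "\<sigma> \<in> stabilised_complex G M"
    have Mc: "M \<subseteq> nrm c" if "c \<in> \<sigma>" for c using \<sigma> that by (auto simp: stabilised_complex_def)
    have "\<forall>c\<in>\<sigma>. g\<^sub>0 ` nrm c = nrm c"
      using vert[OF \<sigma>] Mc by (intro ballI g\<^sub>0(2) lattice_rmod nrm_props) auto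
    moreover have "\<forall>n. g\<^sub>0 ` sumset M (s (\<pi> ^ n) ` L\<^sub>0) = sumset M (s (\<pi> ^ n) ` L\<^sub>0)"
      using sumM by (intro allI g\<^sub>0(2))
    ultimately show "\<exists>g\<in>G. (\<forall>c\<in>\<sigma>. g ` nrm c = nrm c) \<and> (\<forall>n. g ` sumset M (s (\<pi> ^ n) ` L\<^sub>0) = sumset M (s (\<pi> ^ n) ` L\<^sub>0))"
      using g\<^sub>0(1) by blast
    show "\<exists>N. sumset M (s (\<pi> ^ N) ` L\<^sub>0) \<subseteq> nrm c" if "c \<in> \<sigma>" for c
    proof -
      have l: "lattice (nrm c)" by (rule nrm_props(3)[OF vert(1)[OF \<sigma> that]])
      obtain N where "s (\<pi> ^ N) ` L\<^sub>0 \<subseteq> nrm c" using absorb[OF l L\<^sub>0f] by blast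
      then have "sumset M (s (\<pi> ^ N) ` L\<^sub>0) \<subseteq> nrm c"
        by (intro submodule_sumset(4)[OF module_axioms Mr fingen_rmod[OF pow_fg[OF L\<^sub>0f]] lattice_rmod[OF l] Mc[OF that]])
      then show ?thesis by blast
    qed
    have "enlarge (sumset M (s (\<pi> ^ 0) ` L\<^sub>0)) c = cls L\<^sub>0" if c: "c \<in> \<sigma>" for c
    proof -
      note n = nrm_props[OF vert(1)[OF \<sigma> c]]
      have "sumset M (s (\<pi> ^ 0) ` L\<^sub>0) = L\<^sub>0" using sumM(2,4)[of 0] by auto
      moreover have "sumset (nrm c) L\<^sub>0 = L\<^sub>0"
        using submodule_sumset(3,4)[OF module_axioms lattice_rmod[OF n(3)] L\<^sub>0r] L\<^sub>0r vert(2)[OF \<sigma> c] by blast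
      ultimately show ?thesis by (simp add: enlarge_def)
    qed
    then show "\<exists>\<rho>\<in>{{cls L\<^sub>0}}. enlarge (sumset M (s (\<pi> ^ 0) ` L\<^sub>0)) ` \<sigma> \<subseteq> \<rho>" by auto
  next
    fix n
    show "fingen (sumset M (s (\<pi> ^ n) ` L\<^sub>0))" by (intro fingen_sumset M pow_fg L\<^sub>0f)
    show "sumset M (s (\<pi> ^ n) ` L\<^sub>0) \<subseteq> L\<^sub>0" by (rule sumM)
    show "sumset M (s (\<pi> ^ Suc n) ` L\<^sub>0) \<subseteq> sumset M (s (\<pi> ^ n) ` L\<^sub>0)"
      by (intro sumset_mono subset_refl scale_power_mono L\<^sub>0r) simp
    show "s \<pi> ` sumset M (s (\<pi> ^ n) ` L\<^sub>0) \<subseteq> sumset M (s (\<pi> ^ Suc n) ` L\<^sub>0)"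
      unfolding linear_image_sumset[OF linear_scale_map] pow_Suc
      by (intro sumset_mono subset_refl scale_\<pi>_subset Mr)
  qed (use lin base[OF M(2)] contractible_realization_singleton in auto)
  then show "contractible_space (geometric_realization (stabilised_complex G {}))"
  \<comment> \<open>Every g in G fixes \<pi>^n M pointwise, so each simplex keeps its own g.\<close>
  proof (rule contractible_enlarge[where K = "\<lambda>n. s (\<pi> ^ n) ` M", rotated -1])
    have gM: "g ` (s (\<pi> ^ n) ` M) = s (\<pi> ^ n) ` M" if "g \<in> G" for g n
    proof -
      interpret g: Vector_Spaces.linear s s g by (rule lin[OF that])
      show ?thesis using M(3)[OF that] by (force simp: g.scale image_iff)
    qed
    fix \<sigma> assume \<sigma>: "\<sigma> \<in> stabilised_complex G {}"
    then obtain g where g: "g \<in> G" "\<And>c. c \<in> \<sigma> \<Longrightarrow> g ` nrm c = nrm c" unfolding stabilised_complex_def by blast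
    then show "\<exists>g\<in>G. (\<forall>c\<in>\<sigma>. g ` nrm c = nrm c) \<and> (\<forall>n. g ` (s (\<pi> ^ n) ` M) = s (\<pi> ^ n) ` M)"
      using gM by blast
    show "\<exists>N. s (\<pi> ^ N) ` M \<subseteq> nrm c" if "c \<in> \<sigma>" for c
      using absorb[OF nrm_props(3)[OF vert(1)[OF \<sigma> that]] M(1)] by blast
    have b: "\<sigma> \<in> building s R \<pi>" using \<sigma> by (simp add: stabilised_complex_def)
    note bs = building_subset[OF b]
    \<comment> \<open>At index 0 each enlarged lattice contains M, so \<sigma> ends in the
      subcomplex.\<close>
    have "(\<lambda>(v, n). enlarge (s (\<pi> ^ n) ` M) v) ` (\<sigma> \<times> {0}) \<in> stabilised_complex G M"
    proof (rule enlarge_simplex[OF b g(1) lin[OF g(1)] g(2) gM[OF g(1)]])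
      show "M \<subseteq> sumset (nrm v) (s (\<pi> ^ n) ` M)" if "(v, n) \<in> \<sigma> \<times> {0}" for v n
        using that submodule_sumset(3)[OF module_axioms lattice_rmod[OF nrm_props(3)[OF vert(1)[OF \<sigma>, of v]]] Mr] by auto
      show "(nrm v \<subseteq> nrm v' \<and> n' \<le> n \<or> nrm v' \<subseteq> nrm v \<and> n \<le> n') \<and> n' \<le> Suc n"
        if "(v, n) \<in> \<sigma> \<times> {0}" "(v', n') \<in> \<sigma> \<times> {0}" for v n v' n'
        using that bs by (auto simp: adjacent_def)
      show "s (\<pi> ^ n) ` M \<subseteq> L\<^sub>0" "s (\<pi> ^ Suc n) ` M \<subseteq> s (\<pi> ^ n) ` M"
        "s \<pi> ` s (\<pi> ^ n) ` M \<subseteq> s (\<pi> ^ Suc n) ` M" "fingen (s (\<pi> ^ n) ` M)" for n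
        using pow_sub[OF Mr, of n] M(2) scale_power_mono[OF Mr, of n "Suc n"] pow_Suc[of n M] pow_fg[OF M(1)] by auto
    qed (use bs in auto)
    then show "\<exists>\<rho>\<in>stabilised_complex G M. enlarge (s (\<pi> ^ 0) ` M) ` \<sigma> \<subseteq> \<rho>"
      by (rule bexI[rotated]) force
  next
    fix n
    show "fingen (s (\<pi> ^ n) ` M)" by (rule pow_fg[OF M(1)])
    show "s (\<pi> ^ n) ` M \<subseteq> L\<^sub>0" using pow_sub[OF Mr, of n] M(2) by blast
    show "s (\<pi> ^ Suc n) ` M \<subseteq> s (\<pi> ^ n) ` M" by (intro scale_power_mono Mr) simp
    show "s \<pi> ` s (\<pi> ^ n) ` M \<subseteq> s (\<pi> ^ Suc n) ` M" unfolding pow_Suc by simp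
  qed (use lin in \<open>auto simp: stabilised_complex_def\<close>)
qed

end

section \<open>Passage to the complex of the theorem\<close>

lemma (in lattice_base) image_vertex_iff:
  assumes c: "is_vertex c" and g: "Vector_Spaces.linear s s g"
  shows "(\<forall>L\<in>c. g ` L = L) \<longleftrightarrow> g ` nrm c = nrm c"
proof
  interpret g: Vector_Spaces.linear s s g by (rule g)
  show "g ` nrm c = nrm c" if "\<forall>L\<in>c. g ` L = L" using that nrm_props(1)[OF c] by blast
  assume n: "g ` nrm c = nrm c"
  show "\<forall>L\<in>c. g ` L = L"
  proof
    fix L assume "L \<in> c"
    then obtain k where L: "L = s (\<pi> powi k) ` nrm c"
      using nrm_props(4)[OF c] mem_cls_iff by metis
    have "g ` L = s (\<pi> powi k) ` (g ` nrm c)"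
      unfolding L image_image by (simp add: g.scale)
    then show "g ` L = L" using n L by simp
  qed
qed

theorem mainTheorem4:
  fixes F R A I :: "'k::field set" and \<pi> :: 'k
    and scale :: "'k \<Rightarrow> 'w::ab_group_add \<Rightarrow> 'w" and r :: nat and P W\<^sub>1 :: "'w set"
    and \<Gamma> :: "('w \<Rightarrow> 'w) set"
  assumes "curve_function_field F"
    and "closed_point F R"
    and "A = regular_outside F R"
    and "uniformizer R \<pi>"
    and "vector_space scale"
    and "vector_space.dim scale (UNIV :: 'w set) = r" and "r \<ge> 2"
    and "projective_over scale A P" and "module_rank scale P = r"
    and "module.span scale P = UNIV"
    and "submodule_over (*) A I" and "I \<subset> A" and "I \<noteq> {0}"
    and "\<Gamma> = congruence_subgroup scale A P I"
    and "module.subspace scale W\<^sub>1" and "{0} \<subset> W\<^sub>1" and "W\<^sub>1 \<subset> UNIV"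
  shows "contractible_space (geometric_realization (fixed_subcomplex scale R \<pi> P \<Gamma> W\<^sub>1))
       \<and> topspace (geometric_realization (fixed_subcomplex scale R \<pi> P \<Gamma> W\<^sub>1)) \<noteq> {}"
proof -
  note vs = \<open>vector_space scale\<close> and cf = assms(1) and cp = assms(2) and un = assms(4)
  interpret V: vector_space scale by (rule vs)
  have A: "subring_of_field A" unfolding assms(3) by (rule subring_regular_outside)
  note As = subring_of_fieldD[OF A] and Is = submodule_overD[OF assms(11)]
  have Psub: "submodule_over scale A P" using assms(8) by (simp add: projective_over_def)
  note Ps = submodule_overD[OF Psub]
  obtain a where a: "a \<in> I" "a \<noteq> 0" using Is(1) assms(13) by blast
  \<comment> \<open>A non-zero element of a proper ideal is a non-unit; it serves as the
    non-constant function in \<open>fraction_field_regular_outside\<close>.\<close>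
  have "inverse a \<notin> A"
  proof
    assume "inverse a \<in> A"
    then have "1 \<in> I" using Is(3)[of "inverse a" a] a by simp
    then have "x \<in> I" if "x \<in> A" for x using Is(3)[OF that] by force
    then show False using assms(12) by blast
  qed
  then have frac: "\<exists>b\<in>A. b \<noteq> 0 \<and> b * y \<in> A" for y
    using fraction_field_regular_outside[OF cf assms(3)] a assms(12) by blast
  obtain f w where f: "Vector_Spaces.linear scale (*) f" "\<And>x. x \<in> W\<^sub>1 \<Longrightarrow> f x = 0" "\<exists>x\<in>P. f x \<noteq> 0"
    and w: "w \<in> W\<^sub>1" "w \<noteq> 0" "\<And>x. x \<in> P \<Longrightarrow> scale (f x) w \<in> ideal_mult scale A I P"
    by (rule transvection_exists[OF vs A frac assms(8,10) _ assms(11) a assms(15)])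
       (use assms in auto)
  interpret f: Vector_Spaces.linear scale "(*)" f by (rule f(1))
  define h where "h x = scale (f x) w" for x
  have h: "Vector_Spaces.linear scale scale h"
    by unfold_locales (simp_all add: h_def f.add f.scale V.scale_left_distrib)
  interpret h: Vector_Spaces.linear scale scale h by (rule h)
  \<comment> \<open>As w lies in \<open>W\<^sub>1\<close>, where f vanishes, h squares to zero and 1
    - h is inverse to 1 + h.\<close>
  have hh: "h (h x) = 0" for x using f(2)[OF w(1)] by (simp add: h_def f.scale)
  have hW: "h x = 0" if "x \<in> W\<^sub>1" for x using f(2)[OF that] by (simp add: h_def)
  have Wh: "h x \<in> W\<^sub>1" for x unfolding h_def using assms(15) w(1) by (rule V.subspace_scale)
  have "ideal_mult scale A I P \<subseteq> P"
    unfolding ideal_mult_def using Ps(3) assms(12) by (intro module_span_minimal Psub) auto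
  then have hP: "h x \<in> P" if "x \<in> P" for x using w(3)[OF that] by (auto simp: h_def)

  obtain B where "B \<subseteq> UNIV" "V.independent B" "UNIV \<subseteq> V.span B" "card B = V.dim UNIV"
    by (rule V.basis_exists)
  then have B: "V.independent B" "V.span B = UNIV" "card B = r" using assms(6) by auto
  have finB: "finite B" using B(3) assms(7) by (intro card_ge_0_finite) simp
  interpret lattice_setting scale B R \<pi>
  proof unfold_locales
    show "subring_of_field R" by (rule closed_pointD(1)[OF cp])
    show "\<exists>n. \<pi> ^ n * x \<in> R" for x by (rule uniformizer_archimedean[OF cf cp un])
    show "B \<noteq> {}" using B(3) assms(7) by auto
  qed (use finB B uniformizerD[OF cp un] in auto)
  define N where "N = module_span scale R B"
  \<comment> \<open>Adding h N, which h kills, makes the lattice stable under h.\<close>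
  define L\<^sub>0 where "L\<^sub>0 = sumset N (h ` N)"
  have N: "fingen N" unfolding N_def fin_gen_over_def using finB by blast
  note Nr = fingen_rmod[OF N] and hN = linear_image_fingen[OF h N]
  note ss = submodule_sumset[OF V.module_axioms Nr fingen_rmod[OF hN], folded L\<^sub>0_def]
  have "B \<subseteq> L\<^sub>0" using module_span_superset[of B scale R] ss(2) by (auto simp: N_def)
  then have "V.span L\<^sub>0 = UNIV" using B(2) V.span_mono by blast
  then have L\<^sub>0: "lattice L\<^sub>0" unfolding lattice_iff using fingen_sumset[OF N hN] by (simp add: L\<^sub>0_def)
  interpret lattice_base scale B R \<pi> L\<^sub>0 by unfold_locales (rule L\<^sub>0)
  have "h x \<in> h ` N" if "x \<in> L\<^sub>0" for x
    using that unfolding L\<^sub>0_def sumset_def by (auto simp: h.add hh)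
  then have M: "h ` L\<^sub>0 \<subseteq> L\<^sub>0" using ss(3) by blast

  \<comment> \<open>The conditions on g in \<open>fixed_subcomplex\<close> that do not mention the
    simplex, imposed on K-linear extensions to W.\<close>
  define G where "G = {g. Vector_Spaces.linear scale scale g \<and> (\<forall>x\<in>W\<^sub>1. g x = x) \<and>
    (\<exists>\<gamma>\<in>\<Gamma> - {restrict id P}. \<forall>x\<in>P. g x = \<gamma> x)}"
  define g\<^sub>0 where "g\<^sub>0 x = x + h x" for x
  have inv: "g\<^sub>0 (x - h x) = x" "g\<^sub>0 x - h (g\<^sub>0 x) = x" for x
    by (simp_all add: g\<^sub>0_def h.diff h.add hh)
  have minus: "x - h x \<in> Q" if "x \<in> Q" "h x \<in> Q" "submodule_over scale S Q" "- 1 \<in> S" for x Q S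
    using submodule_overD(2)[OF that(3,1) submodule_overD(3)[OF that(3,4,2)]] by simp
  have lin\<^sub>0: "Vector_Spaces.linear scale scale g\<^sub>0"
    by unfold_locales (simp_all add: g\<^sub>0_def h.add h.scale V.scale_right_distrib algebra_simps)
  have "restrict g\<^sub>0 P \<in> \<Gamma>"
    unfolding assms(14) congruence_subgroup_def module_Aut_def mem_Collect_eq
  proof (intro conjI ballI)
    have "g\<^sub>0 ` P \<subseteq> P" using Ps(2) hP by (auto simp: g\<^sub>0_def)
    moreover have "(\<lambda>x. x - h x) ` P \<subseteq> P" using As(2,4) by (auto intro!: minus[OF _ _ Psub] hP)
    ultimately have "bij_betw g\<^sub>0 P P"
      using inv by (intro bij_betw_byWitness[where f' = "\<lambda>x. x - h x"]) auto
    then show "bij_betw (restrict g\<^sub>0 P) P P"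
      by (rule iffD1[OF bij_betw_cong, rotated]) simp
    show "linear_over A P scale scale (restrict g\<^sub>0 P)"
      unfolding linear_over_def using Ps
      by (simp add: g\<^sub>0_def h.add h.scale V.scale_right_distrib algebra_simps)
    show "restrict g\<^sub>0 P x - x \<in> ideal_mult scale A I P" if "x \<in> P" for x
      using w(3)[OF that] that by (simp add: g\<^sub>0_def h_def)
  qed simp
  moreover have "restrict g\<^sub>0 P \<noteq> restrict id P"
  proof
    assume eq: "restrict g\<^sub>0 P = restrict id P"
    obtain x where x: "x \<in> P" "f x \<noteq> 0" using f(3) by blast
    then have "g\<^sub>0 x = x" using fun_cong[OF eq, of x] by simp
    then show False using x(2) w(2) by (simp add: g\<^sub>0_def h_def)
  qed
  ultimately have g\<^sub>0G: "g\<^sub>0 \<in> G"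
    unfolding G_def using lin\<^sub>0 by (auto simp: g\<^sub>0_def hW intro!: bexI[of _ "restrict g\<^sub>0 P"])
  \<comment> \<open>Since h L \<subseteq> h \<open>L\<^sub>0\<close> \<subseteq> L, both 1 + h and
    its inverse 1 - h map L into itself.\<close>
  have stab\<^sub>0: "g\<^sub>0 ` L = L" if L: "rmod L" "h ` L\<^sub>0 \<subseteq> L" "L \<subseteq> L\<^sub>0" for L
  proof
    have hL: "h x \<in> L" if "x \<in> L" for x using L(2,3) that by blast
    show "g\<^sub>0 ` L \<subseteq> L" using submodule_overD(2)[OF L(1)] hL by (auto simp: g\<^sub>0_def)
    show "L \<subseteq> g\<^sub>0 ` L"
    proof
      fix x assume x: "x \<in> L"
      have "x - h x \<in> L" by (rule minus[OF x hL[OF x] L(1)]) (intro R_closed)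
      then show "x \<in> g\<^sub>0 ` L" using inv(1)[of x] by (metis imageI)
    qed
  qed
  have "fingen L\<^sub>0" using L\<^sub>0 by (simp add: lattice_iff)
  note main = contractible_stabilised_complex[of G "h ` L\<^sub>0" g\<^sub>0, OF _ linear_image_fingen[OF h this] M _ g\<^sub>0G stab\<^sub>0]
  have "contractible_space (geometric_realization (stabilised_complex G {}))"
    and base: "{cls L\<^sub>0} \<in> stabilised_complex G {}"
    \<comment> \<open>The image of h lies in \<open>W\<^sub>1\<close>, so all of G fixes it
      pointwise.\<close>
    by (rule main; use Wh in \<open>auto simp: G_def\<close>)+
  moreover have eq: "fixed_subcomplex scale R \<pi> P \<Gamma> W\<^sub>1 = stabilised_complex G {}"
  proof (rule set_eqI)
    fix \<sigma>
    show "\<sigma> \<in> fixed_subcomplex scale R \<pi> P \<Gamma> W\<^sub>1 \<longleftrightarrow> \<sigma> \<in> stabilised_complex G {}"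
    proof (cases "\<sigma> \<in> building scale R \<pi>")
      case True
      then have v: "is_vertex c" if "c \<in> \<sigma>" for c using building_subset that by blast
      have iff: "(\<forall>v\<in>\<sigma>. \<forall>L\<in>v. g ` L = L) \<longleftrightarrow> (\<forall>c\<in>\<sigma>. g ` nrm c = nrm c)"
        if "Vector_Spaces.linear scale scale g" for g
        by (intro ball_cong refl image_vertex_iff[OF v that])
      have "\<sigma> \<in> fixed_subcomplex scale R \<pi> P \<Gamma> W\<^sub>1 \<longleftrightarrow> (\<exists>g\<in>G. \<forall>v\<in>\<sigma>. \<forall>L\<in>v. g ` L = L)"
      proof
        assume "\<sigma> \<in> fixed_subcomplex scale R \<pi> P \<Gamma> W\<^sub>1"
        then obtain \<gamma> g where "\<gamma> \<in> \<Gamma> - {restrict id P}" "Vector_Spaces.linear scale scale g"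
          "\<forall>x\<in>P. g x = \<gamma> x" "\<forall>v\<in>\<sigma>. \<forall>L\<in>v. g ` L = L" "\<forall>x\<in>W\<^sub>1. g x = x"
          unfolding fixed_subcomplex_def mem_Collect_eq by (elim conjE bexE exE)
        then show "\<exists>g\<in>G. \<forall>v\<in>\<sigma>. \<forall>L\<in>v. g ` L = L"
          unfolding G_def by (intro bexI[of _ g]) auto
      next
        assume "\<exists>g\<in>G. \<forall>v\<in>\<sigma>. \<forall>L\<in>v. g ` L = L"
        then obtain g where "g \<in> G" "\<forall>v\<in>\<sigma>. \<forall>L\<in>v. g ` L = L" by (elim bexE)
        moreover from this(1) obtain \<gamma> where "\<gamma> \<in> \<Gamma> - {restrict id P}" "\<forall>x\<in>P. g x = \<gamma> x"
          unfolding G_def by auto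
        ultimately show "\<sigma> \<in> fixed_subcomplex scale R \<pi> P \<Gamma> W\<^sub>1"
          unfolding fixed_subcomplex_def G_def mem_Collect_eq using True
          by (intro conjI bexI[of _ \<gamma>] exI[of _ g]) auto
      qed
      also have "\<dots> \<longleftrightarrow> (\<exists>g\<in>G. \<forall>c\<in>\<sigma>. g ` nrm c = nrm c)"
        using iff by (intro bex_cong refl) (simp add: G_def)
      also have "\<dots> \<longleftrightarrow> \<sigma> \<in> stabilised_complex G {}"
        unfolding stabilised_complex_def using True by simp
      finally show ?thesis .
    qed (simp add: fixed_subcomplex_def stabilised_complex_def)
  qed
  moreover have "(\<lambda>v. if v = cls L\<^sub>0 then 1 else 0) \<in> realization_simplex {cls L\<^sub>0}"
    by (simp add: realization_simplex_def)
  ultimately show ?thesis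
    unfolding topspace_geometric_realization eq using base by blast
qed

end
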